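(* Let $1\le k\le n$ and let $M(n,k)=\mathrm{St}(n,k)\times_{O(k)}\mathrm{Sym}^+(k)=\big(\mathrm{St}(n,k)\times\mathrm{Sym}^+(k)\big)/O(k)$. Then the map $$\phi: M(n,k)\to \mathrm{Sym}^+(n,k),\qquad [Q,D]\mapsto QDQ^\top,$$ is a global diffeomorphism of fiber bundles over $\mathrm{Gr}(k,n)$; that is, $\phi$ is a diffeomorphism and $\pi_{\mathrm{Sym}}\circ\phi=\pi_M$. In particular, each fiber of $\pi_{\mathrm{Sym}}:\mathrm{Sym}^+(n,k)\to\mathrm{Gr}(k,n)$ is diffeomorphic to $\mathrm{Sym}^+(k)$.
   Context: $\mathrm{St}(n,k)$ is the Stiefel manifold of real $n\times k$ matrices $Q$ with $Q^\top Q=I_k$; $O(k)$ is the orthogonal group; $\mathrm{Gr}(k,n)$ is the Grassmann manifold of $k$-dimensional subspaces of $\mathbb{R}^n$; $\mathrm{Sym}(n)$ is the space of real symmetric $n\times n$ matrices; $\mathrm{Sym}^+(k)$ is the open set of symmetric positive definite $k\times k$ matrices. $\mathrm{Sym}^+(n,k)=\{\Sigma\in\mathrm{Sym}(n): \Sigma\succeq 0,\ \mathrm{rk}(\Sigma)=k\}$ is the smooth (embedded) submanifold of $\mathrm{Sym}(n)$ of positive semidefinite matrices of rank $k$. $O(k)$ acts smoothly, freely and properly on the right of $\mathrm{St}(n,k)\times\mathrm{Sym}^+(k)$ by $(Q,D)\cdot G=(QG,G^\top DG)$. The quotient is $M(n,k)$, with the unique smooth structure making the quotient map $(Q,D)\mapsto[Q,D]$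 a smooth submersion. The bundle projections are $\pi_M:M(n,k)\to\mathrm{Gr}(k,n)$, $\pi_M([Q,D])=\mathrm{Span}(Q)$ (column span of $Q$), and $\pi_{\mathrm{Sym}}:\mathrm{Sym}^+(n,k)\to\mathrm{Gr}(k,n)$, $\pi_{\mathrm{Sym}}(\Sigma)=\mathrm{Im}(\Sigma)$ (column space of $\Sigma$). *)

theory Defs
  imports "HOL-Analysis.Analysis"
begin

section \<open>Smooth maps between Euclidean spaces\<close>

text \<open>For open \<open>S\<close>, \<open>C_times m S f\<close> says that \<open>f\<close> is of class \<open>C\<^sup>m\<close> on \<open>S\<close>: all iterated
  directional derivatives up to order \<open>m\<close> exist and are continuous.\<close>

primrec C_times ::
  "nat \<Rightarrow> 'a::euclidean_space set \<Rightarrow> ('a \<Rightarrow> 'b::euclidean_space) \<Rightarrow> bool" where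
  "C_times 0 S f \<longleftrightarrow> continuous_on S f"
| "C_times (Suc m) S f \<longleftrightarrow>
     (\<forall>x\<in>S. f differentiable (at x)) \<and>
     (\<forall>v. C_times m S (\<lambda>x. frechet_derivative f (at x) v))"

definition smooth_on_open ::
  "'a::euclidean_space set \<Rightarrow> ('a \<Rightarrow> 'b::euclidean_space) \<Rightarrow> bool" where
  "smooth_on_open S f \<longleftrightarrow> open S \<and> (\<forall>m. C_times m S f)"

text \<open>Smoothness on an arbitrary subset of a Euclidean space: local smooth extendability.\<close>

definition smooth_on_subset ::
  "'a::euclidean_space set \<Rightarrow> ('a \<Rightarrow> 'b::euclidean_space) \<Rightarrow> bool" where
  "smooth_on_subset S f \<longleftrightarrow>
     (\<forall>x\<in>S. \<exists>U F. x \<in> U \<and> smooth_on_open U F \<and> (\<forall>y\<in>U \<inter> S. F y = f y))"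


section \<open>Smooth manifolds\<close>

text \<open>A manifold is a topology together with a maximal smooth atlas. A chart is a pair of its
  domain and a total_space function whose values outside the domain are irrelevant. The charts take
  values in open subsets of a fixed Euclidean space \<open>'e\<close>, so that \<open>DIM('e)\<close> is the dimension.\<close>

type_synonym ('m, 'e) chart = "'m set \<times> ('m \<Rightarrow> 'e)"
type_synonym ('m, 'e) mfd = "'m topology \<times> ('m, 'e) chart set"

definition is_chart :: "'m topology \<Rightarrow> ('m, 'e::euclidean_space) chart \<Rightarrow> bool" where
  "is_chart X = (\<lambda>(U, f).
     openin X U \<and> open (f ` U) \<and>
     homeomorphic_map (subtopology X U) (top_of_set (f ` U)) f)"

definition compatible :: "('m, 'e::euclidean_space) chart \<Rightarrow> ('m, 'e) chart \<Rightarrow> bool" where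
  "compatible = (\<lambda>(U, f) (V, g).
     smooth_on_open (f ` (U \<inter> V)) (g \<circ> inv_into U f) \<and>
     smooth_on_open (g ` (U \<inter> V)) (f \<circ> inv_into V g))"

definition smooth_structure :: "'m topology \<Rightarrow> ('m, 'e::euclidean_space) chart set \<Rightarrow> bool" where
  "smooth_structure X A \<longleftrightarrow>
     (\<forall>c\<in>A. is_chart X c) \<and>
     (\<Union>c\<in>A. fst c) = topspace X \<and>
     (\<forall>c\<in>A. \<forall>c'\<in>A. compatible c c') \<and>
     (\<forall>c. is_chart X c \<and> (\<forall>c'\<in>A. compatible c c') \<longrightarrow> c \<in> A)"

definition second_countable :: "'m topology \<Rightarrow> bool" where
  "second_countable X \<longleftrightarrow>
     (\<exists>\<B>. countable \<B> \<and> (\<forall>B\<in>\<B>. openin X B) \<and>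
          (\<forall>U x. openin X U \<and> x \<in> U \<longrightarrow> (\<exists>B\<in>\<B>. x \<in> B \<and> B \<subseteq> U)))"

definition smooth_manifold :: "('m, 'e::euclidean_space) mfd \<Rightarrow> bool" where
  "smooth_manifold = (\<lambda>(X, A).
     Hausdorff_space X \<and> second_countable X \<and> smooth_structure X A)"

definition smooth_map ::
  "('m, 'e::euclidean_space) mfd \<Rightarrow> ('p, 'd::euclidean_space) mfd \<Rightarrow> ('m \<Rightarrow> 'p) \<Rightarrow> bool" where
  "smooth_map = (\<lambda>(X, A) (Y, B) F.
     F \<in> topspace X \<rightarrow> topspace Y \<and>
     (\<forall>p\<in>topspace X. \<exists>(U, f)\<in>A. \<exists>(V, g)\<in>B.
        p \<in> U \<and> F ` U \<subseteq> V \<and> smooth_on_open (f ` U) (g \<circ> F \<circ> inv_into U f)))"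

text \<open>The differential of \<open>F\<close> at \<open>p\<close>, read in charts around \<open>p\<close> and \<open>F p\<close>, is onto.\<close>

definition smooth_submersion ::
  "('m, 'e::euclidean_space) mfd \<Rightarrow> ('p, 'd::euclidean_space) mfd \<Rightarrow> ('m \<Rightarrow> 'p) \<Rightarrow> bool" where
  "smooth_submersion M N F \<longleftrightarrow>
     smooth_map M N F \<and>
     (\<forall>p\<in>topspace (fst M). \<forall>(U, f)\<in>snd M. \<forall>(V, g)\<in>snd N.
        p \<in> U \<and> F p \<in> V \<longrightarrow>
          surj (frechet_derivative (g \<circ> F \<circ> inv_into U f) (at (f p))))"

definition diffeomorphism ::
  "('m, 'e::euclidean_space) mfd \<Rightarrow> ('p, 'd::euclidean_space) mfd \<Rightarrow> ('m \<Rightarrow> 'p) \<Rightarrow> bool" where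
  "diffeomorphism M N F \<longleftrightarrow>
     smooth_manifold M \<and> smooth_manifold N \<and>
     bij_betw F (topspace (fst M)) (topspace (fst N)) \<and>
     smooth_map M N F \<and> smooth_map N M (inv_into (topspace (fst M)) F)"

definition diffeomorphic ::
  "('m, 'e::euclidean_space) mfd \<Rightarrow> ('p, 'd::euclidean_space) mfd \<Rightarrow> bool" where
  "diffeomorphic M N \<longleftrightarrow> (\<exists>F. diffeomorphism M N F)"

text \<open>The structure induced on a subset \<open>S\<close> of a Euclidean space: subspace topology, and as charts
  all diffeomorphisms from relatively open subsets of \<open>S\<close> onto open subsets of \<open>'e\<close>.
  \<open>S\<close> is an embedded submanifold of dimension \<open>DIM('e)\<close> iff the domains of these charts cover
  \<open>S\<close>, and then the charts form precisely the maximal atlas of the submanifold structure.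
  Covering is not built in here; it is part of \<^const>\<open>smooth_manifold\<close>.\<close>

definition submanifold ::
  "'a::euclidean_space set \<Rightarrow> ('a, 'e::euclidean_space) mfd" where
  "submanifold S =
     (top_of_set S,
      {(U, f). openin (top_of_set S) U \<and> inj_on f U \<and>
               smooth_on_subset U f \<and> smooth_on_open (f ` U) (inv_into U f)})"


section \<open>Matrix spaces\<close>

definition stiefel :: "(real^'k^'n) set" where
  "stiefel = {Q. transpose Q ** Q = mat 1}"

definition spd :: "(real^'k^'k) set" where
  "spd = {D. transpose D = D \<and> (\<forall>x. x \<noteq> 0 \<longrightarrow> 0 < x \<bullet> (D *v x))}"

definition psd_rank :: "nat \<Rightarrow> (real^'n^'n) set" where
  "psd_rank r = {S. transpose S = S \<and> (\<forall>x. 0 \<le> x \<bullet> (S *v x)) \<and> rank S = r}"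

definition grassmannian :: "nat \<Rightarrow> (real^'n) set set" where
  "grassmannian r = {V. subspace V \<and> dim V = r}"

text \<open>An index type with \<open>k (n - k) + k (k + 1) / 2\<close> elements where \<open>n = CARD('n)\<close>,
  \<open>k = CARD('k)\<close>. For \<open>k \<le> n\<close> this is the dimension of the manifold of positive semidefinite
  \<open>n \<times> n\<close> matrices of rank \<open>k\<close>; for \<open>'n = 'k\<close> it is the dimension \<open>k (k + 1) / 2\<close> of the
  space of symmetric \<open>k \<times> k\<close> matrices.\<close>

typedef ('n::finite, 'k::finite) psd_dim =
  "{..<CARD('k) * (CARD('n) - CARD('k)) + CARD('k) * (CARD('k) + 1) div 2}"
  morphisms psd_dim_nat Abs_psd_dim
proof -
  have "CARD('k) \<ge> 1"
    by (simp add: Suc_le_eq)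
  then have "CARD('k) * (CARD('k) + 1) \<ge> 1 * 2"
    by (intro mult_mono) auto
  then have "CARD('k) * (CARD('k) + 1) div 2 > 0"
    by linarith
  then show ?thesis
    by (intro exI[of _ 0]) simp
qed

lemma card_psd_dim_aux:
  "finite (UNIV :: ('n::finite, 'k::finite) psd_dim set) \<and>
   CARD(('n, 'k) psd_dim) = CARD('k) * (CARD('n) - CARD('k)) + CARD('k) * (CARD('k) + 1) div 2"
proof -
  let ?A = "{..<CARD('k) * (CARD('n) - CARD('k)) + CARD('k) * (CARD('k) + 1) div 2}"
  have "inj_on (Abs_psd_dim :: nat \<Rightarrow> ('n, 'k) psd_dim) ?A"
    by (auto simp: inj_on_def Abs_psd_dim_inject)
  moreover have "(UNIV :: ('n, 'k) psd_dim set) = Abs_psd_dim ` ?A"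
    by (rule type_definition.univ[OF type_definition_psd_dim])
  ultimately show ?thesis
    by (metis card_image card_lessThan finite_imageI finite_lessThan)
qed

instance psd_dim :: (finite, finite) finite
  by standard (simp add: card_psd_dim_aux)

lemma card_psd_dim:
  "CARD(('n::finite, 'k::finite) psd_dim) =
     CARD('k) * (CARD('n) - CARD('k)) + CARD('k) * (CARD('k) + 1) div 2"
  by (simp add: card_psd_dim_aux)


section \<open>The quotient \<open>M(n,k)\<close>\<close>

abbreviation total_space :: "((real^'k^'n) \<times> (real^'k^'k)) set" where
  "total_space \<equiv> stiefel \<times> spd"

text \<open>The dimension of the total space is
  \<open>(n k - k (k + 1) / 2) + k (k + 1) / 2 = n k\<close>, hence the model space below.\<close>

definition total_mfd :: "((real^'k^'n) \<times> (real^'k^'k), real^'k^'n) mfd" where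
  "total_mfd = submanifold total_space"

definition act :: "(real^'k^'n) \<times> (real^'k^'k) \<Rightarrow> real^'k^'k \<Rightarrow> (real^'k^'n) \<times> (real^'k^'k)" where
  "act = (\<lambda>(Q, D) G. (Q ** G, transpose G ** D ** G))"

definition orbit_rel :: "((real^'k^'n) \<times> (real^'k^'k)) rel" where
  "orbit_rel = {(p, act p G) | p G. p \<in> total_space \<and> orthogonal_matrix G}"

definition M_set :: "((real^'k^'n) \<times> (real^'k^'k)) set set" where
  "M_set = total_space // orbit_rel"

definition cls :: "(real^'k^'n) \<times> (real^'k^'k) \<Rightarrow> ((real^'k^'n) \<times> (real^'k^'k)) set" where
  "cls p = orbit_rel `` {p}"

definition M_top :: "((real^'k^'n) \<times> (real^'k^'k)) set topology" where
  "M_top = topology (\<lambda>U. U \<subseteq> M_set \<and> openin (top_of_set total_space) {p \<in> total_space. cls p \<in> U})"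

definition M_mfd ::
  "(((real^'k::finite^'n::finite) \<times> (real^'k^'k)) set, real^('n, 'k) psd_dim) mfd" where
  "M_mfd = (M_top, THE A. smooth_manifold (M_top, A) \<and>
                          smooth_submersion total_mfd (M_top, A) cls)"

definition psd_mfd :: "'k::finite itself \<Rightarrow> (real^'n^'n, real^('n::finite, 'k) psd_dim) mfd" where
  "psd_mfd _ = submanifold (psd_rank CARD('k))"

definition spd_mfd :: "(real^'k::finite^'k, real^('k, 'k) psd_dim) mfd" where
  "spd_mfd = submanifold spd"

text \<open>Maps on the quotient, defined by the common value on representatives
  (see \<open>phi_cls\<close> and \<open>proj_M_cls\<close> below).\<close>

definition phi :: "((real^'k^'n) \<times> (real^'k^'k)) set \<Rightarrow> real^'n^'n" where
  "phi C = the_elem ((\<lambda>(Q, D). Q ** D ** transpose Q) ` C)"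

definition proj_M :: "((real^'k^'n) \<times> (real^'k^'k)) set \<Rightarrow> (real^'n) set" where
  "proj_M C = the_elem ((\<lambda>(Q, D). span (columns Q)) ` C)"

definition proj_Sym :: "real^'n^'n \<Rightarrow> (real^'n) set" where
  "proj_Sym S = range ((*v) S)"

definition Sym_fiber_mfd ::
  "'k::finite itself \<Rightarrow> (real^'n) set \<Rightarrow> (real^'n^'n, real^('k, 'k) psd_dim) mfd" where
  "Sym_fiber_mfd _ V = submanifold {S \<in> psd_rank CARD('k). proj_Sym S = V}"


subsection \<open>Well-definedness\<close>

lemma act_in_total:
  assumes "p \<in> total_space" "orthogonal_matrix G"
  shows "act p G \<in> total_space"
proof -
  obtain Q D where p: "p = (Q, D)" by (cases p)
  have Q: "transpose Q ** Q = mat 1" and D: "transpose D = D"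
    and pos: "\<And>x. x \<noteq> 0 \<Longrightarrow> 0 < x \<bullet> (D *v x)"
    using assms(1) by (auto simp: p stiefel_def spd_def)
  have G: "transpose G ** G = mat 1"
    using assms(2) by (simp add: orthogonal_matrix_def)
  have "transpose (Q ** G) ** (Q ** G) = transpose G ** (transpose Q ** Q) ** G"
    by (simp add: matrix_transpose_mul matrix_mul_assoc)
  then have 1: "Q ** G \<in> stiefel"
    by (simp add: Q G stiefel_def)
  have 2: "transpose (transpose G ** D ** G) = transpose G ** D ** G"
    by (simp add: matrix_transpose_mul matrix_mul_assoc D)
  have 3: "0 < x \<bullet> ((transpose G ** D ** G) *v x)" if "x \<noteq> 0" for x
  proof -
    have "G *v x \<noteq> 0"
      using that G by (metis matrix_left_invertible_ker)
    then have "0 < (G *v x) \<bullet> (D *v (G *v x))"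
      by (rule pos)
    also have "\<dots> = x \<bullet> (transpose G *v (D *v (G *v x)))"
      by (metis dot_lmul_matrix inner_commute transpose_matrix_vector transpose_transpose)
    finally show ?thesis
      by (simp add: matrix_vector_mul_assoc matrix_mul_assoc)
  qed
  from 1 2 3 show ?thesis
    by (simp add: p act_def spd_def)
qed

lemma act_id: "act p (mat 1) = p"
  by (cases p) (simp add: act_def transpose_mat)

lemma act_act: "act (act p G) H = act p (G ** H)"
  by (cases p) (simp add: act_def matrix_transpose_mul matrix_mul_assoc)

lemma orbit_rel_iff:
  "(p, q) \<in> orbit_rel \<longleftrightarrow> p \<in> total_space \<and> (\<exists>G. orthogonal_matrix G \<and> q = act p G)"
  unfolding orbit_rel_def by blast

lemma equiv_orbit_rel:
  "equiv (total_space :: ((real^'k^'n) \<times> (real^'k^'k)) set) orbit_rel"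
  (is "equiv ?A ?R")
proof (rule equivI)
  show "?R \<subseteq> ?A \<times> ?A"
  proof (rule subrelI)
    fix p q :: "(real^'k^'n) \<times> (real^'k^'k)"
    assume "(p, q) \<in> orbit_rel"
    then show "(p, q) \<in> total_space \<times> total_space"
      unfolding orbit_rel_iff using act_in_total by blast
  qed
  show "refl_on ?A ?R"
  proof (rule refl_onI)
    fix p :: "(real^'k^'n) \<times> (real^'k^'k)"
    assume "p \<in> total_space"
    then show "(p, p) \<in> orbit_rel"
      unfolding orbit_rel_iff by (metis act_id orthogonal_matrix_id)
  qed
  show "sym ?R"
  proof (rule symI)
    fix p q :: "(real^'k^'n) \<times> (real^'k^'k)"
    assume "(p, q) \<in> orbit_rel"
    then obtain G where G: "q = act p G" "p \<in> total_space" "orthogonal_matrix G"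
      unfolding orbit_rel_iff by blast
    have "act q (transpose G) = p"
      using G by (simp add: act_act act_id orthogonal_matrix_def)
    moreover have "orthogonal_matrix (transpose G)"
      using G by (simp add: orthogonal_matrix_transpose)
    moreover have "q \<in> total_space"
      using G act_in_total by blast
    ultimately show "(q, p) \<in> orbit_rel"
      unfolding orbit_rel_iff by blast
  qed
  show "trans ?R"
  proof (rule transI)
    fix p q r :: "(real^'k^'n) \<times> (real^'k^'k)"
    assume "(p, q) \<in> orbit_rel" "(q, r) \<in> orbit_rel"
    then obtain G H where "q = act p G" "p \<in> total_space" "orthogonal_matrix G"
        "r = act q H" "orthogonal_matrix H"
      unfolding orbit_rel_iff by blast
    then have "r = act p (G ** H)" "p \<in> total_space" "orthogonal_matrix (G ** H)"
      by (simp_all add: act_act orthogonal_matrix_mul)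
    then show "(p, r) \<in> orbit_rel"
      unfolding orbit_rel_iff by blast
  qed
qed

lemma M_set_eq: "M_set = cls ` total_space"
  unfolding M_set_def cls_def[abs_def] quotient_def by blast

lemma cls_conv: "p \<in> total_space \<Longrightarrow> cls p = {act p G | G. orthogonal_matrix G}"
  unfolding cls_def Image_singleton orbit_rel_iff by blast

lemma the_elem_cls:
  assumes "p \<in> total_space" "\<And>G. orthogonal_matrix G \<Longrightarrow> h (act p G) = h p"
  shows "the_elem (h ` cls p) = h p"
proof -
  have "y = h p" if "y \<in> h ` cls p" for y
  proof -
    from that obtain G where "orthogonal_matrix G" "y = h (act p G)"
      unfolding cls_conv[OF assms(1)] by blast
    with assms(2) show ?thesis by simp
  qed
  moreover have "p \<in> cls p"
    unfolding cls_conv[OF assms(1)] mem_Collect_eq by (metis act_id orthogonal_matrix_id)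
  ultimately have "h ` cls p = {h p}"
    by blast
  then show ?thesis by simp
qed

lemma phi_cls:
  assumes "Q \<in> stiefel" "D \<in> spd"
  shows "phi (cls (Q, D)) = Q ** D ** transpose Q"
proof -
  have "(Q ** G) ** (transpose G ** D ** G) ** transpose (Q ** G) = Q ** D ** transpose Q"
    if "orthogonal_matrix G" for G
  proof -
    have G: "G ** transpose G = mat 1"
      using that by (simp add: orthogonal_matrix_def)
    have "(Q ** G) ** (transpose G ** D ** G) ** transpose (Q ** G)
        = Q ** (G ** transpose G) ** D ** (G ** transpose G) ** transpose Q"
      by (simp add: matrix_transpose_mul matrix_mul_assoc)
    then show ?thesis by (simp add: G)
  qed
  then have "the_elem ((\<lambda>(Q, D). Q ** D ** transpose Q) ` cls (Q, D)) =
      (case (Q, D) of (Q, D) \<Rightarrow> Q ** D ** transpose Q)"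
    using assms by (intro the_elem_cls) (simp_all add: act_def)
  then show ?thesis
    by (simp add: phi_def)
qed

lemma span_columns_eq_range: "span (columns Q) = range ((*v) Q)"
  for Q :: "real^'k^'n"
proof
  have "columns Q \<subseteq> range ((*v) Q)"
    unfolding columns_image_basis by blast
  then show "span (columns Q) \<subseteq> range ((*v) Q)"
    by (intro span_minimal linear_subspace_image) auto
  show "range ((*v) Q) \<subseteq> span (columns Q)"
    using matrix_vector_mult_in_columnspace by blast
qed

lemma proj_M_cls:
  fixes Q :: "real^'k^'n"
  assumes "Q \<in> stiefel" "D \<in> spd"
  shows "proj_M (cls (Q, D)) = span (columns Q)"
proof -
  have "range ((*v) (Q ** G)) = range ((*v) Q)" if "orthogonal_matrix G" for G
  proof -
    have "surj ((*v) G)"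
      using that unfolding orthogonal_matrix_def
      by (meson matrix_right_invertible_surjective)
    moreover have "(*v) (Q ** G) = (*v) Q \<circ> (*v) G"
      by (auto simp: matrix_vector_mul_assoc)
    ultimately show ?thesis
      by (simp only: image_comp[symmetric])
  qed
  then have "the_elem ((\<lambda>(Q, D). span (columns Q)) ` cls (Q, D)) =
      (case (Q, D) of (Q, D) \<Rightarrow> span (columns Q))"
    unfolding span_columns_eq_range
    using assms by (intro the_elem_cls) (simp_all add: act_def)
  then show ?thesis
    by (simp add: proj_M_def)
qed

lemma proj_M_in_grassmannian:
  fixes C :: "((real^'k^'n) \<times> (real^'k^'k)) set"
  assumes "C \<in> M_set"
  shows "proj_M C \<in> grassmannian CARD('k)"
proof -
  obtain Q D where QD: "Q \<in> stiefel" "D \<in> spd" "C = cls (Q, D)"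
    using assms unfolding M_set_eq by blast
  have "inj ((*v) Q)"
    using QD(1) unfolding stiefel_def mem_Collect_eq matrix_left_invertible_injective[symmetric]
    by (rule exI)
  then have "dim (columns Q) = CARD('k)"
    unfolding column_rank_def[symmetric] full_rank_injective .
  then show ?thesis
    by (simp add: QD proj_M_cls grassmannian_def)
qed

lemma proj_Sym_in_grassmannian:
  "S \<in> psd_rank r \<Longrightarrow> proj_Sym S \<in> grassmannian r"
  by (auto simp: psd_rank_def proj_Sym_def grassmannian_def rank_dim_range
        intro!: linear_subspace_image)

lemma istopology_M:
  "istopology (\<lambda>U. U \<subseteq> M_set \<and> openin (top_of_set total_space) {p \<in> total_space. cls p \<in> U})"
proof -
  have inter: "{p \<in> A. cls p \<in> S \<inter> T} = {p \<in> A. cls p \<in> S} \<inter> {p \<in> A. cls p \<in> T}"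
    for A :: "((real^'a^'b) \<times> (real^'a^'a)) set" and S T by blast
  have union: "{p \<in> A. cls p \<in> \<Union>\<K>} = \<Union>((\<lambda>K. {p \<in> A. cls p \<in> K}) ` \<K>)"
    for A :: "((real^'a^'b) \<times> (real^'a^'a)) set" and \<K> by blast
  show ?thesis
    unfolding istopology_def inter union
  proof (intro conjI allI impI)
    fix \<K> :: "((real^'a^'b) \<times> (real^'a^'a)) set set set"
    assume *: "\<forall>K\<in>\<K>. K \<subseteq> M_set \<and> openin (top_of_set total_space) {p \<in> total_space. cls p \<in> K}"
    then show "\<Union>\<K> \<subseteq> M_set"
      by blast
    show "openin (top_of_set total_space) (\<Union>((\<lambda>K. {p \<in> total_space. cls p \<in> K}) ` \<K>))"
      using * by (intro openin_Union) blast
  qed (auto intro: openin_Int)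
qed

lemma openin_M_top:
  "openin M_top U \<longleftrightarrow> U \<subseteq> M_set \<and> openin (top_of_set total_space) {p \<in> total_space. cls p \<in> U}"
  unfolding M_top_def topology_inverse'[OF istopology_M] by (rule refl)

lemma topspace_M_top:
  "topspace M_top = (M_set :: ((real^'k^'n) \<times> (real^'k^'k)) set set)" (is "_ = ?M")
proof (rule subset_antisym)
  show "topspace M_top \<subseteq> ?M"
    using openin_M_top openin_topspace by blast
  have "{p \<in> total_space. cls p \<in> ?M} = total_space"
    unfolding M_set_eq by blast
  then have "openin M_top ?M"
    unfolding openin_M_top by simp
  then show "?M \<subseteq> topspace M_top"
    by (rule openin_subset)
qed

lemma quotient_map_cls: "quotient_map (top_of_set total_space) M_top cls"
  unfolding quotient_map_def topspace_M_top topspace_euclidean_subtopology openin_M_top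
  by (simp add: M_set_eq)

end

theory Submission
  imports Defs
begin

text \<open>Why the theorem holds. The map \<open>(Q, D) \<mapsto> Q D Q\<^sup>T\<close> (here \<open>congruence\<close>) from the total space
  onto the positive semidefinite matrices of rank \<open>k\<close> has exactly the \<open>O(k)\<close>-orbits as fibres: the
  matrix \<open>G\<close> with \<open>Q' = Q G\<close> can be solved for and is orthogonal (\<open>congruence_eq_imp_cls_eq\<close>).
  It is a closed map, because \<open>Q\<close> ranges over a compact set and then determines \<open>D\<close>
  (\<open>closed_map_congruence\<close>). Both it and the orbit projection are therefore quotient maps with the
  same fibres, so \<open>phi\<close> is a homeomorphism (\<open>homeomorphic_map_phi\<close>).

  The smooth part rests on the same principle, once more for submersions. The map \<open>congruence\<close> is
  a submersion (\<open>smooth_submersion_congruence\<close>). If the smooth structure of the positive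
  semidefinite matrices is pulled back along \<open>phi\<close>, then the orbit projection becomes a submersion
  and \<open>phi\<close> a diffeomorphism. On the other hand, a space below a surjective submersion carries only
  one smooth structure for which the projection is a submersion (\<open>submersion_structure_unique\<close>),
  since submersions have smooth local sections. Hence the pulled back structure is the one of
  \<open>M(n, k)\<close> (\<open>M_mfd_eq_pullback\<close>).

  For this to make sense, the spaces involved have to be manifolds, which is shown by charts that
  are rational functions. A positive semidefinite \<open>S\<close> whose range is close to that of \<open>Q\<close> is
  uniquely \<open>B E B\<^sup>T\<close> with \<open>Q\<^sup>T B = 1\<close>, and \<open>(E, B - Q)\<close> are coordinates. The Stiefel manifold is
  parametrized near \<open>Q\<close> by a Cayley transform, whose skew parameter is added to the symmetric
  \<open>D\<close> to give a single \<open>n \<times> k\<close> matrix as coordinate of \<open>(Q, D)\<close>. Submersivity is checked with the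
  help of both parametrizations: a family \<open>B E B\<^sup>T\<close> is lifted to first order
  (\<open>first_order_lift\<close>).

  The statement on fibres is linear algebra: an orthonormal basis of \<open>V\<close> identifies the matrices
  with column space \<open>V\<close> with the positive definite \<open>k \<times> k\<close> matrices.\<close>

section \<open>Calculus of smooth maps\<close>

lemma frechet_derivative_cong:
  assumes "open S" "x \<in> S" "\<And>y. y \<in> S \<Longrightarrow> f y = g y"
  shows "frechet_derivative f (at x) = frechet_derivative g (at x)"
proof -
  have "(f has_derivative D) (at x) \<longleftrightarrow> (g has_derivative D) (at x)" for D
    using has_derivative_transform_within_open[OF _ assms(1,2)] assms(3) by metis
  then show ?thesis unfolding frechet_derivative_def by simp
qed

lemma C_times_cong:
  assumes "open S" "\<And>x. x \<in> S \<Longrightarrow> f x = g x"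
  shows "C_times m S f \<longleftrightarrow> C_times m S g"
  using assms(2)
proof (induction m arbitrary: f g)
  case 0
  then show ?case by (simp cong: continuous_on_cong)
next
  case (Suc m)
  have d: "f differentiable (at x) \<longleftrightarrow> g differentiable (at x)" if "x \<in> S" for x
  proof -
    have "(f has_derivative D) (at x) \<longleftrightarrow> (g has_derivative D) (at x)" for D
      using has_derivative_transform_within_open[OF _ assms(1) that] Suc.prems by metis
    then show ?thesis by (simp add: differentiable_def)
  qed
  have "C_times m S (\<lambda>x. frechet_derivative f (at x) v) \<longleftrightarrow>
        C_times m S (\<lambda>x. frechet_derivative g (at x) v)" for v
    by (rule Suc.IH) (use frechet_derivative_cong[OF assms(1) _ Suc.prems] in simp)
  with d show ?case by simp
qed

lemma C_times_mono: "C_times m S f \<Longrightarrow> T \<subseteq> S \<Longrightarrow> C_times m T f"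
  by (induction m arbitrary: f) (auto intro: continuous_on_subset)

text \<open>Differentiability of class \<open>C\<^sup>m\<close> is a local property; this is what glues local extensions and
  local sections together.\<close>

lemma C_times_local:
  assumes "\<And>x. x \<in> S \<Longrightarrow> \<exists>U. open U \<and> x \<in> U \<and> C_times m U f"
  shows "C_times m S f"
  using assms
proof (induction m arbitrary: f)
  case 0
  have "isCont f x" if x: "x \<in> S" for x
    using 0[OF x] continuous_on_eq_continuous_at by (metis C_times.simps(1))
  then show ?case by (simp add: continuous_at_imp_continuous_on)
next
  case (Suc m)
  have "f differentiable (at x)" if "x \<in> S" for x
    using Suc.prems[OF that] by auto
  moreover have "C_times m S (\<lambda>x. frechet_derivative f (at x) v)" for v
    by (rule Suc.IH) (use Suc.prems in \<open>metis C_times.simps(2)\<close>)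
  ultimately show ?case by simp
qed

lemma C_times_SucI:
  assumes "open S" "\<And>x. x \<in> S \<Longrightarrow> (f has_derivative f' x) (at x)"
    "\<And>v. C_times m S (\<lambda>x. f' x v)"
  shows "C_times (Suc m) S f"
proof -
  have "f' x = frechet_derivative f (at x)" if "x \<in> S" for x
    using assms(2)[OF that] by (rule frechet_derivative_at)
  then have "C_times m S (\<lambda>x. frechet_derivative f (at x) v)" for v
    using C_times_cong[OF assms(1), where f = "\<lambda>x. f' x v" and g = "\<lambda>x. frechet_derivative f (at x) v"]
      assms(3) by metis
  then show ?thesis using assms(2) by (auto simp: differentiable_def)
qed

lemma C_times_has_derivative:
  "C_times (Suc m) S f \<Longrightarrow> x \<in> S \<Longrightarrow> (f has_derivative frechet_derivative f (at x)) (at x)"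
  by (simp add: frechet_derivative_works)

lemma C_times_lower: "C_times (Suc m) S f \<Longrightarrow> C_times m S f"
proof (induction m arbitrary: f)
  case 0
  then show ?case
    by (auto intro!: continuous_at_imp_continuous_on differentiable_imp_continuous_within)
next
  case (Suc m)
  then show ?case by (metis C_times.simps(2))
qed

lemma C_times_const: "C_times m S (\<lambda>_. c)"
  by (induction m arbitrary: c) auto

lemma C_times_linear:
  assumes "open S" "bounded_linear L"
  shows "C_times m S f \<Longrightarrow> C_times m S (\<lambda>x. L (f x))"
proof (induction m arbitrary: f)
  case 0
  then show ?case using bounded_linear.continuous_on[OF assms(2)] by auto
next
  case (Suc m)
  show ?case
  proof (rule C_times_SucI[OF assms(1)])
    fix x assume "x \<in> S"
    then show "((\<lambda>x. L (f x)) has_derivative (\<lambda>v. L (frechet_derivative f (at x) v))) (at x)"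
      by (intro bounded_linear.has_derivative[OF assms(2)] C_times_has_derivative[OF Suc.prems])
  next
    show "C_times m S (\<lambda>x. L (frechet_derivative f (at x) v))" for v
      using Suc by simp
  qed
qed

lemma C_times_add:
  assumes "open S"
  shows "C_times m S f \<Longrightarrow> C_times m S g \<Longrightarrow> C_times m S (\<lambda>x. f x + g x)"
proof (induction m arbitrary: f g)
  case 0
  then show ?case by (auto intro: continuous_intros)
next
  case (Suc m)
  show ?case
  proof (rule C_times_SucI[OF assms(1)])
    fix x assume "x \<in> S"
    then show "((\<lambda>x. f x + g x) has_derivative
        (\<lambda>v. frechet_derivative f (at x) v + frechet_derivative g (at x) v)) (at x)"
      by (intro has_derivative_add C_times_has_derivative[OF Suc.prems(1)]
          C_times_has_derivative[OF Suc.prems(2)])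
  next
    show "C_times m S (\<lambda>x. frechet_derivative f (at x) v + frechet_derivative g (at x) v)" for v
      using Suc by simp
  qed
qed

text \<open>By the product rule the derivative is again a sum of values of \<open>h\<close>, so the same lemma covers
  products of numbers, scalars with vectors, and matrices.\<close>

lemma C_times_bilinear:
  assumes "open S" "bounded_bilinear h"
  shows "C_times m S f \<Longrightarrow> C_times m S g \<Longrightarrow> C_times m S (\<lambda>x. h (f x) (g x))"
proof (induction m arbitrary: f g)
  case 0
  then show ?case using bounded_bilinear.continuous_on[OF assms(2)] by auto
next
  case (Suc m)
  show ?case
  proof (rule C_times_SucI[OF assms(1)])
    fix x assume "x \<in> S"
    then show "((\<lambda>x. h (f x) (g x)) has_derivative
        (\<lambda>v. h (f x) (frechet_derivative g (at x) v) + h (frechet_derivative f (at x) v) (g x))) (at x)"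
      by (intro bounded_bilinear.FDERIV[OF assms(2)] C_times_has_derivative[OF Suc.prems(1)]
          C_times_has_derivative[OF Suc.prems(2)])
  next
    show "C_times m S (\<lambda>x. h (f x) (frechet_derivative g (at x) v) + h (frechet_derivative f (at x) v) (g x))" for v
      using Suc C_times_lower[OF Suc.prems(1)] C_times_lower[OF Suc.prems(2)]
      by (intro C_times_add[OF assms(1)]) simp_all
  qed
qed

lemma C_times_sum:
  assumes "open S" "finite I" "\<And>i. i \<in> I \<Longrightarrow> C_times m S (f i)"
  shows "C_times m S (\<lambda>x. \<Sum>i\<in>I. f i x)"
  using assms(2,3)
  by (induction I rule: finite_induct) (auto intro: C_times_add[OF assms(1)] C_times_const)

text \<open>Expanding the inner derivative in a basis turns the chain rule into a sum of products of
  maps of one class less, to which the induction hypothesis applies.\<close>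

lemma C_times_comp:
  assumes "open S" "open T"
  shows "C_times m S f \<Longrightarrow> C_times m T g \<Longrightarrow> f ` S \<subseteq> T \<Longrightarrow> C_times m S (\<lambda>x. g (f x))"
proof (induction m arbitrary: f g)
  case 0
  then show ?case by (auto intro: continuous_on_compose2)
next
  case (Suc m)
  show ?case
  proof (rule C_times_SucI[OF assms(1)])
    fix x assume x: "x \<in> S"
    then have g: "(g has_derivative frechet_derivative g (at (f x))) (at (f x))"
      using C_times_has_derivative Suc.prems by blast
    interpret G: bounded_linear "frechet_derivative g (at (f x))"
      using g by (rule has_derivative_bounded_linear)
    have comp: "((\<lambda>x. g (f x)) has_derivative
        (\<lambda>v. frechet_derivative g (at (f x)) (frechet_derivative f (at x) v))) (at x)"
      by (rule has_derivative_compose[where g = g, OF C_times_has_derivative[OF Suc.prems(1) x] g])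
    have expand: "frechet_derivative g (at (f x)) w =
        (\<Sum>i\<in>Basis. (w \<bullet> i) *\<^sub>R frechet_derivative g (at (f x)) i)" for w
    proof -
      have "frechet_derivative g (at (f x)) w =
          frechet_derivative g (at (f x)) (\<Sum>i\<in>Basis. (w \<bullet> i) *\<^sub>R i)"
        by (simp add: euclidean_representation)
      also have "\<dots> = (\<Sum>i\<in>Basis. (w \<bullet> i) *\<^sub>R frechet_derivative g (at (f x)) i)"
        by (simp add: G.sum G.scaleR)
      finally show ?thesis .
    qed
    show "((\<lambda>x. g (f x)) has_derivative
        (\<lambda>v. \<Sum>i\<in>Basis. (frechet_derivative f (at x) v \<bullet> i) *\<^sub>R frechet_derivative g (at (f x)) i)) (at x)"
      by (rule has_derivative_eq_rhs[OF comp]) (rule ext, rule expand)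
  next
    fix v
    have "C_times m S f" by (rule C_times_lower[OF Suc.prems(1)])
    then have "C_times m S (\<lambda>x. frechet_derivative g (at (f x)) i)" for i
      using Suc.IH[where g = "\<lambda>y. frechet_derivative g (at y) i"] Suc.prems by simp
    moreover have "C_times m S (\<lambda>x. frechet_derivative f (at x) v \<bullet> i)" for i
      using Suc.prems(1) by (intro C_times_linear[OF assms(1) bounded_linear_inner_left]) simp
    ultimately show "C_times m S
        (\<lambda>x. \<Sum>i\<in>Basis. (frechet_derivative f (at x) v \<bullet> i) *\<^sub>R frechet_derivative g (at (f x)) i)"
      by (intro C_times_sum C_times_bilinear[OF assms(1) bounded_bilinear_scaleR] assms) auto
  qed
qed

lemma C_times_inverse: "C_times m (- {0}) (inverse :: real \<Rightarrow> real)"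
proof (induction m)
  case 0
  then show ?case by (auto intro!: continuous_intros)
next
  case (Suc m)
  show ?case
  proof (rule C_times_SucI)
    show "(inverse has_derivative (\<lambda>v. - (inverse x * v * inverse x))) (at x)"
      if "x \<in> - {0}" for x :: real
      using that by (intro has_derivative_inverse') simp
    have "C_times m (- {0}) (\<lambda>x::real. (- v) * (inverse x * inverse x))" for v
      using C_times_linear[OF _ bounded_linear_mult_right[of "-v"]]
        C_times_bilinear[OF _ bounded_bilinear_mult Suc Suc] by blast
    then show "C_times m (- {0}) (\<lambda>x::real. - (inverse x * v * inverse x))" for v
      by (simp add: mult_ac)
  qed auto
qed

lemma smooth_on_openD:
  assumes "smooth_on_open S f"
  shows "open S" "\<And>m. C_times m S f" "continuous_on S f"
    "\<And>x. x \<in> S \<Longrightarrow> (f has_derivative frechet_derivative f (at x)) (at x)"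
proof -
  show "open S" and *: "C_times m S f" for m using assms by (auto simp: smooth_on_open_def)
  show "continuous_on S f" using *[of 0] by simp
  show "x \<in> S \<Longrightarrow> (f has_derivative frechet_derivative f (at x)) (at x)" for x
    using *[of "Suc 0"] by (rule C_times_has_derivative)
qed

lemma smooth_on_open_mono: "smooth_on_open S f \<Longrightarrow> open T \<Longrightarrow> T \<subseteq> S \<Longrightarrow> smooth_on_open T f"
  by (auto simp: smooth_on_open_def intro: C_times_mono[of _ S])

lemma smooth_on_open_cong:
  "(\<And>x. x \<in> S \<Longrightarrow> f x = g x) \<Longrightarrow> smooth_on_open S f \<longleftrightarrow> smooth_on_open S g"
  unfolding smooth_on_open_def using C_times_cong[of S f g] by auto

lemma smooth_on_subsetE:
  assumes "smooth_on_subset S f" "x \<in> S"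
  obtains U F where "x \<in> U" "smooth_on_open U F" "\<And>y. y \<in> U \<inter> S \<Longrightarrow> F y = f y"
proof -
  from assms obtain U F where "x \<in> U \<and> smooth_on_open U F \<and> (\<forall>y\<in>U \<inter> S. F y = f y)"
    unfolding smooth_on_subset_def by meson
  then show ?thesis using that[of U F] by simp
qed

text \<open>On an open set a local extension is the map itself near the point. All further smoothness
  arguments can therefore be phrased with \<^const>\<open>smooth_on_subset\<close>.\<close>

lemma smooth_on_open_iff_subset: "smooth_on_open S f \<longleftrightarrow> open S \<and> smooth_on_subset S f"
proof (intro iffI conjI)
  show "smooth_on_open S f \<Longrightarrow> open S" by (rule smooth_on_openD)
  show "smooth_on_open S f \<Longrightarrow> smooth_on_subset S f"
    unfolding smooth_on_subset_def by blast
  assume *: "open S \<and> smooth_on_subset S f"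
  have "C_times m S f" for m
  proof (rule C_times_local)
    fix x assume "x \<in> S"
    then obtain U F where F: "x \<in> U" "smooth_on_open U F" "\<And>y. y \<in> U \<inter> S \<Longrightarrow> F y = f y"
      using smooth_on_subsetE[of S f x] * by metis
    have "open (U \<inter> S)" using F(2) * by (simp add: smooth_on_openD(1) open_Int)
    moreover have "C_times m (U \<inter> S) F"
      by (rule C_times_mono[OF smooth_on_openD(2)[OF F(2)]]) blast
    then have "C_times m (U \<inter> S) f"
      by (rule C_times_cong[OF \<open>open (U \<inter> S)\<close> F(3), THEN iffD1, rotated])
    ultimately show "\<exists>U. open U \<and> x \<in> U \<and> C_times m U f"
      using F(1) \<open>x \<in> S\<close> by (intro exI[of _ "U \<inter> S"]) simp
  qed
  then show "smooth_on_open S f" using * by (simp add: smooth_on_open_def)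
qed

lemma smooth_on_subset_mono: "smooth_on_subset S f \<Longrightarrow> T \<subseteq> S \<Longrightarrow> smooth_on_subset T f"
  unfolding smooth_on_subset_def
proof
  fix x
  assume *: "\<forall>x\<in>S. \<exists>U F. x \<in> U \<and> smooth_on_open U F \<and> (\<forall>y\<in>U \<inter> S. F y = f y)"
    and "T \<subseteq> S" "x \<in> T"
  then obtain U F where "x \<in> U" "smooth_on_open U F" "\<forall>y\<in>U \<inter> S. F y = f y" by blast
  then show "\<exists>U F. x \<in> U \<and> smooth_on_open U F \<and> (\<forall>y\<in>U \<inter> T. F y = f y)"
    using \<open>T \<subseteq> S\<close> by (intro exI[of _ U] exI[of _ F]) auto
qed

lemma smooth_on_subset_cong:
  "(\<And>x. x \<in> S \<Longrightarrow> f x = g x) \<Longrightarrow> smooth_on_subset S f \<longleftrightarrow> smooth_on_subset S g"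
  unfolding smooth_on_subset_def by simp

lemma smooth_on_subset_local:
  assumes "\<And>x. x \<in> S \<Longrightarrow> \<exists>U. open U \<and> x \<in> U \<and> smooth_on_subset (S \<inter> U) f"
  shows "smooth_on_subset S f"
  unfolding smooth_on_subset_def
proof
  fix x assume "x \<in> S"
  then obtain U where U: "open U" "x \<in> U" "smooth_on_subset (S \<inter> U) f" using assms by blast
  then obtain V F where F: "x \<in> V" "smooth_on_open V F" "\<And>y. y \<in> V \<inter> (S \<inter> U) \<Longrightarrow> F y = f y"
    using smooth_on_subsetE[OF U(3), of x] \<open>x \<in> S\<close> by (metis IntI)
  have "smooth_on_open (V \<inter> U) F"
    by (rule smooth_on_open_mono[OF F(2)]) (simp_all add: U(1) smooth_on_openD(1)[OF F(2)] open_Int)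
  moreover have "\<forall>y\<in>(V \<inter> U) \<inter> S. F y = f y" using F(3) by blast
  ultimately show "\<exists>U F. x \<in> U \<and> smooth_on_open U F \<and> (\<forall>y\<in>U \<inter> S. F y = f y)"
    using U(2) F(1) by blast
qed

lemma smooth_on_subset_continuous: "smooth_on_subset S f \<Longrightarrow> continuous_on S f"
  unfolding continuous_on_eq_continuous_within
proof
  fix x assume s: "smooth_on_subset S f" and x: "x \<in> S"
  obtain U F where F: "x \<in> U" "smooth_on_open U F" "\<And>y. y \<in> U \<inter> S \<Longrightarrow> F y = f y"
    using smooth_on_subsetE[OF s x] by metis
  have "isCont F x"
    using smooth_on_openD(1,3)[OF F(2)] F(1) by (simp add: continuous_on_eq_continuous_at)
  then have "continuous (at x within S) F" by (rule continuous_at_imp_continuous_within)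
  moreover obtain e where "e > 0" "ball x e \<subseteq> U"
    using smooth_on_openD(1)[OF F(2)] F(1) open_contains_ball by metis
  ultimately show "continuous (at x within S) f"
    using continuous_transform_within[of x S F e f] x F(3)
    by (simp add: dist_commute subset_iff)
qed

text \<open>The composition of local extensions extends the composition.\<close>

lemma smooth_on_subset_comp:
  assumes f: "smooth_on_subset S f" and g: "smooth_on_subset T g" and fS: "f ` S \<subseteq> T"
  shows "smooth_on_subset S (\<lambda>x. g (f x))"
  unfolding smooth_on_subset_def
proof
  fix x assume x: "x \<in> S"
  obtain U F where F: "x \<in> U" "smooth_on_open U F" "\<And>y. y \<in> U \<inter> S \<Longrightarrow> F y = f y"
    using smooth_on_subsetE[OF f x] by metis
  obtain V G where G: "f x \<in> V" "smooth_on_open V G" "\<And>y. y \<in> V \<inter> T \<Longrightarrow> G y = g y"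
    using smooth_on_subsetE[OF g] fS x by (metis image_subset_iff)
  let ?W = "U \<inter> F -` V"
  have W: "open ?W"
    using smooth_on_openD[OF F(2)] smooth_on_openD(1)[OF G(2)] by (simp add: continuous_open_preimage)
  have "C_times m ?W (\<lambda>x. G (F x))" for m
    by (rule C_times_comp[OF W smooth_on_openD(1)[OF G(2)]
          C_times_mono[OF smooth_on_openD(2)[OF F(2)]] smooth_on_openD(2)[OF G(2)]]) auto
  with W have "smooth_on_open ?W (\<lambda>x. G (F x))" by (simp add: smooth_on_open_def)
  moreover have "G (F y) = g (f y)" if "y \<in> ?W \<inter> S" for y
  proof -
    have "F y = f y" using that F(3) by simp
    then show ?thesis using G(3)[of "f y"] that fS by (auto simp: image_subset_iff)
  qed
  moreover have "x \<in> ?W" using F(1) F(3)[of x] G(1) x by simp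
  ultimately show "\<exists>U F. x \<in> U \<and> smooth_on_open U F \<and> (\<forall>y\<in>U \<inter> S. F y = g (f y))"
    by (intro exI[of _ ?W] exI[of _ "\<lambda>x. G (F x)"]) simp
qed

lemma smooth_on_subset_bilinear:
  assumes "bounded_bilinear h" and f: "smooth_on_subset S f" and g: "smooth_on_subset S g"
  shows "smooth_on_subset S (\<lambda>x. h (f x) (g x))"
  unfolding smooth_on_subset_def
proof
  fix x assume x: "x \<in> S"
  obtain U F where F: "x \<in> U" "smooth_on_open U F" "\<And>y. y \<in> U \<inter> S \<Longrightarrow> F y = f y"
    using smooth_on_subsetE[OF f x] by metis
  obtain V G where G: "x \<in> V" "smooth_on_open V G" "\<And>y. y \<in> V \<inter> S \<Longrightarrow> G y = g y"
    using smooth_on_subsetE[OF g x] by metis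
  have W: "open (U \<inter> V)" using F G by (simp add: smooth_on_openD(1) open_Int)
  have "C_times m (U \<inter> V) (\<lambda>x. h (F x) (G x))" for m
    by (rule C_times_bilinear[OF W assms(1)])
       (use C_times_mono smooth_on_openD(2)[OF F(2)] smooth_on_openD(2)[OF G(2)] in blast)+
  with W have "smooth_on_open (U \<inter> V) (\<lambda>x. h (F x) (G x))" by (simp add: smooth_on_open_def)
  then show "\<exists>U F. x \<in> U \<and> smooth_on_open U F \<and> (\<forall>y\<in>U \<inter> S. F y = h (f y) (g y))"
    using F G by (intro exI[of _ "U \<inter> V"] exI[of _ "\<lambda>x. h (F x) (G x)"]) auto
qed

lemma smooth_on_subset_const [intro]: "smooth_on_subset S (\<lambda>_. c)"
  unfolding smooth_on_subset_def smooth_on_open_def using C_times_const open_UNIV by blast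

lemma C_times_id: "C_times m UNIV (\<lambda>x. x)"
proof (cases m)
  case (Suc n)
  then show ?thesis using C_times_SucI[OF open_UNIV has_derivative_ident] C_times_const by metis
qed simp

lemma smooth_on_subset_id [intro]: "smooth_on_subset S (\<lambda>x. x)"
  unfolding smooth_on_subset_def smooth_on_open_def using C_times_id open_UNIV by blast

lemma smooth_on_subset_linear:
  fixes f :: "'a::euclidean_space \<Rightarrow> 'b::euclidean_space"
  assumes "bounded_linear L" "smooth_on_subset S f"
  shows "smooth_on_subset S (\<lambda>x. L (f x))"
proof -
  have "smooth_on_open UNIV L"
    using C_times_linear[OF open_UNIV assms(1) C_times_id] by (simp add: smooth_on_open_def)
  then have "smooth_on_subset UNIV L" by (simp add: smooth_on_open_iff_subset)
  from smooth_on_subset_comp[OF assms(2) this] show ?thesis by auto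
qed

lemma smooth_on_subset_add [intro]:
  assumes "smooth_on_subset S f" "smooth_on_subset S g"
  shows "smooth_on_subset S (\<lambda>x. f x + g x)"
  unfolding smooth_on_subset_def
proof
  fix x assume x: "x \<in> S"
  obtain U F where F: "x \<in> U" "smooth_on_open U F" "\<And>y. y \<in> U \<inter> S \<Longrightarrow> F y = f y"
    using smooth_on_subsetE[OF assms(1) x] by metis
  obtain V G where G: "x \<in> V" "smooth_on_open V G" "\<And>y. y \<in> V \<inter> S \<Longrightarrow> G y = g y"
    using smooth_on_subsetE[OF assms(2) x] by metis
  have W: "open (U \<inter> V)" using F G by (simp add: smooth_on_openD(1) open_Int)
  have "C_times m (U \<inter> V) (\<lambda>x. F x + G x)" for m
    by (rule C_times_add[OF W])
       (use C_times_mono smooth_on_openD(2)[OF F(2)] smooth_on_openD(2)[OF G(2)] in blast)+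
  with W have "smooth_on_open (U \<inter> V) (\<lambda>x. F x + G x)" by (simp add: smooth_on_open_def)
  then show "\<exists>U F. x \<in> U \<and> smooth_on_open U F \<and> (\<forall>y\<in>U \<inter> S. F y = f y + g y)"
    using F G by (intro exI[of _ "U \<inter> V"] exI[of _ "\<lambda>x. F x + G x"]) auto
qed

lemma smooth_on_subset_scaleR [intro]:
  "smooth_on_subset S f \<Longrightarrow> smooth_on_subset S (\<lambda>x. c *\<^sub>R f x)"
  by (rule smooth_on_subset_linear[OF bounded_linear_scaleR_right])

lemma smooth_on_subset_diff [intro]:
  assumes "smooth_on_subset S f" "smooth_on_subset S g"
  shows "smooth_on_subset S (\<lambda>x. f x - g x)"
  using smooth_on_subset_add[OF assms(1) smooth_on_subset_scaleR[OF assms(2), of "-1"]] by simp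

lemma smooth_on_subset_sum:
  assumes "\<And>i. i \<in> I \<Longrightarrow> smooth_on_subset S (f i)"
  shows "smooth_on_subset S (\<lambda>x. \<Sum>i\<in>I. f i x)"
  using assms by (induction I rule: infinite_finite_induct) auto

lemma smooth_on_subset_prod:
  fixes f :: "'i \<Rightarrow> 'a::euclidean_space \<Rightarrow> real"
  assumes "\<And>i. i \<in> I \<Longrightarrow> smooth_on_subset S (f i)"
  shows "smooth_on_subset S (\<lambda>x. \<Prod>i\<in>I. f i x)"
  using assms
  by (induction I rule: infinite_finite_induct)
     (auto intro!: smooth_on_subset_bilinear[OF bounded_bilinear_mult])

lemma smooth_on_subset_divide:
  fixes f g :: "'a::euclidean_space \<Rightarrow> real"
  assumes "smooth_on_subset S f" "smooth_on_subset S g" "\<And>x. x \<in> S \<Longrightarrow> g x \<noteq> 0"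
  shows "smooth_on_subset S (\<lambda>x. f x / g x)"
proof -
  have "smooth_on_open (- {0}) (inverse :: real \<Rightarrow> real)"
    by (simp add: smooth_on_open_def C_times_inverse open_Compl)
  then have "smooth_on_subset (- {0}) (inverse :: real \<Rightarrow> real)"
    by (simp add: smooth_on_open_iff_subset)
  moreover have "g ` S \<subseteq> - {0}" using assms(3) by auto
  ultimately have "smooth_on_subset S (\<lambda>x. inverse (g x))"
    by (rule smooth_on_subset_comp[OF assms(2)])
  from smooth_on_subset_bilinear[OF bounded_bilinear_mult assms(1) this] show ?thesis
    by (simp add: divide_inverse)
qed

lemma smooth_on_subset_vec:
  fixes f :: "'a::euclidean_space \<Rightarrow> 'b::euclidean_space ^ 'n"
  assumes "\<And>i. smooth_on_subset S (\<lambda>x. f x $ i)"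
  shows "smooth_on_subset S f"
proof -
  have "bounded_linear (axis i :: 'b \<Rightarrow> 'b^'n)" for i
    unfolding linear_conv_bounded_linear[symmetric]
    by (rule linearI) (simp_all add: vec_eq_iff axis_def)
  then have "smooth_on_subset S (\<lambda>x. \<Sum>i\<in>UNIV. axis i (f x $ i))"
    by (rule smooth_on_subset_sum[OF smooth_on_subset_linear]) (rule assms)
  moreover have "(\<Sum>i\<in>UNIV. axis i (f x $ i)) = f x" for x
    by (simp add: vec_eq_iff axis_def if_distrib cong: if_cong)
  ultimately show ?thesis by simp
qed

lemma smooth_on_subset_vec_nth:
  "smooth_on_subset S f \<Longrightarrow> smooth_on_subset S (\<lambda>x. f x $ i)"
  by (rule smooth_on_subset_linear[OF bounded_linear_vec_nth])

lemma smooth_on_subset_Pair: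
  assumes "smooth_on_subset S f" "smooth_on_subset S g"
  shows "smooth_on_subset S (\<lambda>x. (f x, g x))"
proof -
  have "bounded_linear (\<lambda>x::'b. (x, 0::'c))" "bounded_linear (\<lambda>y::'c. (0::'b, y))"
    by (auto intro!: bounded_linear_Pair bounded_linear_ident bounded_linear_zero)
  from smooth_on_subset_add[OF smooth_on_subset_linear[OF this(1) assms(1)]
      smooth_on_subset_linear[OF this(2) assms(2)]]
  show ?thesis by simp
qed

lemma smooth_on_subset_fst: "smooth_on_subset S f \<Longrightarrow> smooth_on_subset S (\<lambda>x. fst (f x))"
  by (rule smooth_on_subset_linear[OF bounded_linear_fst])

lemma smooth_on_subset_snd: "smooth_on_subset S f \<Longrightarrow> smooth_on_subset S (\<lambda>x. snd (f x))"
  by (rule smooth_on_subset_linear[OF bounded_linear_snd])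

subsection \<open>Matrix operations\<close>

lemma bounded_bilinear_matrix_matrix_mult:
  "bounded_bilinear ((**) :: real^'m^'n \<Rightarrow> real^'p^'m \<Rightarrow> real^'p^'n)"
proof -
  have "bilinear ((**) :: real^'m^'n \<Rightarrow> real^'p^'m \<Rightarrow> real^'p^'n)"
    unfolding bilinear_def
    by (auto intro!: linearI simp: matrix_add_ldistrib matrix_matrix_mult_def vec_eq_iff
        algebra_simps sum.distrib sum_distrib_left)
  then show ?thesis by (simp add: bilinear_conv_bounded_bilinear)
qed

lemma bounded_linear_transpose: "bounded_linear (transpose :: real^'m^'n \<Rightarrow> real^'n^'m)"
  unfolding linear_conv_bounded_linear[symmetric]
  by (rule linearI) (auto simp: transpose_def vec_eq_iff)

lemma smooth_on_subset_matrix_mult: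
  fixes f :: "'a::euclidean_space \<Rightarrow> real^'m^'n" and g :: "'a \<Rightarrow> real^'p^'m"
  shows "smooth_on_subset S f \<Longrightarrow> smooth_on_subset S g \<Longrightarrow> smooth_on_subset S (\<lambda>x. f x ** g x)"
  by (rule smooth_on_subset_bilinear[OF bounded_bilinear_matrix_matrix_mult])

lemma smooth_on_subset_transpose:
  fixes f :: "'a::euclidean_space \<Rightarrow> real^'m^'n"
  shows "smooth_on_subset S f \<Longrightarrow> smooth_on_subset S (\<lambda>x. transpose (f x))"
  by (rule smooth_on_subset_linear[OF bounded_linear_transpose])

lemma smooth_on_subset_det:
  fixes f :: "'a::euclidean_space \<Rightarrow> real^'n^'n"
  assumes "\<And>i j. smooth_on_subset S (\<lambda>x. f x $ i $ j)"
  shows "smooth_on_subset S (\<lambda>x. det (f x))"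
  unfolding det_def
  by (intro smooth_on_subset_sum smooth_on_subset_bilinear[OF bounded_bilinear_mult]
      smooth_on_subset_const smooth_on_subset_prod assms)

lemma matrix_inv_unique_left:
  fixes A :: "real^'n^'n"
  assumes "B ** A = mat 1"
  shows "matrix_inv A = B" "A ** B = mat 1"
proof -
  show AB: "A ** B = mat 1" using assms by (simp add: matrix_left_right_inverse)
  have "\<exists>C. A ** C = mat 1 \<and> C ** A = mat 1" using assms AB by blast
  then have "A ** matrix_inv A = mat 1 \<and> matrix_inv A ** A = mat 1"
    unfolding matrix_inv_def by (rule someI_ex)
  then show "matrix_inv A = B"
    by (metis AB assms matrix_mul_assoc matrix_mul_lid matrix_mul_rid)
qed

lemma matrix_inv_works:
  fixes A :: "real^'n^'n"
  assumes "det A \<noteq> 0"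
  shows "A ** matrix_inv A = mat 1" "matrix_inv A ** A = mat 1"
proof -
  obtain B where "B ** A = mat 1"
    using assms by (metis invertible_det_nz invertible_left_inverse)
  with matrix_inv_unique_left[OF this]
  show "A ** matrix_inv A = mat 1" "matrix_inv A ** A = mat 1" by simp_all
qed

text \<open>Cramer's rule exhibits the entries of the inverse as rational functions.\<close>

lemma smooth_on_subset_matrix_inv:
  fixes f :: "'a::euclidean_space \<Rightarrow> real^'n^'n"
  assumes "smooth_on_subset S f" "\<And>x. x \<in> S \<Longrightarrow> det (f x) \<noteq> 0"
  shows "smooth_on_subset S (\<lambda>x. matrix_inv (f x))"
proof (intro smooth_on_subset_vec)
  fix i j
  have ent: "matrix_inv A $ i $ j =
      det (\<chi> r c. if c = i then axis j 1 $ r else A $ r $ c) / det A"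
    if "det A \<noteq> 0" for A :: "real^'n^'n"
  proof -
    have "A *v (matrix_inv A *v axis j 1) = axis j 1"
      using matrix_inv_works(1)[OF that] by (simp add: matrix_vector_mul_assoc)
    with cramer[OF that]
    have "matrix_inv A *v axis j 1 = (\<chi> k. det (\<chi> r c. if c = k then axis j 1 $ r else A $ r $ c) / det A)"
      by blast
    moreover have "(matrix_inv A *v axis j 1) $ i = matrix_inv A $ i $ j"
      by (simp add: matrix_vector_mult_basis column_def)
    ultimately show ?thesis by simp
  qed
  have f: "smooth_on_subset S (\<lambda>x. f x $ r $ c)" for r c
    using assms(1) by (intro smooth_on_subset_vec_nth)
  have "smooth_on_subset S (\<lambda>x. det (\<chi> r c. if c = i then axis j 1 $ r else f x $ r $ c) / det (f x))"
  proof (intro smooth_on_subset_divide smooth_on_subset_det f assms(2))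
    fix r c
    show "smooth_on_subset S (\<lambda>x. (\<chi> r c. if c = i then axis j 1 $ r else f x $ r $ c) $ r $ c)"
      by (cases "c = i") (simp_all add: f smooth_on_subset_const)
  qed
  then show "smooth_on_subset S (\<lambda>x. matrix_inv (f x) $ i $ j)"
    by (rule smooth_on_subset_cong[THEN iffD1, rotated]) (simp add: ent assms(2))
qed

lemmas smooth_rules =
  smooth_on_subset_const smooth_on_subset_id smooth_on_subset_add smooth_on_subset_diff
  smooth_on_subset_scaleR smooth_on_subset_matrix_mult smooth_on_subset_transpose
  smooth_on_subset_matrix_inv smooth_on_subset_Pair smooth_on_subset_fst smooth_on_subset_snd

lemma smooth_manifold_iff:
  "smooth_manifold M \<longleftrightarrow>
     Hausdorff_space (fst M) \<and> Defs.second_countable (fst M) \<and> smooth_structure (fst M) (snd M)"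
  by (cases M) (simp add: smooth_manifold_def)

lemma smooth_map_iff:
  "smooth_map M N F \<longleftrightarrow>
     F ` topspace (fst M) \<subseteq> topspace (fst N) \<and>
     (\<forall>p\<in>topspace (fst M). \<exists>U f V g. (U, f) \<in> snd M \<and> (V, g) \<in> snd N \<and>
        p \<in> U \<and> F ` U \<subseteq> V \<and> smooth_on_open (f ` U) (g \<circ> F \<circ> inv_into U f))"
  by (cases M; cases N) (simp add: smooth_map_def image_subset_iff_funcset Bex_def split_paired_Ex, blast)

section \<open>Submanifolds of Euclidean spaces\<close>

lemma inv_into_cong:
  assumes "\<And>x. x \<in> U \<Longrightarrow> f x = g x"
  shows "inv_into U f = inv_into U g"
proof
  fix y
  have "(x \<in> U \<and> f x = y) = (x \<in> U \<and> g x = y)" for x using assms by metis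
  then show "inv_into U f y = inv_into U g y" unfolding inv_into_def by simp
qed

lemma inv_into_subset_eq:
  "inj_on f U \<Longrightarrow> V \<subseteq> U \<Longrightarrow> y \<in> f ` V \<Longrightarrow> inv_into V f y = inv_into U f y"
  by (metis f_inv_into_f inj_on_eq_iff inj_on_subset inv_into_f_f inv_into_into subsetD)

lemma submanifold_chart_iff:
  "(U, f) \<in> snd (submanifold S) \<longleftrightarrow>
     openin (top_of_set S) U \<and> inj_on f U \<and>
     smooth_on_subset U f \<and> smooth_on_open (f ` U) (inv_into U f)"
  by (simp add: submanifold_def)

lemma fst_submanifold [simp]: "fst (submanifold S) = top_of_set S"
  by (simp add: submanifold_def)

lemma submanifold_chartD:
  assumes "(U, f) \<in> snd (submanifold S)"
  shows "openin (top_of_set S) U" "U \<subseteq> S" "inj_on f U" "smooth_on_subset U f"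
    "open (f ` U)" "smooth_on_subset (f ` U) (inv_into U f)"
proof -
  show "openin (top_of_set S) U" using assms by (simp add: submanifold_chart_iff)
  then show "U \<subseteq> S" by (rule openin_imp_subset)
qed (use assms in \<open>simp_all add: submanifold_chart_iff smooth_on_open_iff_subset\<close>)

text \<open>The definition of smooth maps asks for chart domains mapped into one another, which is achieved
  by shrinking.\<close>

lemma submanifold_chart_restrict:
  assumes "(U, f) \<in> snd (submanifold S)" "openin (top_of_set S) V" "V \<subseteq> U"
  shows "(V, f) \<in> snd (submanifold S)"
proof -
  note c = submanifold_chartD[OF assms(1)]
  obtain W where W: "open W" "V = S \<inter> W" using assms(2) openin_open by metis
  have "f ` V = f ` U \<inter> inv_into U f -` W"
  proof (intro set_eqI iffI)
    fix y assume "y \<in> f ` V"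
    then obtain x where "x \<in> V" "y = f x" by blast
    then show "y \<in> f ` U \<inter> inv_into U f -` W" using assms(3) W c(3) by auto
  next
    fix y assume "y \<in> f ` U \<inter> inv_into U f -` W"
    then obtain x where "x \<in> U" "y = f x" "inv_into U f y \<in> W" by blast
    then show "y \<in> f ` V" using W c(2,3) by auto
  qed
  then have op: "open (f ` V)"
    using continuous_open_preimage[OF smooth_on_subset_continuous[OF c(6)] c(5) W(1)] by simp
  have "smooth_on_subset (f ` V) (inv_into U f)"
    using c(6) by (rule smooth_on_subset_mono) (use assms(3) in blast)
  then have "smooth_on_subset (f ` V) (inv_into V f)"
    by (rule smooth_on_subset_cong[THEN iffD2, rotated])
       (rule inv_into_subset_eq[OF c(3) assms(3)])
  moreover have "smooth_on_subset V f" using c(4) assms(3) by (rule smooth_on_subset_mono)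
  moreover have "inj_on f V" using c(3) assms(3) by (rule inj_on_subset)
  ultimately show ?thesis
    using assms(2) op by (simp add: submanifold_chart_iff smooth_on_open_iff_subset)
qed

lemma submanifold_is_chart:
  assumes "(U, f) \<in> snd (submanifold S)"
  shows "is_chart (top_of_set S) (U, f)"
proof -
  note c = submanifold_chartD[OF assms]
  have eq: "subtopology (top_of_set S) U = top_of_set U"
    using c(2) by (simp add: subtopology_subtopology inf_absorb2)
  have "homeomorphic_maps (top_of_set U) (top_of_set (f ` U)) f (inv_into U f)"
    unfolding homeomorphic_maps_def
    using smooth_on_subset_continuous[OF c(4)] smooth_on_subset_continuous[OF c(6)] c(3)
    by (auto simp: inv_into_into f_inv_into_f)
  then have "homeomorphic_map (top_of_set U) (top_of_set (f ` U)) f"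
    using homeomorphic_map_maps by blast
  then show ?thesis using c eq by (simp add: is_chart_def)
qed

lemma submanifold_transition_smooth:
  assumes "(U, f) \<in> snd (submanifold S)" "(V, g) \<in> snd (submanifold S)"
  shows "smooth_on_open (f ` (U \<inter> V)) (g \<circ> inv_into U f)"
proof -
  note c = submanifold_chartD[OF assms(1)] and d = submanifold_chartD[OF assms(2)]
  have "(U \<inter> V, f) \<in> snd (submanifold S)"
    using c d by (intro submanifold_chart_restrict[OF assms(1)]) auto
  then have "open (f ` (U \<inter> V))" by (rule submanifold_chartD)
  moreover have "smooth_on_subset (f ` (U \<inter> V)) (inv_into U f)"
    using c(6) by (rule smooth_on_subset_mono) blast
  then have "smooth_on_subset (f ` (U \<inter> V)) (\<lambda>y. g (inv_into U f y))"
    using d(4) by (rule smooth_on_subset_comp) (use c(3) in auto)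
  ultimately show ?thesis by (simp add: smooth_on_open_iff_subset o_def)
qed

lemma submanifold_compatible:
  assumes "c \<in> snd (submanifold S)" "c' \<in> snd (submanifold S)"
  shows "compatible c c'"
proof -
  obtain U f V g where "c = (U, f)" "c' = (V, g)" by (metis surj_pair)
  with assms submanifold_transition_smooth[of U f S V g] submanifold_transition_smooth[of V g S U f]
  show ?thesis by (simp add: compatible_def Int_commute)
qed

text \<open>A chart that is compatible with all charts of the atlas factors locally through one of them,
  and so inherits smoothness in both directions.\<close>

lemma submanifold_atlas_maximal:
  fixes S :: "'a::euclidean_space set" and h :: "'a \<Rightarrow> 'e::euclidean_space"
  assumes cover: "\<And>p. p \<in> S \<Longrightarrow> \<exists>U f. (U, f) \<in> snd (submanifold S :: ('a, 'e) mfd) \<and> p \<in> U"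
    and ch: "is_chart (top_of_set S) (W, h)"
    and comp: "\<And>U f. (U, f) \<in> snd (submanifold S :: ('a, 'e) mfd) \<Longrightarrow> compatible (W, h) (U, f)"
  shows "(W, h) \<in> snd (submanifold S)"
proof -
  have W: "openin (top_of_set S) W" "open (h ` W)"
    and hom: "homeomorphic_map (subtopology (top_of_set S) W) (top_of_set (h ` W)) h"
    using ch by (auto simp: is_chart_def)
  have WS: "W \<subseteq> S" using W(1) by (rule openin_imp_subset)
  have inj: "inj_on h W"
    using homeomorphic_imp_injective_map[OF hom] WS by (simp add: Int_absorb1)
  have "smooth_on_subset W h"
  proof (rule smooth_on_subset_local)
    fix x assume x: "x \<in> W"
    then obtain U and f :: "'a \<Rightarrow> 'e" where c: "(U, f) \<in> snd (submanifold S)" and xU: "x \<in> U"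
      using cover WS by blast
    note d = submanifold_chartD[OF c]
    obtain N where N: "open N" "U = S \<inter> N" using d(1) openin_open by metis
    have WO: "W \<inter> N = W \<inter> U" using N WS by blast
    have t: "smooth_on_subset (f ` (W \<inter> U)) (h \<circ> inv_into U f)"
      using comp[OF c] by (simp add: compatible_def smooth_on_open_iff_subset Int_commute)
    have "smooth_on_subset (W \<inter> U) f"
      using d(4) by (rule smooth_on_subset_mono) blast
    then have "smooth_on_subset (W \<inter> U) (\<lambda>y. (h \<circ> inv_into U f) (f y))"
      using t by (rule smooth_on_subset_comp) (rule order_refl)
    then have "smooth_on_subset (W \<inter> U) h"
      by (rule smooth_on_subset_cong[THEN iffD1, rotated]) (use d(3) in simp)
    then show "\<exists>N. open N \<and> x \<in> N \<and> smooth_on_subset (W \<inter> N) h"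
      using N xU WO by (intro exI[of _ N]) simp
  qed
  moreover have "smooth_on_subset (h ` W) (inv_into W h)"
  proof (rule smooth_on_subset_local)
    fix y assume "y \<in> h ` W"
    then obtain x where x: "x \<in> W" "y = h x" by blast
    then obtain U and f :: "'a \<Rightarrow> 'e" where c: "(U, f) \<in> snd (submanifold S)" and xU: "x \<in> U"
      using cover WS by blast
    note d = submanifold_chartD[OF c]
    let ?N = "h ` (W \<inter> U)"
    have t: "smooth_on_open ?N (f \<circ> inv_into W h)"
      using comp[OF c] by (simp add: compatible_def)
    have "smooth_on_subset ?N (\<lambda>y. inv_into U f ((f \<circ> inv_into W h) y))"
      by (rule smooth_on_subset_comp[OF _ d(6)])
         (use t inj in \<open>auto simp: smooth_on_open_iff_subset o_def\<close>)
    then have "smooth_on_subset ?N (inv_into W h)"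
      by (rule smooth_on_subset_cong[THEN iffD1, rotated]) (use d(3) inj in auto)
    moreover have "h ` W \<inter> ?N = ?N" by blast
    ultimately show "\<exists>N. open N \<and> y \<in> N \<and> smooth_on_subset (h ` W \<inter> N) (inv_into W h)"
      using smooth_on_openD(1)[OF t] x xU by (intro exI[of _ ?N]) auto
  qed
  ultimately show ?thesis using W inj by (simp add: submanifold_chart_iff smooth_on_open_iff_subset)
qed

lemma second_countable_top_of_set: "Defs.second_countable (top_of_set (S::'a::euclidean_space set))"
proof -
  obtain \<B> :: "'a set set" where B: "countable \<B>" "topological_basis \<B>"
    using ex_countable_basis by blast
  show ?thesis unfolding Defs.second_countable_def
  proof (intro exI[of _ "(\<lambda>B. S \<inter> B) ` \<B>"] conjI allI impI ballI)
    show "countable ((\<lambda>B. S \<inter> B) ` \<B>)" using B by simp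
    show "openin (top_of_set S) B" if "B \<in> (\<lambda>B. S \<inter> B) ` \<B>" for B
      using that B(2) topological_basis_open by (fastforce simp: openin_open)
    fix U x assume "openin (top_of_set S) U \<and> x \<in> U"
    then obtain T where T: "open T" "U = S \<inter> T" "x \<in> T" "x \<in> S" by (auto simp: openin_open)
    obtain B where "B \<in> \<B>" "x \<in> B" "B \<subseteq> T"
      by (rule topological_basisE[OF B(2) T(1,3)])
    with T show "\<exists>B\<in>(\<lambda>B. S \<inter> B) ` \<B>. x \<in> B \<and> B \<subseteq> U"
      by (intro bexI[of _ "S \<inter> B"]) auto
  qed
qed

lemma smooth_manifold_submanifold:
  fixes S :: "'a::euclidean_space set"
  assumes cover: "\<And>p. p \<in> S \<Longrightarrow>
    \<exists>U f. (U, f) \<in> snd (submanifold S :: ('a, 'e::euclidean_space) mfd) \<and> p \<in> U"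
  shows "smooth_manifold (submanifold S :: ('a, 'e) mfd)"
proof -
  let ?A = "snd (submanifold S :: ('a, 'e) mfd)"
  have "smooth_structure (top_of_set S) (?A)"
    unfolding smooth_structure_def
  proof (intro conjI ballI allI impI)
    show "is_chart (top_of_set S) c" if "c \<in> ?A" for c
      using that submanifold_is_chart by (metis surj_pair)
    show "(\<Union>c\<in>?A. fst c) = topspace (top_of_set S)"
    proof
      show "(\<Union>c\<in>?A. fst c) \<subseteq> topspace (top_of_set S)"
        using submanifold_chartD(2) by fastforce
      show "topspace (top_of_set S) \<subseteq> (\<Union>c\<in>?A. fst c)"
        using cover by force
    qed
    show "compatible c c'" if "c \<in> ?A" "c' \<in> ?A" for c c'
      using that by (rule submanifold_compatible)
    fix c assume c: "is_chart (top_of_set S) c \<and> (\<forall>c'\<in>?A. compatible c c')"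
    obtain W and h :: "'a \<Rightarrow> 'e" where "c = (W, h)" by (metis surj_pair)
    with c cover show "c \<in> ?A"
      using submanifold_atlas_maximal[of S W h] by blast
  qed
  moreover have "Hausdorff_space (top_of_set S)"
    by (simp add: Hausdorff_space_subtopology)
  ultimately have "smooth_manifold (top_of_set S, ?A)"
    using second_countable_top_of_set by (simp add: smooth_manifold_def)
  then show ?thesis by (simp add: submanifold_def)
qed

lemma smooth_manifold_chart_at:
  assumes "smooth_manifold (submanifold S :: ('a::euclidean_space, 'e::euclidean_space) mfd)" "p \<in> S"
  obtains U f where "(U, f) \<in> snd (submanifold S :: ('a, 'e) mfd)" "p \<in> U"
proof -
  have "(\<Union>c\<in>snd (submanifold S :: ('a, 'e) mfd). fst c) = S"
    using assms(1) unfolding smooth_manifold_iff smooth_structure_def by (simp only: fst_submanifold) simp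
  then obtain c where "c \<in> snd (submanifold S :: ('a, 'e) mfd)" "p \<in> fst c"
    using assms(2) by blast
  then show ?thesis using that[of "fst c" "snd c"] by simp
qed

lemma smooth_map_submanifold:
  fixes S :: "'a::euclidean_space set" and T :: "'b::euclidean_space set"
  assumes F: "smooth_on_subset S F" "F ` S \<subseteq> T"
    and S: "smooth_manifold (submanifold S :: ('a, 'e::euclidean_space) mfd)"
    and T: "smooth_manifold (submanifold T :: ('b, 'd::euclidean_space) mfd)"
  shows "smooth_map (submanifold S :: ('a, 'e) mfd) (submanifold T :: ('b, 'd) mfd) F"
proof -
  let ?A = "snd (submanifold S :: ('a, 'e) mfd)" and ?B = "snd (submanifold T :: ('b, 'd) mfd)"
  have "\<exists>U f V g. (U, f) \<in> ?A \<and> (V, g) \<in> ?B \<and>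
      p \<in> U \<and> F ` U \<subseteq> V \<and> smooth_on_open (f ` U) (g \<circ> F \<circ> inv_into U f)"
    if p: "p \<in> S" for p
  proof -
    obtain U f where U: "(U, f) \<in> ?A" "p \<in> U" using smooth_manifold_chart_at[OF S p] .
    obtain V g where V: "(V, g) \<in> ?B" "F p \<in> V"
      using smooth_manifold_chart_at[OF T, of "F p"] p F(2) by blast
    note c = submanifold_chartD[OF U(1)] and d = submanifold_chartD[OF V(1)]
    let ?U = "U \<inter> (S \<inter> F -` V)"
    have "openin (top_of_set S) (S \<inter> F -` V)"
      using continuous_openin_preimage[OF smooth_on_subset_continuous[OF F(1)] _ d(1)] F(2) by auto
    then have "openin (top_of_set S) ?U" using c(1) by (rule openin_Int[rotated])
    then have U': "(?U, f) \<in> ?A" by (rule submanifold_chart_restrict[OF U(1)]) blast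
    note e = submanifold_chartD[OF U']
    have FU: "smooth_on_subset ?U F" using F(1) by (rule smooth_on_subset_mono) blast
    have "smooth_on_subset (f ` ?U) (\<lambda>y. F (inv_into ?U f y))"
      by (rule smooth_on_subset_comp[OF e(6) FU]) (use inv_into_into[of _ f ?U] in blast)
    then have "smooth_on_subset (f ` ?U) (\<lambda>y. g (F (inv_into ?U f y)))"
      by (rule smooth_on_subset_comp[OF _ d(4)]) (use inv_into_into[of _ f ?U] in blast)
    then have "smooth_on_open (f ` ?U) (g \<circ> F \<circ> inv_into ?U f)"
      using e(5) by (simp add: smooth_on_open_iff_subset o_def)
    moreover have "p \<in> ?U" "F ` ?U \<subseteq> V" using p U V by auto
    ultimately show ?thesis using U' V(1)
      by (intro exI[of _ ?U] exI[of _ f] exI[of _ V] exI[of _ g]) (intro conjI)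
  qed
  then show ?thesis
    unfolding smooth_map_iff using F(2) by simp
qed

text \<open>If \<open>T\<close> has the dimension of the model space, a smooth bijection with smooth inverse from
  \<open>U\<close> onto a relatively open part of the vector space \<open>T\<close> becomes a chart after composition with
  a linear isometry from \<open>T\<close> onto the model space.\<close>

lemma submanifold_chart_of_parametrization:
  fixes S :: "'a::euclidean_space set" and T :: "'b::euclidean_space set"
  assumes U: "openin (top_of_set S) U" and T: "subspace T" "dim T = DIM('e::euclidean_space)"
    and N: "open N"
    and f: "smooth_on_subset U f" "f ` U \<subseteq> T \<inter> N"
    and b: "smooth_on_subset (T \<inter> N) b" "b ` (T \<inter> N) \<subseteq> U"
    and bf: "\<And>x. x \<in> U \<Longrightarrow> b (f x) = x" and fb: "\<And>y. y \<in> T \<inter> N \<Longrightarrow> f (b y) = y"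
  shows "\<exists>g. (U, g) \<in> snd (submanifold S :: ('a, 'e) mfd)"
proof -
  have "dim T = dim (UNIV :: 'e set)" using T(2) by (simp add: dim_UNIV)
  then obtain L :: "'b \<Rightarrow> 'e" and K where L: "linear L" "linear K" "L ` T = UNIV" "K ` UNIV = T"
    "\<And>x. x \<in> T \<Longrightarrow> K (L x) = x" "\<And>y. L (K y) = y"
    using isometries_subspaces[OF T(1) subspace_UNIV] by (metis UNIV_I)
  then have bl: "bounded_linear L" "bounded_linear K" by (simp_all add: linear_conv_bounded_linear)
  let ?g = "\<lambda>x. L (f x)"
  have im: "?g ` U = K -` N"
  proof (intro set_eqI iffI)
    fix y assume "y \<in> ?g ` U"
    then show "y \<in> K -` N" using f(2) L(5) by auto
  next
    fix y assume "y \<in> K -` N"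
    then have "K y \<in> T \<inter> N" using L(4) by auto
    then have "y = ?g (b (K y))" "b (K y) \<in> U" using fb L(6) b(2) by auto
    then show "y \<in> ?g ` U" by (rule image_eqI)
  qed
  have inj: "inj_on ?g U"
    by (rule inj_on_inverseI[of _ "\<lambda>y. b (K y)"]) (use bf f(2) L(5) in auto)
  have inv: "inv_into U ?g y = b (K y)" if "y \<in> ?g ` U" for y
  proof (rule inv_into_f_eq[OF inj])
    have "K y \<in> T \<inter> N" using that im L(4) by auto
    then show "b (K y) \<in> U" "L (f (b (K y))) = y" using b(2) fb L(6) by auto
  qed
  have "continuous_on UNIV K" using bl(2) by (simp add: linear_continuous_on)
  then have op: "open (K -` N)" using N by (simp add: open_vimage)
  have "smooth_on_subset (?g ` U) K"
    by (rule smooth_on_subset_linear[OF bl(2) smooth_on_subset_id])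
  then have "smooth_on_subset (?g ` U) (\<lambda>y. b (K y))"
    by (rule smooth_on_subset_comp[OF _ b(1)]) (use im L(4) in auto)
  then have "smooth_on_subset (?g ` U) (inv_into U ?g)"
    by (rule smooth_on_subset_cong[THEN iffD2, rotated]) (rule inv)
  moreover have "smooth_on_subset U ?g" using smooth_on_subset_linear[OF bl(1) f(1)] .
  ultimately have "(U, ?g) \<in> snd (submanifold S :: ('a, 'e) mfd)"
    using U inj op im by (simp add: submanifold_chart_iff smooth_on_open_iff_subset)
  then show ?thesis by blast
qed

section \<open>Transporting a smooth structure along a homeomorphism\<close>

lemma is_chartD:
  assumes "is_chart X (U, f)"
  shows "openin X U" "U \<subseteq> topspace X" "open (f ` U)" "inj_on f U"
    "homeomorphic_map (subtopology X U) (top_of_set (f ` U)) f"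
proof -
  show 1: "openin X U" "open (f ` U)"
    and 2: "homeomorphic_map (subtopology X U) (top_of_set (f ` U)) f"
    using assms by (auto simp: is_chart_def)
  from 1(1) show 3: "U \<subseteq> topspace X" by (rule openin_subset)
  from homeomorphic_imp_injective_map[OF 2] 3 show "inj_on f U" by (simp add: Int_absorb1)
qed

lemma is_chart_open_image:
  assumes "is_chart X (U, f)" "openin X V"
  shows "open (f ` (U \<inter> V))"
proof -
  note c = is_chartD[OF assms(1)]
  have "openin (subtopology X U) (U \<inter> V)"
    using assms(2) by (auto simp: openin_subtopology)
  then have "openin (top_of_set (f ` U)) (f ` (U \<inter> V))"
    using homeomorphic_imp_open_map[OF c(5)] by (auto simp: open_map_def)
  then show ?thesis using c(3) openin_open_trans by blast
qed

lemma is_chart_cong: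
  assumes "is_chart X (U, f)" "\<And>x. x \<in> U \<Longrightarrow> f x = g x"
  shows "is_chart X (U, g)"
proof -
  note c = is_chartD[OF assms(1)]
  have eq: "g ` U = f ` U" using assms(2) by auto
  have "homeomorphic_map (subtopology X U) (top_of_set (f ` U)) g"
    by (rule homeomorphic_map_eq[OF c(5)]) (use assms(2) in auto)
  then show ?thesis using c(1,3) eq by (simp add: is_chart_def)
qed

lemma compatible_iff:
  "compatible (U, f) (V, g) \<longleftrightarrow>
     smooth_on_open (f ` (U \<inter> V)) (\<lambda>y. g (inv_into U f y)) \<and>
     smooth_on_open (g ` (U \<inter> V)) (\<lambda>y. f (inv_into V g y))"
  by (simp add: compatible_def o_def)

text \<open>The values of a chart outside its domain are arbitrary, so everything has to respect equality
  on the domain only.\<close>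

lemma compatible_cong:
  assumes "compatible (U, f) (V, g)" "inj_on f U" "inj_on g V"
    and f: "\<And>x. x \<in> U \<Longrightarrow> f x = f' x" and g: "\<And>x. x \<in> V \<Longrightarrow> g x = g' x"
  shows "compatible (U, f') (V, g')"
proof -
  have i: "inv_into U f' = inv_into U f" "inv_into V g' = inv_into V g"
    using f g by (auto intro: inv_into_cong)
  have im: "f' ` (U \<inter> V) = f ` (U \<inter> V)" "g' ` (U \<inter> V) = g ` (U \<inter> V)"
    using f g by auto
  have 1: "g' (inv_into U f y) = g (inv_into U f y)" if "y \<in> f ` (U \<inter> V)" for y
    using that assms(2) g by auto
  have 2: "f' (inv_into V g y) = f (inv_into V g y)" if "y \<in> g ` (U \<inter> V)" for y
    using that assms(3) f by auto
  have "smooth_on_open (f ` (U \<inter> V)) (\<lambda>y. g' (inv_into U f y))"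
    "smooth_on_open (g ` (U \<inter> V)) (\<lambda>y. f' (inv_into V g y))"
    by (rule smooth_on_open_cong[THEN iffD2, OF 1], assumption,
        use assms(1) in \<open>simp add: compatible_iff\<close>)
       (rule smooth_on_open_cong[THEN iffD2, OF 2], assumption,
        use assms(1) in \<open>simp add: compatible_iff\<close>)
  then show ?thesis unfolding compatible_iff im i by blast
qed

lemma smooth_structureD:
  assumes "smooth_structure X A"
  shows "\<And>c. c \<in> A \<Longrightarrow> is_chart X c" "\<And>c c'. c \<in> A \<Longrightarrow> c' \<in> A \<Longrightarrow> compatible c c'"
    "\<And>c. is_chart X c \<Longrightarrow> (\<And>c'. c' \<in> A \<Longrightarrow> compatible c c') \<Longrightarrow> c \<in> A"
    "\<And>p. p \<in> topspace X \<Longrightarrow> \<exists>U f. (U, f) \<in> A \<and> p \<in> U"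
proof -
  fix p assume "p \<in> topspace X"
  then have "p \<in> (\<Union>c\<in>A. fst c)" using assms by (simp add: smooth_structure_def)
  then show "\<exists>U f. (U, f) \<in> A \<and> p \<in> U" by force
qed (use assms in \<open>unfold smooth_structure_def; blast\<close>)+

lemma smooth_structure_chart_cong:
  assumes S: "smooth_structure X A" and c: "(U, f) \<in> A" and eq: "\<And>x. x \<in> U \<Longrightarrow> f x = g x"
  shows "(U, g) \<in> A"
proof (rule smooth_structureD(3)[OF S])
  note ch = smooth_structureD(1)[OF S]
  show "is_chart X (U, g)" using ch[OF c] eq by (rule is_chart_cong)
  fix c' assume c': "c' \<in> A"
  obtain V h where "c' = (V, h)" by (metis surj_pair)
  then show "compatible (U, g) c'"
    using compatible_cong[of U f V h g h] smooth_structureD(2)[OF S c c'] eq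
      is_chartD(4)[of X U f] is_chartD(4)[of X V h] ch[OF c] ch[OF c'] by simp
qed

text \<open>The atlas that makes a homeomorphism \<open>\<phi>\<close> with inverse \<open>\<psi>\<close> a diffeomorphism. The inverse is
  passed as a parameter, so that charts can be moved in both directions by the same lemmas.\<close>

definition pullback_atlas ::
  "'m topology \<Rightarrow> ('m \<Rightarrow> 'p) \<Rightarrow> ('p \<Rightarrow> 'm) \<Rightarrow> ('p, 'e) chart set \<Rightarrow> ('m, 'e) chart set" where
  "pullback_atlas X \<phi> \<psi> B = {(U, f). U \<subseteq> topspace X \<and> (\<phi> ` U, f \<circ> \<psi>) \<in> B}"

lemma homeomorphic_mapsD:
  assumes "homeomorphic_maps X Y \<phi> \<psi>"
  shows "\<And>x. x \<in> topspace X \<Longrightarrow> \<psi> (\<phi> x) = x" "\<And>y. y \<in> topspace Y \<Longrightarrow> \<phi> (\<psi> y) = y"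
    "\<phi> ` topspace X = topspace Y" "\<psi> ` topspace Y = topspace X"
    "homeomorphic_map X Y \<phi>" "homeomorphic_map Y X \<psi>" "inj_on \<phi> (topspace X)"
proof -
  have *: "homeomorphic_map X Y \<phi>" "homeomorphic_map Y X \<psi>"
    using assms by (auto simp: homeomorphic_maps_map)
  then show "homeomorphic_map X Y \<phi>" "homeomorphic_map Y X \<psi>" "inj_on \<phi> (topspace X)"
    "\<phi> ` topspace X = topspace Y" "\<psi> ` topspace Y = topspace X"
    by (simp_all add: homeomorphic_imp_surjective_map homeomorphic_imp_injective_map)
qed (use assms in \<open>simp_all add: homeomorphic_maps_map\<close>)

lemma transport_image:
  assumes "homeomorphic_maps X Y \<phi> \<psi>" "U \<subseteq> topspace X"
  shows "\<psi> ` \<phi> ` U = U" "(f \<circ> \<psi>) ` \<phi> ` U = f ` U"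
proof -
  show 1: "\<psi> ` \<phi> ` U = U"
    using homeomorphic_mapsD(1)[OF assms(1)] assms(2) by (force simp: image_image)
  show "(f \<circ> \<psi>) ` \<phi> ` U = f ` U" by (simp only: image_comp[symmetric] 1)
qed

lemma transport_inv_into:
  assumes "homeomorphic_maps X Y \<phi> \<psi>" "U \<subseteq> topspace X" "inj_on f U" "y \<in> f ` U"
  shows "inj_on (f \<circ> \<psi>) (\<phi> ` U)" "inv_into (\<phi> ` U) (f \<circ> \<psi>) y = \<phi> (inv_into U f y)"
proof -
  have id: "\<psi> (\<phi> x) = x" if "x \<in> U" for x
    using homeomorphic_mapsD(1)[OF assms(1)] assms(2) that by blast
  then show 1: "inj_on (f \<circ> \<psi>) (\<phi> ` U)"
    using assms(3) by (auto simp: inj_on_def)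
  show "inv_into (\<phi> ` U) (f \<circ> \<psi>) y = \<phi> (inv_into U f y)"
    by (rule inv_into_f_eq[OF 1]) (use assms(4) id inv_into_into[OF assms(4)] in \<open>auto simp: f_inv_into_f\<close>)
qed

lemma is_chart_transport:
  assumes hom: "homeomorphic_maps X Y \<phi> \<psi>" and c: "is_chart X (U, f)"
  shows "is_chart Y (\<phi> ` U, f \<circ> \<psi>)"
proof -
  note h = homeomorphic_mapsD[OF hom] and d = is_chartD[OF c]
  note im = transport_image[OF hom d(2)]
  have "openin Y (\<phi> ` U)" using homeomorphic_imp_open_map[OF h(5)] d(1) by (simp add: open_map_def)
  moreover have "homeomorphic_map (subtopology Y (\<phi> ` U)) (subtopology X U) \<psi>"
    by (rule homeomorphic_map_subtopologies_alt[OF h(6)]) (use h(1,2) d(2) in force)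
  then have "homeomorphic_map (subtopology Y (\<phi> ` U)) (top_of_set (f ` U)) (f \<circ> \<psi>)"
    using d(5) by (rule homeomorphic_map_compose)
  ultimately show ?thesis unfolding is_chart_def split im(2) using d(3) by blast
qed

lemma compatible_transport:
  assumes hom: "homeomorphic_maps X Y \<phi> \<psi>"
    and U: "U \<subseteq> topspace X" "inj_on f U" and V: "V \<subseteq> topspace X" "inj_on g V"
  shows "compatible (\<phi> ` U, f \<circ> \<psi>) (\<phi> ` V, g \<circ> \<psi>) \<longleftrightarrow> compatible (U, f) (V, g)"
proof -
  have UV: "\<phi> ` U \<inter> \<phi> ` V = \<phi> ` (U \<inter> V)"
    using inj_on_image_Int[OF homeomorphic_mapsD(7)[OF hom]] U(1) V(1) by simp
  have sub: "U \<inter> V \<subseteq> topspace X" using U(1) by blast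
  have id: "\<psi> (\<phi> x) = x" if "x \<in> U \<or> x \<in> V" for x
    using homeomorphic_mapsD(1)[OF hom] U(1) V(1) that by blast
  have 1: "(g \<circ> \<psi>) (inv_into (\<phi> ` U) (f \<circ> \<psi>) y) = g (inv_into U f y)" if "y \<in> f ` (U \<inter> V)" for y
  proof -
    have y: "y \<in> f ` U" using that by blast
    show ?thesis using transport_inv_into(2)[OF hom U y] id inv_into_into[OF y] by simp
  qed
  have 2: "(f \<circ> \<psi>) (inv_into (\<phi> ` V) (g \<circ> \<psi>) y) = f (inv_into V g y)" if "y \<in> g ` (U \<inter> V)" for y
  proof -
    have y: "y \<in> g ` V" using that by blast
    show ?thesis using transport_inv_into(2)[OF hom V y] id inv_into_into[OF y] by simp
  qed
  show ?thesis
    unfolding compatible_iff UV transport_image(2)[OF hom sub]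
    by (intro arg_cong2[where f = "(\<and>)"] smooth_on_open_cong 1 2)
qed

lemma in_pullback_atlas_iff:
  "(U, f) \<in> pullback_atlas X \<phi> \<psi> B \<longleftrightarrow> U \<subseteq> topspace X \<and> (\<phi> ` U, f \<circ> \<psi>) \<in> B"
  by (simp add: pullback_atlas_def)

lemma pullback_chart_of_chart:
  assumes hom: "homeomorphic_maps X Y \<phi> \<psi>" and S: "smooth_structure Y B" and c: "(V, g) \<in> B"
  shows "(\<psi> ` V, g \<circ> \<phi>) \<in> pullback_atlas X \<phi> \<psi> B" "\<phi> ` \<psi> ` V = V"
proof -
  have V: "V \<subseteq> topspace Y" using smooth_structureD(1)[OF S c] by (rule is_chartD)
  note h = homeomorphic_mapsD[OF hom]
  have hom': "homeomorphic_maps Y X \<psi> \<phi>" using hom by (rule homeomorphic_maps_sym[THEN iffD1])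
  show im: "\<phi> ` \<psi> ` V = V" using transport_image(1)[OF hom' V] .
  have "(V, (g \<circ> \<phi>) \<circ> \<psi>) \<in> B"
    by (rule smooth_structure_chart_cong[OF S c]) (use V h(2) in auto)
  moreover have "\<psi> ` V \<subseteq> topspace X" using V h(4) by blast
  ultimately show "(\<psi> ` V, g \<circ> \<phi>) \<in> pullback_atlas X \<phi> \<psi> B"
    unfolding in_pullback_atlas_iff im by simp
qed

lemma pullback_chart_is_chart:
  assumes hom: "homeomorphic_maps X Y \<phi> \<psi>" and S: "smooth_structure Y B"
    and c: "(U, f) \<in> pullback_atlas X \<phi> \<psi> B"
  shows "is_chart X (U, f)"
proof -
  have U: "U \<subseteq> topspace X" "(\<phi> ` U, f \<circ> \<psi>) \<in> B" using c by (simp_all add: in_pullback_atlas_iff)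
  have hom': "homeomorphic_maps Y X \<psi> \<phi>" using hom by (rule homeomorphic_maps_sym[THEN iffD1])
  have "is_chart X (\<psi> ` \<phi> ` U, (f \<circ> \<psi>) \<circ> \<phi>)"
    by (rule is_chart_transport[OF hom' smooth_structureD(1)[OF S U(2)]])
  then have "is_chart X (U, (f \<circ> \<psi>) \<circ> \<phi>)" by (simp only: transport_image(1)[OF hom U(1)])
  then show ?thesis
    by (rule is_chart_cong) (use U(1) homeomorphic_mapsD(1)[OF hom] in auto)
qed

lemma smooth_structure_pullback:
  assumes hom: "homeomorphic_maps X Y \<phi> \<psi>" and S: "smooth_structure Y B"
  shows "smooth_structure X (pullback_atlas X \<phi> \<psi> B)"
  unfolding smooth_structure_def
proof (intro conjI ballI allI impI)
  let ?A = "pullback_atlas X \<phi> \<psi> B"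
  note h = homeomorphic_mapsD[OF hom]
  have chart: "is_chart X (U, f)" if "(U, f) \<in> ?A" for U f
    by (rule pullback_chart_is_chart[OF hom S that])
  show "is_chart X c" if "c \<in> ?A" for c using chart that by (metis surj_pair)
  show "(\<Union>c\<in>?A. fst c) = topspace X"
  proof
    show "(\<Union>c\<in>?A. fst c) \<subseteq> topspace X" by (auto simp: pullback_atlas_def)
    show "topspace X \<subseteq> (\<Union>c\<in>?A. fst c)"
    proof
      fix x assume x: "x \<in> topspace X"
      then have "\<phi> x \<in> topspace Y" using h(3) by blast
      then obtain V g where c: "(V, g) \<in> B" "\<phi> x \<in> V" using smooth_structureD(4)[OF S] by blast
      have "(\<psi> ` V, g \<circ> \<phi>) \<in> ?A" by (rule pullback_chart_of_chart[OF hom S c(1)])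
      moreover have "x \<in> \<psi> ` V" using c(2) h(1)[OF x] by (metis imageI)
      ultimately show "x \<in> (\<Union>c\<in>?A. fst c)" by force
    qed
  qed
  fix c c' assume c: "c \<in> ?A" "c' \<in> ?A"
  obtain U f V g where eq: "c = (U, f)" "c' = (V, g)" by (metis surj_pair)
  have U: "(\<phi> ` U, f \<circ> \<psi>) \<in> B" and V: "(\<phi> ` V, g \<circ> \<psi>) \<in> B"
    using c by (simp_all add: eq in_pullback_atlas_iff)
  have "is_chart X (U, f)" "is_chart X (V, g)" using c eq chart by auto
  then have i: "U \<subseteq> topspace X" "inj_on f U" "V \<subseteq> topspace X" "inj_on g V"
    using is_chartD(2,4)[of X U f] is_chartD(2,4)[of X V g] by simp_all
  show "compatible c c'"
    unfolding eq using compatible_transport[OF hom i] smooth_structureD(2)[OF S U V] by simp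
next
  let ?A = "pullback_atlas X \<phi> \<psi> B"
  note h = homeomorphic_mapsD[OF hom]
  have hom': "homeomorphic_maps Y X \<psi> \<phi>" using hom by (rule homeomorphic_maps_sym[THEN iffD1])
  fix c assume c: "is_chart X c \<and> (\<forall>c'\<in>?A. compatible c c')"
  obtain U f where eq: "c = (U, f)" by (metis surj_pair)
  note d = is_chartD[of X U f]
  have U: "is_chart X (U, f)" "U \<subseteq> topspace X" "inj_on f U" using c eq d by simp_all
  have "(\<phi> ` U, f \<circ> \<psi>) \<in> B"
  proof (rule smooth_structureD(3)[OF S])
    show ch: "is_chart Y (\<phi> ` U, f \<circ> \<psi>)" by (rule is_chart_transport[OF hom U(1)])
    fix c' assume c': "c' \<in> B"
    obtain V g where eq': "c' = (V, g)" by (metis surj_pair)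
    have ch': "is_chart Y (V, g)" using smooth_structureD(1)[OF S c'] eq' by simp
    note V = pullback_chart_of_chart[OF hom S c'[unfolded eq']]
    have W: "is_chart X (\<psi> ` V, g \<circ> \<phi>)" by (rule pullback_chart_is_chart[OF hom S V(1)])
    have "compatible (U, f) (\<psi> ` V, g \<circ> \<phi>)" using c eq V(1) by blast
    then have "compatible (\<phi> ` U, f \<circ> \<psi>) (\<phi> ` \<psi> ` V, (g \<circ> \<phi>) \<circ> \<psi>)"
      using compatible_transport[OF hom U(2,3) is_chartD(2)[OF W] is_chartD(4)[OF W]] by blast
    then have *: "compatible (\<phi> ` U, f \<circ> \<psi>) (V, (g \<circ> \<phi>) \<circ> \<psi>)" by (simp only: V(2))
    have id: "((g \<circ> \<phi>) \<circ> \<psi>) y = g y" if "y \<in> V" for y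
      using that is_chartD(2)[OF ch'] h(2) by auto
    have "inj_on ((g \<circ> \<phi>) \<circ> \<psi>) V"
      using is_chartD(4)[OF ch'] id by (simp cong: inj_on_cong)
    then show "compatible (\<phi> ` U, f \<circ> \<psi>) c'"
      unfolding eq' using compatible_cong[OF * is_chartD(4)[OF ch] _ refl id] by blast
  qed
  then show "c \<in> ?A" using U(2) by (simp add: eq in_pullback_atlas_iff)
qed

lemma second_countable_homeomorphic:
  assumes hom: "homeomorphic_maps X Y \<phi> \<psi>" and "Defs.second_countable Y"
  shows "Defs.second_countable X"
proof -
  note h = homeomorphic_mapsD[OF hom]
  obtain \<B> where B: "countable \<B>" "\<And>B. B \<in> \<B> \<Longrightarrow> openin Y B"
    "\<And>U x. openin Y U \<Longrightarrow> x \<in> U \<Longrightarrow> \<exists>B\<in>\<B>. x \<in> B \<and> B \<subseteq> U"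
    using assms(2) unfolding Defs.second_countable_def by metis
  show ?thesis unfolding Defs.second_countable_def
  proof (intro exI[of _ "(`) \<psi> ` \<B>"] conjI ballI allI impI)
    show "countable ((`) \<psi> ` \<B>)" using B(1) by simp
    show "openin X C" if "C \<in> (`) \<psi> ` \<B>" for C
      using that B(2) homeomorphic_imp_open_map[OF h(6)] by (auto simp: open_map_def)
    fix U x assume U: "openin X U \<and> x \<in> U"
    then have "openin Y (\<phi> ` U)" "\<phi> x \<in> \<phi> ` U" "U \<subseteq> topspace X"
      using homeomorphic_imp_open_map[OF h(5)] by (auto simp: open_map_def dest: openin_subset)
    moreover then obtain C where "C \<in> \<B>" "\<phi> x \<in> C" "C \<subseteq> \<phi> ` U" using B(3) by metis
    moreover have "\<psi> (\<phi> x) = x" using U calculation h(1) by blast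
    moreover have "\<psi> ` C \<subseteq> \<psi> ` \<phi> ` U" using calculation by (intro image_mono) simp
    ultimately show "\<exists>C\<in>(`) \<psi> ` \<B>. x \<in> C \<and> C \<subseteq> U"
      using transport_image(1)[OF hom, of U]
      by (intro bexI[of _ "\<psi> ` C"]) (auto intro: rev_image_eqI)
  qed
qed

lemma smooth_manifold_pullback:
  assumes "homeomorphic_maps X (fst N) \<phi> \<psi>" "smooth_manifold N"
  shows "smooth_manifold (X, pullback_atlas X \<phi> \<psi> (snd N))"
proof -
  have "Hausdorff_space X"
    using assms homeomorphic_Hausdorff_space[of X "fst N"]
    by (auto simp: smooth_manifold_iff homeomorphic_space_def)
  then show ?thesis
    using assms smooth_structure_pullback[OF assms(1), of "snd N"] second_countable_homeomorphic[OF assms(1)]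
    by (simp add: smooth_manifold_iff)
qed

lemma smooth_on_open_id: "open W \<Longrightarrow> smooth_on_open W (\<lambda>x. x)"
  by (simp add: smooth_on_open_iff_subset smooth_on_subset_id)

lemma diffeomorphism_pullback:
  assumes hom: "homeomorphic_maps X (fst N) \<phi> \<psi>" and N: "smooth_manifold N"
  shows "diffeomorphism (X, pullback_atlas X \<phi> \<psi> (snd N)) N \<phi>"
proof -
  let ?A = "pullback_atlas X \<phi> \<psi> (snd N)" and ?i = "inv_into (topspace X) \<phi>"
  note h = homeomorphic_mapsD[OF hom]
  have S: "smooth_structure (fst N) (snd N)" using N by (simp add: smooth_manifold_iff)
  have bij: "bij_betw \<phi> (topspace X) (topspace (fst N))"
    using h(3,7) by (simp add: bij_betw_def)
  have i: "?i y = \<psi> y" if "y \<in> topspace (fst N)" for y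
    using that h(1,2,4,7) by (intro inv_into_f_eq) auto
  have "\<exists>U f V g. (U, f) \<in> ?A \<and> (V, g) \<in> snd N \<and>
      p \<in> U \<and> \<phi> ` U \<subseteq> V \<and> smooth_on_open (f ` U) (g \<circ> \<phi> \<circ> inv_into U f)"
    if p: "p \<in> topspace X" for p
  proof -
    have "\<phi> p \<in> topspace (fst N)" using p h(3) by blast
    then obtain V g where c: "(V, g) \<in> snd N" "\<phi> p \<in> V" using smooth_structureD(4)[OF S] by blast
    note d = pullback_chart_of_chart[OF hom S c(1)]
    have ch: "is_chart X (\<psi> ` V, g \<circ> \<phi>)" by (rule pullback_chart_is_chart[OF hom S d(1)])
    have "(g \<circ> \<phi> \<circ> inv_into (\<psi> ` V) (g \<circ> \<phi>)) y = y" if "y \<in> (g \<circ> \<phi>) ` \<psi> ` V" for y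
      using f_inv_into_f[OF that] by simp
    then have "smooth_on_open ((g \<circ> \<phi>) ` \<psi> ` V) (g \<circ> \<phi> \<circ> inv_into (\<psi> ` V) (g \<circ> \<phi>))"
      by (rule smooth_on_open_cong[THEN iffD2, OF _ smooth_on_open_id[OF is_chartD(3)[OF ch]]])
    moreover have "p \<in> \<psi> ` V" using c(2) h(1)[OF p] by (metis imageI)
    ultimately show ?thesis using c(1) d
      by (intro exI[of _ "\<psi> ` V"] exI[of _ "g \<circ> \<phi>"] exI[of _ V] exI[of _ g]) (intro conjI; simp)
  qed
  then have 1: "smooth_map (X, ?A) N \<phi>" unfolding smooth_map_iff using h(3) by simp
  have "\<exists>V g U f. (V, g) \<in> snd N \<and> (U, f) \<in> ?A \<and>
      q \<in> V \<and> ?i ` V \<subseteq> U \<and> smooth_on_open (g ` V) (f \<circ> ?i \<circ> inv_into V g)"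
    if q: "q \<in> topspace (fst N)" for q
  proof -
    obtain V g where c: "(V, g) \<in> snd N" "q \<in> V" using smooth_structureD(4)[OF S q] by blast
    have ch: "is_chart (fst N) (V, g)" by (rule smooth_structureD(1)[OF S c(1)])
    note d = pullback_chart_of_chart[OF hom S c(1)]
    have V: "V \<subseteq> topspace (fst N)" by (rule is_chartD(2)[OF ch])
    have "((g \<circ> \<phi>) \<circ> ?i \<circ> inv_into V g) y = y" if y: "y \<in> g ` V" for y
    proof -
      have "inv_into V g y \<in> topspace (fst N)" using inv_into_into[OF y] V by blast
      then show ?thesis using i h(2) f_inv_into_f[OF y] by simp
    qed
    then have "smooth_on_open (g ` V) ((g \<circ> \<phi>) \<circ> ?i \<circ> inv_into V g)"
      by (rule smooth_on_open_cong[THEN iffD2, OF _ smooth_on_open_id[OF is_chartD(3)[OF ch]]])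
    moreover have "?i ` V \<subseteq> \<psi> ` V" using V i by auto
    ultimately show ?thesis using c d
      by (intro exI[of _ V] exI[of _ g] exI[of _ "\<psi> ` V"] exI[of _ "g \<circ> \<phi>"]) (intro conjI; simp)
  qed
  moreover have "?i ` topspace (fst N) \<subseteq> topspace X" using i h(4) by auto
  ultimately have 2: "smooth_map N (X, ?A) ?i" unfolding smooth_map_iff by simp
  show ?thesis
    unfolding diffeomorphism_def using N smooth_manifold_pullback[OF hom N] bij 1 2 by simp
qed

lemma smooth_submersion_iff:
  "smooth_submersion M N F \<longleftrightarrow>
     smooth_map M N F \<and>
     (\<forall>U f V g p. (U, f) \<in> snd M \<longrightarrow> (V, g) \<in> snd N \<longrightarrow> p \<in> topspace (fst M) \<longrightarrow> p \<in> U \<longrightarrow> F p \<in> V \<longrightarrow>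
        surj (frechet_derivative (g \<circ> F \<circ> inv_into U f) (at (f p))))"
  unfolding smooth_submersion_def by fast

text \<open>In the charts of the pulled back atlas \<open>\<pi>\<close> has the same coordinate expressions as \<open>\<phi> \<circ> \<pi>\<close>.\<close>

lemma smooth_submersion_pullback:
  assumes hom: "homeomorphic_maps X (fst N) \<phi> \<psi>"
    and S: "smooth_structure (fst M) (snd M)" "smooth_structure (fst N) (snd N)"
    and h: "smooth_submersion M N h"
    and \<pi>: "\<And>p. p \<in> topspace (fst M) \<Longrightarrow> \<pi> p \<in> topspace X \<and> \<phi> (\<pi> p) = h p"
  shows "smooth_submersion M (X, pullback_atlas X \<phi> \<psi> (snd N)) \<pi>"
proof -
  let ?A = "pullback_atlas X \<phi> \<psi> (snd N)"
  have \<pi>': "\<pi> p = \<psi> (h p)" if "p \<in> topspace (fst M)" for p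
    using \<pi>[OF that] homeomorphic_mapsD(1)[OF hom] by metis
  have sm: "smooth_map M N h" using h by (simp add: smooth_submersion_def)
  have "\<exists>U f V g. (U, f) \<in> snd M \<and> (V, g) \<in> ?A \<and>
      p \<in> U \<and> \<pi> ` U \<subseteq> V \<and> smooth_on_open (f ` U) (g \<circ> \<pi> \<circ> inv_into U f)"
    if p: "p \<in> topspace (fst M)" for p
  proof -
    obtain U f V g where c: "(U, f) \<in> snd M" "(V, g) \<in> snd N" "p \<in> U" "h ` U \<subseteq> V"
      and sm: "smooth_on_open (f ` U) (g \<circ> h \<circ> inv_into U f)"
      using sm p unfolding smooth_map_iff by metis
    have U: "U \<subseteq> topspace (fst M)" by (rule is_chartD(2)[OF smooth_structureD(1)[OF S(1) c(1)]])
    have "((g \<circ> \<phi>) \<circ> \<pi> \<circ> inv_into U f) y = (g \<circ> h \<circ> inv_into U f) y" if "y \<in> f ` U" for y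
      using inv_into_into[OF that] U \<pi> by auto
    then have "smooth_on_open (f ` U) ((g \<circ> \<phi>) \<circ> \<pi> \<circ> inv_into U f)"
      using sm by (rule smooth_on_open_cong[THEN iffD2])
    moreover have "\<pi> ` U \<subseteq> \<psi> ` V"
    proof (rule image_subsetI)
      fix x assume "x \<in> U"
      then show "\<pi> x \<in> \<psi> ` V" using \<pi>'[of x] U c(4) by auto
    qed
    ultimately show ?thesis
      using c pullback_chart_of_chart(1)[OF hom S(2) c(2)] by blast
  qed
  moreover have "\<pi> ` topspace (fst M) \<subseteq> topspace X" using \<pi> by blast
  ultimately have 1: "smooth_map M (X, ?A) \<pi>" unfolding smooth_map_iff by simp
  have 2: "surj (frechet_derivative (g \<circ> \<pi> \<circ> inv_into U f) (at (f p)))"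
    if c: "(U, f) \<in> snd M" "(V, g) \<in> ?A" "p \<in> topspace (fst M)" "p \<in> U" "\<pi> p \<in> V" for U f V g p
  proof -
    have V: "(\<phi> ` V, g \<circ> \<psi>) \<in> snd N" using c(2) by (simp add: in_pullback_atlas_iff)
    have ch: "is_chart (fst M) (U, f)" by (rule smooth_structureD(1)[OF S(1) c(1)])
    have "h p \<in> \<phi> ` V" using \<pi>[OF c(3)] c(5) by (metis imageI)
    then have s: "surj (frechet_derivative ((g \<circ> \<psi>) \<circ> h \<circ> inv_into U f) (at (f p)))"
      using h c V unfolding smooth_submersion_iff by blast
    have "(g \<circ> \<pi> \<circ> inv_into U f) y = ((g \<circ> \<psi>) \<circ> h \<circ> inv_into U f) y" if "y \<in> f ` U" for y
      using inv_into_into[OF that] is_chartD(2)[OF ch] \<pi>' by auto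
    then have "frechet_derivative (g \<circ> \<pi> \<circ> inv_into U f) (at (f p)) =
        frechet_derivative ((g \<circ> \<psi>) \<circ> h \<circ> inv_into U f) (at (f p))"
      by (rule frechet_derivative_cong[OF is_chartD(3)[OF ch] imageI[OF c(4)]])
    then show ?thesis using s by simp
  qed
  show ?thesis unfolding smooth_submersion_iff using 1 2 by simp
qed

section \<open>Uniqueness of the smooth structure below a submersion\<close>

lemma smooth_on_open_derivative:
  assumes "smooth_on_open S f"
  shows "smooth_on_open S (\<lambda>x. frechet_derivative f (at x) v)"
proof -
  have "C_times m S (\<lambda>x. frechet_derivative f (at x) v)" for m
    using smooth_on_openD(2)[OF assms, of "Suc m"] by simp
  then show ?thesis using smooth_on_openD(1)[OF assms] by (simp add: smooth_on_open_def)
qed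

text \<open>The inverse function theorem gives a \<open>C\<^sup>1\<close> local inverse \<open>s\<close> with
  \<open>s' y = (\<Phi>' (s y))\<^sup>-\<^sup>1\<close>. The right-hand side is a smooth function of \<open>s y\<close>, hence
  \<open>s\<close> gains one order of differentiability at a time.\<close>

lemma smooth_inverse_function_theorem:
  fixes \<Phi> :: "real^'d \<Rightarrow> real^'d"
  assumes \<Phi>: "smooth_on_open T \<Phi>" and t0: "t0 \<in> T"
    and inj: "inj (frechet_derivative \<Phi> (at t0))"
  obtains V s where "open V" "\<Phi> t0 \<in> V" "smooth_on_open V s" "s ` V \<subseteq> T" "\<And>y. y \<in> V \<Longrightarrow> \<Phi> (s y) = y"
proof -
  let ?D = "\<lambda>x. frechet_derivative \<Phi> (at x)"
  note d = smooth_on_openD[OF \<Phi>]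
  have bl: "bounded_linear (?D x)" if "x \<in> T" for x
    using d(4)[OF that] by (rule has_derivative_bounded_linear)
  define f' where "f' x = Blinfun (?D x)" for x
  have f': "blinfun_apply (f' x) = ?D x" if "x \<in> T" for x
    unfolding f'_def using bl[OF that] by (rule bounded_linear_Blinfun_apply)
  have der: "(\<Phi> has_derivative blinfun_apply (f' x)) (at x)" if "x \<in> T" for x
    using d(4)[OF that] f'[OF that] by simp
  have cont: "continuous_on T f'"
  proof (rule continuous_on_blinfun_componentwise)
    fix i :: "real^'d"
    have "continuous_on T (\<lambda>x. ?D x i)"
      using smooth_on_open_derivative[OF \<Phi>] by (rule smooth_on_openD(3))
    then show "continuous_on T (\<lambda>x. blinfun_apply (f' x) i)"
      by (simp add: f' cong: continuous_on_cong)
  qed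
  obtain K where K: "linear K" "K \<circ> ?D t0 = id"
    using linear_injective_left_inverse[OF bounded_linear.linear[OF bl[OF t0]] inj] by blast
  then have "bounded_linear K" by (simp add: linear_conv_bounded_linear)
  then have "Blinfun K o\<^sub>L f' t0 = id_blinfun"
    using K(2) by (intro blinfun_eqI) (simp add: bounded_linear_Blinfun_apply f' t0 pointfree_idE)
  from inverse_function_theorem[OF d(1) der cont t0 this]
  obtain U V s g' where U: "open U" "U \<subseteq> T" "t0 \<in> U" and V: "open V" "\<Phi> t0 \<in> V"
    and hom: "homeomorphism U V \<Phi> s"
    and ders: "\<And>y. y \<in> V \<Longrightarrow> (s has_derivative (g' y)) (at y)"
    and g': "\<And>y. y \<in> V \<Longrightarrow> g' y = inv (blinfun_apply (f' (s y)))"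
    and bij: "\<And>y. y \<in> V \<Longrightarrow> bij (blinfun_apply (f' (s y)))"
    by blast
  have sV: "s ` V \<subseteq> U" and sf: "\<And>y. y \<in> V \<Longrightarrow> \<Phi> (s y) = y" and cs: "continuous_on V s"
    using hom by (auto simp: homeomorphism_def)
  define J where "J x = matrix (?D x)" for x
  have J: "J x *v v = ?D x v" if "x \<in> T" for x v
    unfolding J_def using bl[OF that] by (simp add: matrix_works bounded_linear.linear)
  have Js: "smooth_on_subset T J"
  proof (intro smooth_on_subset_vec)
    fix i j
    have "smooth_on_subset T (\<lambda>x. ?D x (axis j 1) $ i)"
      using smooth_on_open_derivative[OF \<Phi>]
      by (intro smooth_on_subset_vec_nth) (simp add: smooth_on_open_iff_subset)
    then show "smooth_on_subset T (\<lambda>x. J x $ i $ j)"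
      by (simp add: J_def matrix_def)
  qed
  define W where "W = T \<inter> {x. det (J x) \<noteq> 0}"
  have W: "open W"
  proof -
    have "smooth_on_subset T (\<lambda>x. det (J x))"
      by (intro smooth_on_subset_det smooth_on_subset_vec_nth Js)
    then have "open (T \<inter> (\<lambda>x. det (J x)) -` (- {0}))"
      using d(1) by (intro continuous_open_preimage smooth_on_subset_continuous) (auto simp: open_Compl)
    moreover have "W = T \<inter> (\<lambda>x. det (J x)) -` (- {0})" by (auto simp: W_def)
    ultimately show ?thesis by simp
  qed
  have inv_smooth: "smooth_on_open W (\<lambda>x. matrix_inv (J x) *v v)" for v
  proof -
    have "bounded_linear (\<lambda>A::real^'d^'d. A *v v)"
      unfolding linear_conv_bounded_linear[symmetric]
      by (rule linearI) (simp_all add: matrix_vector_mult_add_rdistrib scaleR_matrix_vector_assoc)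
    moreover have "smooth_on_subset W (\<lambda>x. matrix_inv (J x))"
      by (rule smooth_on_subset_matrix_inv) (auto simp: W_def intro: smooth_on_subset_mono[OF Js])
    ultimately show ?thesis
      using W smooth_on_subset_linear by (auto simp: smooth_on_open_iff_subset)
  qed
  have sW: "s y \<in> W" and g'_eq: "g' y v = matrix_inv (J (s y)) *v v" if y: "y \<in> V" for y v
  proof -
    have T: "s y \<in> T" using y sV U(2) by blast
    have b: "bij (?D (s y))" using bij[OF y] f'[OF T] by simp
    have "J (s y) *v x = ?D (s y) x" for x using J[OF T] .
    then have JD: "(*v) (J (s y)) = ?D (s y)" by blast
    then have "invertible (J (s y))"
      using b by (simp add: invertible_eq_bij)
    then have det: "det (J (s y)) \<noteq> 0" by (simp add: invertible_det_nz)
    then show "s y \<in> W" using T by (simp add: W_def)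
    have "?D (s y) (matrix_inv (J (s y)) *v v) = v"
      using matrix_inv_works(1)[OF det] by (simp add: J[OF T, symmetric] matrix_vector_mul_assoc)
    then show "g' y v = matrix_inv (J (s y)) *v v"
      unfolding g'[OF y] f'[OF T] using b by (metis bij_inv_eq_iff)
  qed
  have "C_times m V s" for m
  proof (induction m)
    case 0
    then show ?case using cs by simp
  next
    case (Suc m)
    show ?case
    proof (rule C_times_SucI[OF V(1) ders])
      fix v
      have "C_times m V (\<lambda>y. matrix_inv (J (s y)) *v v)"
        by (rule C_times_comp[OF V(1) W Suc smooth_on_openD(2)[OF inv_smooth]]) (use sW in blast)
      then show "C_times m V (\<lambda>y. g' y v)"
        by (rule C_times_cong[OF V(1), THEN iffD2, rotated]) (rule g'_eq)
    qed
  qed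
  then have "smooth_on_open V s" using V(1) by (simp add: smooth_on_open_def)
  then show ?thesis using that V sf sV U(2) by blast
qed

text \<open>Smoothness descends along a submersion \<open>G\<close>: restricted to an affine subspace complementary
  to the kernel of its derivative, \<open>G\<close> has a smooth local inverse \<open>s\<close>, and \<open>k = H \<circ> s\<close>.\<close>

lemma smooth_descends:
  fixes G :: "'a::euclidean_space \<Rightarrow> real^'d" and H :: "'a \<Rightarrow> 'b::euclidean_space"
  assumes G: "smooth_on_open D G" and x0: "x0 \<in> D"
    and surj: "surj (frechet_derivative G (at x0))"
    and H: "smooth_on_open D H" and k: "\<And>x. x \<in> D \<Longrightarrow> k (G x) = H x"
  shows "\<exists>E. G x0 \<in> E \<and> smooth_on_open E k"
proof -
  let ?L = "frechet_derivative G (at x0)"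
  note d = smooth_on_openD[OF G]
  have "linear ?L" using d(4)[OF x0] by (rule has_derivative_linear)
  then obtain R where R: "linear R" "?L \<circ> R = id"
    using linear_surjective_right_inverse[OF _ surj] by blast
  have bR: "bounded_linear R" using R(1) by (simp add: linear_conv_bounded_linear)
  define r where "r t = x0 + R t" for t
  define T where "T = r -` D"
  have r: "smooth_on_subset UNIV r"
    unfolding r_def by (intro smooth_on_subset_add smooth_on_subset_const
        smooth_on_subset_linear[OF bR] smooth_on_subset_id)
  have T: "open T"
    unfolding T_def using d(1) smooth_on_subset_continuous[OF r] by (rule open_vimage)
  have r0: "r 0 = x0" unfolding r_def using R(1) by (simp add: linear_0)
  have "smooth_on_subset T (\<lambda>t. G (r t))"
    by (rule smooth_on_subset_comp[OF smooth_on_subset_mono[OF r subset_UNIV], where T = D])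
       (use G in \<open>auto simp: T_def smooth_on_open_iff_subset\<close>)
  then have \<Phi>: "smooth_on_open T (\<lambda>t. G (r t))" using T by (simp add: smooth_on_open_iff_subset)
  have "(r has_derivative R) (at 0)"
    unfolding r_def using bounded_linear_imp_has_derivative[OF bR]
    by (auto intro!: derivative_eq_intros)
  then have "((\<lambda>t. G (r t)) has_derivative (\<lambda>t. ?L (R t))) (at 0)"
    by (rule has_derivative_compose) (use d(4)[OF x0] r0 in simp)
  moreover have "(\<lambda>t. ?L (R t)) = id" using R(2) by (auto simp: fun_eq_iff)
  ultimately have "frechet_derivative (\<lambda>t. G (r t)) (at 0) = id"
    using frechet_derivative_at by metis
  then have inj: "inj (frechet_derivative (\<lambda>t. G (r t)) (at 0))" by simp
  have "0 \<in> T" using x0 r0 by (simp add: T_def)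
  then obtain V s where V: "open V" "G x0 \<in> V" "smooth_on_open V s" "s ` V \<subseteq> T"
    "\<And>y. y \<in> V \<Longrightarrow> G (r (s y)) = y"
    using smooth_inverse_function_theorem[OF \<Phi> _ inj] r0 by metis
  have "smooth_on_subset V (\<lambda>y. r (s y))"
    using V(3) by (intro smooth_on_subset_comp[OF _ r]) (auto simp: smooth_on_open_iff_subset)
  then have "smooth_on_subset V (\<lambda>y. H (r (s y)))"
    by (rule smooth_on_subset_comp[where T = D])
       (use H V(4) in \<open>auto simp: T_def smooth_on_open_iff_subset\<close>)
  moreover have "H (r (s y)) = k y" if "y \<in> V" for y
  proof -
    have "r (s y) \<in> D" using V(4) that by (auto simp: T_def)
    from k[OF this] show ?thesis using V(5)[OF that] by simp
  qed
  ultimately have "smooth_on_subset V k"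
    using smooth_on_subset_cong[of V "\<lambda>y. H (r (s y))" k] by blast
  then show ?thesis using V by (auto simp: smooth_on_open_iff_subset)
qed

text \<open>The definition of smooth maps provides a single pair of charts around each point; any other pair
  differs from it by smooth changes of charts, on a possibly smaller domain \<open>D\<close>.\<close>

lemma smooth_map_in_charts:
  assumes M: "smooth_structure (fst M) (snd M)" and N: "smooth_structure (fst N) (snd N)"
    and F: "smooth_map M N F"
    and f: "(U, f) \<in> snd M" and g: "(V, g) \<in> snd N" and p: "p \<in> U" "F p \<in> V"
  shows "\<exists>D. f p \<in> D \<and> D \<subseteq> f ` U \<and> (\<forall>x\<in>D. F (inv_into U f x) \<in> V) \<and>
    smooth_on_open D (g \<circ> F \<circ> inv_into U f)"
proof -
  note cf = is_chartD[OF smooth_structureD(1)[OF M f]]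
    and cg = is_chartD[OF smooth_structureD(1)[OF N g]]
  obtain U1 f1 V1 g1 where c: "(U1, f1) \<in> snd M" "(V1, g1) \<in> snd N" "p \<in> U1" "F ` U1 \<subseteq> V1"
    and sm: "smooth_on_open (f1 ` U1) (g1 \<circ> F \<circ> inv_into U1 f1)"
    using F p cf(2) unfolding smooth_map_iff by (meson subsetD)
  note cf1 = is_chartD[OF smooth_structureD(1)[OF M c(1)]]
    and cg1 = is_chartD[OF smooth_structureD(1)[OF N c(2)]]
  let ?t = "\<lambda>x. f1 (inv_into U f x)" and ?G = "\<lambda>x. g1 (F (inv_into U1 f1 x))"
  have t: "smooth_on_open (f ` (U \<inter> U1)) ?t"
    using smooth_structureD(2)[OF M f c(1)] by (simp add: compatible_iff)
  have Gs: "smooth_on_open (g1 ` (V1 \<inter> V)) (\<lambda>y. g (inv_into V1 g1 y))"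
    using smooth_structureD(2)[OF N c(2) g] by (simp add: compatible_iff)
  have sm': "smooth_on_subset (f1 ` U1) ?G" using sm by (simp add: smooth_on_open_iff_subset o_def)
  have tim: "?t ` f ` (U \<inter> U1) \<subseteq> f1 ` U1" using cf(4) by auto
  have Gt: "smooth_on_subset (f ` (U \<inter> U1)) (\<lambda>x. ?G (?t x))"
    using t tim by (intro smooth_on_subset_comp[OF _ sm']) (simp_all add: smooth_on_open_iff_subset)
  have Gt_eq: "?G (?t x) = g1 (F (inv_into U f x))" if "x \<in> f ` (U \<inter> U1)" for x
    using that cf(4) cf1(4) by auto
  define D where "D = f ` (U \<inter> U1) \<inter> (\<lambda>x. ?G (?t x)) -` (g1 ` (V1 \<inter> V))"
  have "open D"
    unfolding D_def using smooth_on_openD(1)[OF Gs] smooth_on_openD(1)[OF t]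
    by (intro continuous_open_preimage smooth_on_subset_continuous[OF Gt])
  have FV: "F (inv_into U f x) \<in> V1 \<inter> V" if x: "x \<in> D" for x
  proof -
    have x': "x \<in> f ` (U \<inter> U1)" using x by (simp add: D_def)
    have "g1 (F (inv_into U f x)) \<in> g1 ` (V1 \<inter> V)"
      using x Gt_eq[OF x'] by (simp add: D_def)
    then obtain z where "z \<in> V1 \<inter> V" "g1 (F (inv_into U f x)) = g1 z" by blast
    moreover have "F (inv_into U f x) \<in> V1" using x' cf(4) c(4) by auto
    ultimately show ?thesis using cg1(4) by (metis IntD1 inj_onD)
  qed
  have "smooth_on_subset D (\<lambda>x. g (inv_into V1 g1 (?G (?t x))))"
    by (rule smooth_on_subset_comp[OF smooth_on_subset_mono[OF Gt], where T = "g1 ` (V1 \<inter> V)"])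
       (use Gs in \<open>auto simp: D_def smooth_on_open_iff_subset\<close>)
  then have "smooth_on_subset D (g \<circ> F \<circ> inv_into U f)"
  proof (rule smooth_on_subset_cong[THEN iffD1, rotated])
    fix x assume x: "x \<in> D"
    then have "?G (?t x) = g1 (F (inv_into U f x))" by (intro Gt_eq) (simp add: D_def)
    then show "g (inv_into V1 g1 (?G (?t x))) = (g \<circ> F \<circ> inv_into U f) x"
      using FV[OF x] cg1(4) by simp
  qed
  moreover have "f p \<in> D" using p c(3,4) cf(4) cf1(4) by (auto simp: D_def)
  moreover have "D \<subseteq> f ` U" by (auto simp: D_def)
  ultimately show ?thesis using FV \<open>open D\<close> by (intro exI[of _ D]) (auto simp: smooth_on_open_iff_subset)
qed

text \<open>Lift a point to \<open>M\<close> and read \<open>\<pi>\<close> in the charts \<open>g\<close> and \<open>h\<close>. The first expression is a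
  submersion, the second one is smooth and factors through the first by the change of charts, which
  is smooth by descent.\<close>

lemma submersion_transition_smooth:
  fixes A :: "('m, real^'d) chart set" and B :: "('m, 'e::euclidean_space) chart set"
  assumes M: "smooth_structure (fst M) (snd M)"
    and A: "smooth_structure X A" "smooth_submersion M (X, A) \<pi>"
    and B: "smooth_structure X B" "smooth_map M (X, B) \<pi>"
    and onto: "\<pi> ` topspace (fst M) = topspace X"
    and g: "(V, g) \<in> A" and h: "(W, h) \<in> B"
  shows "smooth_on_open (g ` (V \<inter> W)) (\<lambda>y. h (inv_into V g y))"
proof -
  have ch: "is_chart X (V, g)" "is_chart X (W, h)"
    using g h A(1) B(1) by (simp_all add: smooth_structureD(1))
  have op: "open (g ` (V \<inter> W))" using ch(1) is_chartD(1)[OF ch(2)] by (rule is_chart_open_image)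
  have sm: "smooth_map M (X, A) \<pi>" using A(2) by (simp add: smooth_submersion_def)
  have "\<exists>E. open E \<and> y \<in> E \<and> smooth_on_subset (g ` (V \<inter> W) \<inter> E) (\<lambda>y. h (inv_into V g y))"
    if y: "y \<in> g ` (V \<inter> W)" for y
  proof -
    obtain q where q: "q \<in> V" "q \<in> W" "y = g q" using y by blast
    then have "q \<in> \<pi> ` topspace (fst M)" using is_chartD(2)[OF ch(1)] onto by blast
    then obtain p where p: "p \<in> topspace (fst M)" "q = \<pi> p" by blast
    obtain U f where f: "(U, f) \<in> snd M" "p \<in> U" using smooth_structureD(4)[OF M p(1)] by blast
    let ?G = "g \<circ> \<pi> \<circ> inv_into U f" and ?H = "h \<circ> \<pi> \<circ> inv_into U f"
    obtain D where D: "f p \<in> D" "D \<subseteq> f ` U" "\<And>x. x \<in> D \<Longrightarrow> \<pi> (inv_into U f x) \<in> V"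
      "smooth_on_open D ?G"
      using smooth_map_in_charts[OF M _ sm f(1), of V g p] A(1) g f(2) q p(2) by auto
    obtain D' where D': "f p \<in> D'" "smooth_on_open D' ?H"
      using smooth_map_in_charts[OF M _ B(2) f(1), of W h p] B(1) h f(2) q p(2) by auto
    have op2: "open (D \<inter> D')"
      by (intro open_Int smooth_on_openD(1)[OF D(4)] smooth_on_openD(1)[OF D'(2)])
    have G: "smooth_on_open (D \<inter> D') ?G" using D(4) op2 by (rule smooth_on_open_mono) simp
    have H: "smooth_on_open (D \<inter> D') ?H" using D'(2) op2 by (rule smooth_on_open_mono) simp
    have surj: "surj (frechet_derivative ?G (at (f p)))"
      using A(2) f g p q(1) unfolding smooth_submersion_iff by simp
    have "h (inv_into V g (?G x)) = ?H x" if "x \<in> D \<inter> D'" for x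
      using that D(3) is_chartD(4)[OF ch(1)] by simp
    from smooth_descends[where k = "\<lambda>y. h (inv_into V g y)", OF G _ surj H this] D(1) D'(1)
    obtain E where E: "?G (f p) \<in> E" "smooth_on_open E (\<lambda>y. h (inv_into V g y))" by auto
    have "?G (f p) = y"
      using is_chartD(4)[OF smooth_structureD(1)[OF M f(1)]] f(2) p(2) q(3) by simp
    moreover have "smooth_on_subset (g ` (V \<inter> W) \<inter> E) (\<lambda>y. h (inv_into V g y))"
      by (rule smooth_on_subset_mono[of E]) (use E(2) in \<open>simp_all add: smooth_on_open_iff_subset\<close>)
    ultimately show ?thesis
      using E(1) smooth_on_openD(1)[OF E(2)] by (intro exI[of _ E]) simp
  qed
  then have "smooth_on_subset (g ` (V \<inter> W)) (\<lambda>y. h (inv_into V g y))"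
    by (rule smooth_on_subset_local)
  then show ?thesis using op by (simp add: smooth_on_open_iff_subset)
qed

text \<open>By maximality it suffices that any two charts of the two atlases are compatible.\<close>

lemma submersion_structure_unique:
  fixes A B :: "('m, real^'d) chart set"
  assumes M: "smooth_structure (fst M) (snd M)"
    and A: "smooth_structure X A" "smooth_submersion M (X, A) \<pi>"
    and B: "smooth_structure X B" "smooth_submersion M (X, B) \<pi>"
    and onto: "\<pi> ` topspace (fst M) = topspace X"
  shows "A = B"
proof -
  have sub: "A \<subseteq> B"
    if A: "smooth_structure X A" "smooth_submersion M (X, A) \<pi>"
      and B: "smooth_structure X B" "smooth_submersion M (X, B) \<pi>"
    for A B :: "('m, real^'d) chart set"
  proof
    fix c assume c: "c \<in> A"
    have sm: "smooth_map M (X, A) \<pi>" "smooth_map M (X, B) \<pi>"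
      using A(2) B(2) by (simp_all add: smooth_submersion_def)
    show "c \<in> B"
    proof (rule smooth_structureD(3)[OF B(1)])
      show "is_chart X c" using A(1) c by (rule smooth_structureD(1))
      fix c' assume c': "c' \<in> B"
      obtain V g W h where eq: "c = (V, g)" "c' = (W, h)" by (metis surj_pair)
      have "smooth_on_open (g ` (V \<inter> W)) (\<lambda>y. h (inv_into V g y))"
        using submersion_transition_smooth[OF M A B(1) sm(2) onto] c c' eq by simp
      moreover have "smooth_on_open (h ` (W \<inter> V)) (\<lambda>y. g (inv_into W h y))"
        using submersion_transition_smooth[OF M B A(1) sm(1) onto] c c' eq by simp
      ultimately show "compatible c c'" by (simp add: eq compatible_iff Int_commute)
    qed
  qed
  show ?thesis using sub[OF A B] sub[OF B A] by blast
qed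

section \<open>Matrix algebra and positive matrices\<close>

lemmas mm_rules =
  bounded_bilinear.add_left[OF bounded_bilinear_matrix_matrix_mult]
  bounded_bilinear.add_right[OF bounded_bilinear_matrix_matrix_mult]
  bounded_bilinear.diff_left[OF bounded_bilinear_matrix_matrix_mult]
  bounded_bilinear.diff_right[OF bounded_bilinear_matrix_matrix_mult]
  bounded_bilinear.scaleR_left[OF bounded_bilinear_matrix_matrix_mult]
  bounded_bilinear.scaleR_right[OF bounded_bilinear_matrix_matrix_mult]
  bounded_bilinear.zero_left[OF bounded_bilinear_matrix_matrix_mult]
  bounded_bilinear.zero_right[OF bounded_bilinear_matrix_matrix_mult]
  linear_add[OF bounded_linear.linear[OF bounded_linear_transpose]]
  linear_diff[OF bounded_linear.linear[OF bounded_linear_transpose]]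
  linear_0[OF bounded_linear.linear[OF bounded_linear_transpose]]
  transpose_scalar matrix_transpose_mul matrix_mul_assoc

declare transpose_matrix_vector [simp del]

text \<open>Products are normalized with parentheses to the left. An equation for \<open>A B\<close> then also has to be
  available behind a prefix \<open>X\<close>.\<close>

lemma mm_lift: "A ** B = C \<Longrightarrow> X ** A ** B = X ** C"
  for A :: "real^'m^'n" and B :: "real^'p^'m" and X :: "real^'n^'q"
  by (simp add: matrix_mul_assoc[symmetric])

lemma inner_matrix_vector: "x \<bullet> (A *v y) = (transpose A *v x) \<bullet> y" for A :: "real^'m^'n"
  by (simp add: dot_lmul_matrix transpose_matrix_vector)

lemma stiefelD: "Q \<in> stiefel \<Longrightarrow> transpose Q ** Q = mat 1"
  by (simp add: stiefel_def)

subsection \<open>Matrices with positive quadratic form\<close>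

text \<open>The matrices are not assumed to be symmetric: positivity is an open condition on all square
  matrices, it ignores a skew summand, and the image of the chart of the total space below is
  the set of all \<open>X\<close> for which \<open>Q\<^sup>T X\<close> satisfies it.\<close>

definition posdef :: "(real^'k^'k) set" where
  "posdef = {E. \<forall>x. x \<noteq> 0 \<longrightarrow> 0 < x \<bullet> (E *v x)}"

lemma spd_iff: "D \<in> spd \<longleftrightarrow> transpose D = D \<and> D \<in> posdef"
  by (auto simp: spd_def posdef_def)

lemma posdef_det:
  fixes E :: "real^'k^'k"
  assumes "E \<in> posdef"
  shows "det E \<noteq> 0"
proof -
  have "x = 0" if "E *v x = 0" for x
    using assms that by (force simp: posdef_def)
  then show ?thesis
    by (metis invertible_det_nz invertible_left_inverse matrix_left_invertible_ker)
qed

lemma inner_transpose_matrix: "x \<bullet> (transpose E *v x) = x \<bullet> (E *v x)" for E :: "real^'k^'k"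
  by (metis inner_commute inner_matrix_vector transpose_transpose)

lemma posdef_add_skew:
  fixes D A :: "real^'k^'k"
  assumes "transpose A = - A"
  shows "D + A \<in> posdef \<longleftrightarrow> D \<in> posdef"
proof -
  have "x \<bullet> (A *v x) = 0" for x
  proof -
    have "(- A) *v x = - (A *v x)" by (metis matrix_vector_mult_0 matrix_vector_mult_diff_rdistrib diff_0)
    then have "x \<bullet> (A *v x) = - (x \<bullet> (A *v x))"
      using inner_transpose_matrix[of x A] assms by simp
    then show ?thesis by simp
  qed
  then show ?thesis by (simp add: posdef_def matrix_vector_mult_add_rdistrib inner_add_right)
qed

lemma posdef_sym_part:
  fixes E :: "real^'k^'k"
  shows "(1/2) *\<^sub>R (E + transpose E) \<in> posdef \<longleftrightarrow> E \<in> posdef"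
  by (simp add: posdef_def matrix_vector_mult_add_rdistrib inner_add_right inner_transpose_matrix
      scaleR_matrix_vector_assoc[symmetric])

lemma bounded_bilinear_matrix_vector_mult:
  "bounded_bilinear ((*v) :: real^'m^'n \<Rightarrow> real^'m \<Rightarrow> real^'n)"
  unfolding bilinear_conv_bounded_bilinear[symmetric] bilinear_def
  by (auto intro!: linearI simp: matrix_vector_mult_add_rdistrib scaleR_matrix_vector_assoc
      matrix_vector_right_distrib matrix_vector_mult_scaleR)

text \<open>The non-positive matrices are the projection, along the compact unit sphere, of a closed
  set.\<close>

lemma open_posdef: "open (posdef :: (real^'k^'k) set)"
proof -
  let ?S = "sphere (0::real^'k) 1"
  let ?U = "{z \<in> ?S \<times> (UNIV :: (real^'k^'k) set). fst z \<bullet> (snd z *v fst z) \<le> 0}"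
  have "continuous_on UNIV (\<lambda>z :: (real^'k) \<times> (real^'k^'k). fst z \<bullet> (snd z *v fst z))"
    by (intro continuous_intros bounded_bilinear.continuous_on[OF bounded_bilinear_matrix_vector_mult])
  then have "closed {z :: (real^'k) \<times> (real^'k^'k). fst z \<bullet> (snd z *v fst z) \<le> 0}"
    by (intro closed_Collect_le) (auto intro: continuous_intros)
  then have "closedin (top_of_set (?S \<times> (UNIV :: (real^'k^'k) set))) ?U"
    by (auto simp: closedin_closed)
  then have "closedin (top_of_set UNIV) {E. \<exists>x. x \<in> ?S \<and> (x, E) \<in> ?U}"
    by (intro closedin_compact_projection) auto
  moreover have "{E. \<exists>x. x \<in> ?S \<and> (x, E) \<in> ?U} = - posdef"
  proof (intro set_eqI iffI)
    fix E :: "real^'k^'k" assume "E \<in> {E. \<exists>x. x \<in> ?S \<and> (x, E) \<in> ?U}"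
    then obtain x where "norm x = 1" "x \<bullet> (E *v x) \<le> 0" by auto
    then have "x \<noteq> 0" "\<not> 0 < x \<bullet> (E *v x)" by auto
    then show "E \<in> - posdef" by (auto simp: posdef_def)
  next
    fix E :: "real^'k^'k" assume "E \<in> - posdef"
    then obtain x where x: "x \<noteq> 0" "x \<bullet> (E *v x) \<le> 0" by (auto simp: posdef_def not_less)
    define u where "u = (1 / norm x) *\<^sub>R x"
    have "u \<bullet> (E *v u) = (1 / norm x)^2 * (x \<bullet> (E *v x))"
      by (simp add: u_def matrix_vector_mult_scaleR power2_eq_square)
    then have "u \<bullet> (E *v u) \<le> 0" using x(2) by (simp add: mult_nonneg_nonpos)
    moreover have "norm u = 1" using x(1) by (simp add: u_def)
    ultimately show "E \<in> {E. \<exists>x. x \<in> ?S \<and> (x, E) \<in> ?U}" by auto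
  qed
  ultimately show ?thesis by (simp add: closed_def)
qed

text \<open>Otherwise moving a little from \<open>x\<close> in the direction \<open>- D x\<close> would make the quadratic form
  negative.\<close>

lemma psd_null_vector:
  fixes D :: "real^'k^'k"
  assumes D: "transpose D = D" "\<And>x. 0 \<le> x \<bullet> (D *v x)" and x: "x \<bullet> (D *v x) = 0"
  shows "D *v x = 0"
proof (rule ccontr)
  define y where "y = D *v x"
  define a where "a = y \<bullet> y"
  define c where "c = y \<bullet> (D *v y)"
  assume "D *v x \<noteq> 0"
  then have a: "a > 0" by (simp add: a_def y_def)
  have c: "c \<ge> 0" unfolding c_def by (rule D(2))
  \<comment> \<open>small enough for the linear term to win; the summand 1 covers \<open>c = 0\<close>\<close>
  define t where "t = a / (c + 1)"
  have xy: "x \<bullet> (D *v y) = a"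
    unfolding inner_matrix_vector[of x D y] D(1) by (simp add: a_def y_def)
  have "(x - t *\<^sub>R y) \<bullet> (D *v (x - t *\<^sub>R y)) = t * (t * c - 2 * a)"
    using x xy by (simp add: matrix_vector_mult_diff_distrib matrix_vector_mult_scaleR
        inner_diff_left inner_diff_right y_def[symmetric] a_def[symmetric] c_def[symmetric] algebra_simps)
  moreover have "t > 0" using a c by (simp add: t_def)
  moreover have "t * c \<le> a"
    using a c by (simp add: t_def field_simps)
  ultimately have "(x - t *\<^sub>R y) \<bullet> (D *v (x - t *\<^sub>R y)) < 0"
    using a by (simp add: mult_pos_neg)
  then show False using D(2)[of "x - t *\<^sub>R y"] by simp
qed

subsection \<open>Positive semidefinite matrices of given rank\<close>

lemma inner_congruence:
  fixes B :: "real^'k^'n"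
  shows "x \<bullet> ((B ** E ** transpose B) *v x) = (transpose B *v x) \<bullet> (E *v (transpose B *v x))"
proof -
  have "x \<bullet> ((B ** E ** transpose B) *v x) = x \<bullet> (B *v (E *v (transpose B *v x)))"
    by (simp add: matrix_vector_mul_assoc matrix_mul_assoc)
  then show ?thesis by (simp only: inner_matrix_vector[of x B])
qed

lemma congruence_range:
  fixes B :: "real^'k^'n"
  assumes L: "L ** B = mat 1" and E: "E \<in> spd"
  shows "range ((*v) (B ** E ** transpose B)) = range ((*v) B)"
proof -
  have "det E \<noteq> 0" using E by (simp add: spd_iff posdef_det)
  from matrix_inv_works(1)[OF this] have "surj ((*v) E)"
    using matrix_right_invertible_surjective by blast
  moreover have "transpose B ** transpose L = mat 1"
    using L by (metis matrix_transpose_mul transpose_mat)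
  then have "surj ((*v) (transpose B))" using matrix_right_invertible_surjective by blast
  moreover have "(*v) (B ** E ** transpose B) = (*v) B \<circ> ((*v) E \<circ> (*v) (transpose B))"
    by (auto simp: matrix_vector_mul_assoc matrix_mul_assoc)
  ultimately show ?thesis by (simp only: image_comp[symmetric])
qed

lemma congruence_psd_rank:
  fixes B :: "real^'k^'n"
  assumes L: "L ** B = mat 1" and E: "E \<in> spd"
  shows "B ** E ** transpose B \<in> psd_rank CARD('k)"
proof -
  have "transpose (B ** E ** transpose B) = B ** E ** transpose B"
    using E by (simp add: mm_rules spd_iff)
  moreover have "0 \<le> x \<bullet> ((B ** E ** transpose B) *v x)" for x
  proof (cases "transpose B *v x = 0")
    case False
    then show ?thesis unfolding inner_congruence using E by (auto simp: spd_def less_imp_le)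
  qed (simp only: inner_congruence, simp)
  moreover have "inj ((*v) B)" using L matrix_left_invertible_injective by blast
  then have "rank B = CARD('k)" by (simp add: full_rank_injective)
  then have "rank (B ** E ** transpose B) = CARD('k)"
    using congruence_range[OF L E] by (simp only: rank_dim_range)
  ultimately show ?thesis by (simp add: psd_rank_def)
qed

text \<open>\<open>D = Q\<^sup>T (Q D Q\<^sup>T) Q\<close> is positive semidefinite, and the rank condition leaves it no kernel.\<close>

lemma stiefel_congruence_spd:
  fixes Q :: "real^'k^'n" and D :: "real^'k^'k"
  assumes Q: "Q \<in> stiefel" and S: "Q ** D ** transpose Q \<in> psd_rank CARD('k)"
  shows "D \<in> spd"
proof -
  let ?S = "Q ** D ** transpose Q"
  note q = stiefelD[OF Q]
  have "transpose Q ** ?S ** Q = D" by (simp add: mm_rules q mm_lift[OF q])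
  then have D: "D = transpose Q ** ?S ** Q" by (rule sym)
  have "transpose ?S = ?S" using S by (simp add: psd_rank_def)
  then have sym: "transpose D = D" by (subst (1 2) D) (simp add: mm_rules)
  have pos: "0 \<le> x \<bullet> (D *v x)" for x
  proof -
    have "x \<bullet> (D *v x) = (Q *v x) \<bullet> (?S *v (Q *v x))"
      by (subst D) (use inner_congruence[of x "transpose Q" ?S] in simp)
    then show ?thesis using S by (simp add: psd_rank_def)
  qed
  have "CARD('k) \<le> rank D"
    using rank_mul_le_left[of "Q ** D" "transpose Q"] rank_mul_le_right[of Q D] S
    by (simp add: psd_rank_def)
  then have "rank D = CARD('k)" using rank_bound[of D] by simp
  then have "inj ((*v) D)" by (simp add: full_rank_injective)
  then have inj: "x = 0" if "D *v x = 0" for x using that by (metis injD matrix_vector_mult_0_right)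
  have "0 < x \<bullet> (D *v x)" if "x \<noteq> 0" for x
    using pos[of x] psd_null_vector[OF sym pos, of x] inj[of x] that by force
  then show ?thesis using sym by (simp add: spd_def)
qed

text \<open>The columns of \<open>Q\<close> form an orthonormal basis of \<open>V\<close>.\<close>

lemma stiefel_with_range:
  fixes V :: "(real^'n) set"
  assumes "subspace V" "dim V = CARD('k)"
  obtains Q :: "real^'k^'n" where "Q \<in> stiefel" "range ((*v) Q) = V"
proof -
  have "dim (UNIV :: (real^'k) set) = dim V" using assms(2) by (simp add: dim_UNIV)
  then obtain f :: "real^'k \<Rightarrow> real^'n" where f: "linear f" "f ` UNIV = V" "\<And>x. norm (f x) = norm x"
    using isometry_subspaces[OF subspace_UNIV assms(1)] by (metis UNIV_I)
  define Q where "Q = matrix f"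
  have Q: "Q *v x = f x" for x unfolding Q_def using f(1) by (simp add: matrix_works)
  have inner: "f x \<bullet> f y = x \<bullet> y" for x y
    unfolding dot_norm[of "f x"] dot_norm[of x] using f(3) linear_add[OF f(1)] by metis
  have "x \<bullet> ((transpose Q ** Q) *v y) = x \<bullet> (mat 1 *v y)" for x y
    using inner inner_matrix_vector[of x "transpose Q" "Q *v y"]
    by (simp add: matrix_vector_mul_assoc[symmetric] Q)
  then have "(transpose Q ** Q) *v y = mat 1 *v y" for y
    by (intro vector_eq_ldot[THEN iffD1]) blast
  then have "transpose Q ** Q = mat 1" unfolding matrix_eq by blast
  moreover have "range ((*v) Q) = V" using f(2) Q by simp
  ultimately show ?thesis using that by (simp add: stiefel_def)
qed

text \<open>\<open>Q Q\<^sup>T\<close> is the orthogonal projection onto the range of \<open>Q\<close>, so it fixes \<open>S\<close> from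
  both sides.\<close>

lemma psd_rank_stiefel_decomposition:
  fixes Q :: "real^'k^'n"
  assumes Q: "Q \<in> stiefel" and S: "S \<in> psd_rank CARD('k)" and range: "range ((*v) S) \<subseteq> range ((*v) Q)"
  shows "S = Q ** (transpose Q ** S ** Q) ** transpose Q" "transpose Q ** S ** Q \<in> spd"
proof -
  note q = stiefelD[OF Q]
  have sym: "transpose S = S" using S by (simp add: psd_rank_def)
  have "(Q ** transpose Q ** S) *v x = S *v x" for x
  proof -
    obtain y where y: "S *v x = Q *v y" using range by blast
    have "(Q ** transpose Q ** S) *v x = (Q ** transpose Q) *v (S *v x)"
      by (simp add: matrix_vector_mul_assoc)
    also have "\<dots> = (Q ** transpose Q ** Q) *v y" unfolding y by (simp add: matrix_vector_mul_assoc)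
    also have "\<dots> = S *v x" using mm_lift[OF q, of Q] y by simp
    finally show ?thesis .
  qed
  then have 1: "Q ** transpose Q ** S = S" by (simp add: matrix_eq)
  have "transpose (Q ** transpose Q ** S) = transpose S" by (simp only: 1)
  then have 2: "S ** Q ** transpose Q = S" by (simp add: mm_rules sym)
  show 3: "S = Q ** (transpose Q ** S ** Q) ** transpose Q" by (simp add: mm_rules 1 2)
  show "transpose Q ** S ** Q \<in> spd"
    using S by (intro stiefel_congruence_spd[OF Q]) (simp only: 3[symmetric])
qed

lemma psd_rank_decompose:
  fixes S :: "real^'n^'n"
  assumes "S \<in> psd_rank CARD('k)"
  obtains Q :: "real^'k^'n" and D where "Q \<in> stiefel" "D \<in> spd" "S = Q ** D ** transpose Q"
proof -
  have "subspace (range ((*v) S))" by (intro linear_subspace_image) auto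
  moreover have "dim (range ((*v) S)) = CARD('k)"
    using assms by (simp add: psd_rank_def rank_dim_range)
  ultimately obtain Q :: "real^'k^'n" where Q: "Q \<in> stiefel" "range ((*v) Q) = range ((*v) S)"
    using stiefel_with_range by metis
  from psd_rank_stiefel_decomposition[OF Q(1) assms] Q that show ?thesis by simp
qed

section \<open>Dimensions\<close>

text \<open>A symmetric matrix is determined by its entries on and above the diagonal. The index type has no
  order of its own, so one is borrowed from the naturals by an injection \<open>f\<close>.\<close>

lemma dim_symmetric:
  "dim {A :: real^'k^'k. transpose A = A} = CARD('k) * (CARD('k) + 1) div 2"
proof -
  let ?S = "{A :: real^'k^'k. transpose A = A}"
  obtain f :: "'k \<Rightarrow> nat" where f: "inj f"
    using finite_imp_inj_to_nat_seg[OF finite, of UNIV] by blast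
  let ?e = "\<lambda>(i, j). axis i (axis j 1) :: real^'k^'k"
  let ?P = "{(i, j). f i \<le> f j}"
  define d where "d = ?e ` ?P"
  have comp: "A \<bullet> ?e (i, j) = A $ i $ j" for A :: "real^'k^'k" and i j
    by (simp add: inner_axis)
  have dB: "d \<subseteq> Basis" by (auto simp: d_def intro!: axis_in_Basis_iff[THEN iffD2])
  have inj_e: "inj_on ?e X" for X
    by (auto simp: inj_on_def axis_eq_axis)
  define U where "U = {A :: real^'k^'k. \<forall>i j. \<not> f i \<le> f j \<longrightarrow> A $ i $ j = 0}"
  have "U = {A. \<forall>b\<in>Basis. b \<notin> d \<longrightarrow> A \<bullet> b = 0}"
  proof (intro set_eqI iffI)
    fix A assume "A \<in> U"
    then show "A \<in> {A. \<forall>b\<in>Basis. b \<notin> d \<longrightarrow> A \<bullet> b = 0}"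
      by (auto simp: U_def d_def Basis_vec_def inner_axis image_iff)
  next
    fix A assume A: "A \<in> {A. \<forall>b\<in>Basis. b \<notin> d \<longrightarrow> A \<bullet> b = 0}"
    have "A $ i $ j = 0" if "\<not> f i \<le> f j" for i j
    proof -
      have "?e (i, j) \<notin> d"
        using that inj_onD[OF inj_e[of UNIV], of "(i, j)"] by (auto simp: d_def)
      moreover have "?e (i, j) \<in> Basis" by (simp add: axis_in_Basis_iff)
      ultimately show ?thesis using A comp[of A i j] by auto
    qed
    then show "A \<in> U" by (auto simp: U_def)
  qed
  then have dimU: "dim U = card ?P"
    using dim_substandard[OF dB] card_image[OF inj_e[of ?P]] by (simp add: d_def)
  let ?L = "\<lambda>A :: real^'k^'k. \<chi> i j. if f i \<le> f j then A $ i $ j else 0"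
  have lin: "linear ?L" by (rule linearI) (auto simp: vec_eq_iff)
  have subS: "subspace ?S"
    by (simp add: subspace_def mm_rules)
  have "inj_on ?L ?S"
  proof (rule inj_onI)
    fix A B assume A: "A \<in> ?S" and B: "B \<in> ?S" and eq: "?L A = ?L B"
    have sym: "A $ i $ j = A $ j $ i" "B $ i $ j = B $ j $ i" for i j
      using A B by (simp_all add: transpose_def vec_eq_iff)
    have le: "A $ i $ j = B $ i $ j" if "f i \<le> f j" for i j
      using arg_cong[OF eq, of "\<lambda>M. M $ i $ j"] that by simp
    have "A $ i $ j = B $ i $ j" for i j
      using le[of i j] le[of j i] sym by (cases "f i \<le> f j") auto
    then show "A = B" by (simp add: vec_eq_iff)
  qed
  then have "dim (?L ` ?S) = dim ?S"
    using dim_image_eq[OF lin, of ?S] subS by (simp add: span_eq_iff[THEN iffD2])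
  moreover have "?L ` ?S = U"
  proof
    show "?L ` ?S \<subseteq> U" by (auto simp: U_def)
    show "U \<subseteq> ?L ` ?S"
    proof
      fix A assume A: "A \<in> U"
      let ?B = "\<chi> i j. if f i \<le> f j then A $ i $ j else A $ j $ i"
      have "?B \<in> ?S"
        using f by (auto simp: transpose_def vec_eq_iff inj_eq dest: antisym)
      moreover have "A = ?L ?B" using A by (auto simp: U_def vec_eq_iff)
      ultimately show "A \<in> ?L ` ?S" by (rule rev_image_eqI)
    qed
  qed
  ultimately have "dim ?S = card ?P" using dimU by simp
  moreover have "card ?P = CARD('k) * (CARD('k) + 1) div 2"
  proof -
    let ?l = "{(i, j). f i < f j}" and ?g = "{(i, j). f j < f i}" and ?d = "{(i, j). i = (j :: 'k)}"
    have "?g = prod.swap ` ?l" by auto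
    then have g: "card ?g = card ?l" by (simp add: card_image)
    have "?d = (\<lambda>i. (i, i)) ` UNIV" by auto
    then have dd: "card ?d = CARD('k)" by (simp add: card_image inj_on_def)
    have P: "?P = ?l \<union> ?d" using f by (auto simp: inj_eq le_less)
    have "f i < f j \<or> i = j \<or> f j < f i" for i j
      using injD[OF f] linorder_less_linear by metis
    then have U: "UNIV = (?l \<union> ?d) \<union> ?g" by auto
    have 1: "card ?P = card ?l + CARD('k)"
      unfolding P dd[symmetric] by (rule card_Un_disjoint) auto
    have "card (UNIV :: ('k \<times> 'k) set) = card (?l \<union> ?d) + card ?g"
      unfolding U by (rule card_Un_disjoint) auto
    then have "CARD('k) * CARD('k) = card ?P + card ?l"
      using P g by (simp add: card_prod)
    with 1 have "CARD('k) * (CARD('k) + 1) = 2 * card ?P" by simp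
    then show ?thesis by simp
  qed
  ultimately show ?thesis by simp
qed

text \<open>The model space of the positive semidefinite matrices near the range of \<open>Q\<close>: a matrix
  \<open>X = Q E + Y\<close> records a symmetric \<open>E\<close> and a \<open>Y\<close> with columns orthogonal to that range.\<close>

definition psd_model :: "real^'k^'n \<Rightarrow> (real^'k^'n) set" where
  "psd_model Q = {X. transpose (transpose Q ** X) = transpose Q ** X}"

lemma subspace_psd_model: "subspace (psd_model Q)"
  by (simp add: subspace_def psd_model_def mm_rules)

text \<open>All \<open>n \<times> k\<close> matrices are the direct sum of the \<open>Q E\<close> and of the \<open>Y\<close> with \<open>Q\<^sup>T Y = 0\<close>. Counting
  dimensions once for arbitrary \<open>E\<close> gives the dimension of the second summand; the model
  space is the same sum for symmetric \<open>E\<close>.\<close>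

lemma dim_psd_model:
  fixes Q :: "real^'k^'n"
  assumes Q: "Q \<in> stiefel"
  shows "dim (psd_model Q) = CARD(('n, 'k) psd_dim)"
proof -
  note q = stiefelD[OF Q]
  let ?m = "\<lambda>A :: real^'k^'k. Q ** A"
  let ?K = "{Y :: real^'k^'n. transpose Q ** Y = 0}"
  have lin: "linear ?m" by (rule linearI) (simp_all add: mm_rules)
  have inj: "inj_on ?m X" for X
    by (rule inj_on_inverseI[of _ "\<lambda>B. transpose Q ** B"]) (simp add: mm_rules q)
  have K: "subspace ?K" by (auto simp: subspace_def mm_rules)
  have split: "dim {x + y |x y. x \<in> ?m ` S \<and> y \<in> ?K} = dim S + dim ?K"
    if S: "subspace S" for S
  proof -
    have "subspace (?m ` S)" using lin S by (rule linear_subspace_image)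
    moreover have "?m ` S \<inter> ?K = {0}"
      using subspace_0[OF S] by (auto simp: mm_rules q intro: rev_image_eqI)
    moreover have "dim (?m ` S) = dim S" by (rule dim_image_eq[OF lin inj])
    ultimately show ?thesis using dim_sums_Int[of "?m ` S" ?K] K by simp
  qed
  have dec: "X = ?m (transpose Q ** X) + (X - ?m (transpose Q ** X))"
    "X - ?m (transpose Q ** X) \<in> ?K" for X :: "real^'k^'n"
    by (simp_all add: mm_rules q)
  have "X \<in> {x + y |x y. x \<in> ?m ` UNIV \<and> y \<in> ?K}" for X
    by (rule CollectI, intro exI[of _ "?m (transpose Q ** X)"] exI[of _ "X - ?m (transpose Q ** X)"])
       (use dec(2) in simp)
  then have "{x + y |x y. x \<in> ?m ` UNIV \<and> y \<in> ?K} = UNIV" by blast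
  then have 1: "CARD('n) * CARD('k) = CARD('k) * CARD('k) + dim ?K"
    using split[OF subspace_UNIV] by (simp add: dim_UNIV)
  have eq: "{x + y |x y. x \<in> ?m ` {A. transpose A = A} \<and> y \<in> ?K} = psd_model Q"
  proof
    show "{x + y |x y. x \<in> ?m ` {A. transpose A = A} \<and> y \<in> ?K} \<subseteq> psd_model Q"
      by (auto simp: psd_model_def mm_rules(1-8) matrix_mul_assoc q)
    show "psd_model Q \<subseteq> {x + y |x y. x \<in> ?m ` {A. transpose A = A} \<and> y \<in> ?K}"
    proof
      fix X assume "X \<in> psd_model Q"
      then show "X \<in> {x + y |x y. x \<in> ?m ` {A. transpose A = A} \<and> y \<in> ?K}"
        by (intro CollectI exI[of _ "?m (transpose Q ** X)"] exI[of _ "X - ?m (transpose Q ** X)"])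
           (use dec(2) in \<open>simp add: psd_model_def\<close>)
    qed
  qed
  have sub: "subspace {A :: real^'k^'k. transpose A = A}"
    by (simp add: subspace_def mm_rules)
  have 2: "dim (psd_model Q) = CARD('k) * (CARD('k) + 1) div 2 + dim ?K"
    using split[OF sub] unfolding eq dim_symmetric .
  have "dim ?K = CARD('k) * (CARD('n) - CARD('k))"
    using 1 by (simp add: diff_mult_distrib2 mult.commute)
  then show ?thesis using 2 by (simp add: card_psd_dim)
qed

section \<open>Charts of the positive semidefinite matrices\<close>

text \<open>If \<open>S = B E B\<^sup>T\<close> with \<open>Q\<^sup>T B = 1\<close>, then \<open>E = Q\<^sup>T S Q\<close> and \<open>B = S Q E\<^sup>-\<^sup>1\<close>. The coordinate of \<open>S\<close>
  packs \<open>E\<close> and the remaining part \<open>Y = B - Q\<close> of \<open>B\<close>, which satisfies \<open>Q\<^sup>T Y = 0\<close>, into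
  \<open>Q E + Y\<close>.\<close>

definition psd_coord :: "real^'k^'n \<Rightarrow> real^'n^'n \<Rightarrow> real^'k^'n" where
  "psd_coord Q S = (let E = transpose Q ** S ** Q in S ** Q ** matrix_inv E - Q + Q ** E)"

definition psd_param :: "real^'k^'n \<Rightarrow> real^'k^'n \<Rightarrow> real^'n^'n" where
  "psd_param Q X = (let E = transpose Q ** X; B = X - Q ** E + Q in B ** E ** transpose B)"

lemma smooth_psd_coord:
  "smooth_on_subset {S. transpose Q ** S ** Q \<in> posdef} (psd_coord Q)"
  unfolding psd_coord_def[abs_def] Let_def
  by (intro smooth_rules) (auto simp: posdef_det)

lemma smooth_psd_param: "smooth_on_subset U (psd_param Q)"
  unfolding psd_param_def[abs_def] Let_def by (intro smooth_rules)

lemma psd_param_in: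
  fixes Q X :: "real^'k^'n"
  assumes Q: "Q \<in> stiefel" and X: "X \<in> psd_model Q" "transpose Q ** X \<in> posdef"
  shows "psd_param Q X \<in> psd_rank CARD('k)" "transpose Q ** psd_param Q X ** Q = transpose Q ** X"
    "psd_coord Q (psd_param Q X) = X"
proof -
  note q = stiefelD[OF Q]
  define E where "E = transpose Q ** X"
  define B where "B = X - Q ** E + Q"
  have E: "E \<in> spd" using X by (simp add: spd_iff psd_model_def E_def)
  have QB: "transpose Q ** B = mat 1" by (simp add: B_def mm_rules q E_def)
  have S: "psd_param Q X = B ** E ** transpose B" by (simp add: psd_param_def Let_def E_def B_def)
  show "psd_param Q X \<in> psd_rank CARD('k)" unfolding S by (rule congruence_psd_rank[OF QB E])
  have BQ: "transpose B ** Q = mat 1"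
    using QB by (metis matrix_transpose_mul transpose_mat transpose_transpose)
  have 1: "transpose Q ** (B ** E ** transpose B) ** Q = E"
    by (simp add: mm_rules QB BQ mm_lift[OF BQ])
  then show "transpose Q ** psd_param Q X ** Q = transpose Q ** X" by (simp add: S E_def)
  have inv: "E ** matrix_inv E = mat 1"
    using E by (simp add: spd_iff posdef_det matrix_inv_works)
  have "B ** E ** transpose B ** Q ** matrix_inv E = B"
    by (simp add: mm_rules mm_lift[OF BQ] mm_lift[OF inv])
  then show "psd_coord Q (psd_param Q X) = X"
    unfolding psd_coord_def Let_def S 1 by (simp add: B_def)
qed

lemma psd_coord_in:
  fixes Q :: "real^'k^'n"
  assumes Q: "Q \<in> stiefel" and S: "S \<in> psd_rank CARD('k)" "transpose Q ** S ** Q \<in> posdef"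
  shows "transpose Q ** psd_coord Q S = transpose Q ** S ** Q" "psd_coord Q S \<in> psd_model Q"
    "psd_param Q (psd_coord Q S) = S"
proof -
  note q = stiefelD[OF Q]
  define E where "E = transpose Q ** S ** Q"
  have symS: "transpose S = S" using S by (simp add: psd_rank_def)
  have E: "E \<in> spd" using S by (simp add: spd_iff E_def mm_rules symS)
  then have symE: "transpose E = E" and inv: "E ** matrix_inv E = mat 1" "matrix_inv E ** E = mat 1"
    by (simp_all add: spd_iff posdef_det matrix_inv_works)
  define F where "F = matrix_inv E"
  have symF: "transpose F = F"
    by (metis F_def inv(1) matrix_inv_unique_left(1) matrix_transpose_mul symE transpose_mat)
  have c: "psd_coord Q S = S ** Q ** F - Q + Q ** E"
    by (simp add: psd_coord_def Let_def E_def F_def)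
  show 1: "transpose Q ** psd_coord Q S = transpose Q ** S ** Q"
    unfolding c using inv(1) by (simp add: mm_rules q E_def[symmetric] F_def)
  show "psd_coord Q S \<in> psd_model Q"
    using symE 1 by (simp add: psd_model_def E_def)
  obtain Q' :: "real^'k^'n" and D where D: "Q' \<in> stiefel" "D \<in> spd" "S = Q' ** D ** transpose Q'"
    using psd_rank_decompose[OF S(1)] .
  \<comment> \<open>\<open>E = G D G\<^sup>T\<close> with an invertible \<open>G\<close>, which cancels in \<open>S Q E\<^sup>-\<^sup>1 Q\<^sup>T S\<close>\<close>
  define G where "G = transpose Q ** Q'"
  have GT: "transpose G = transpose Q' ** Q" by (simp add: G_def mm_rules)
  have EG: "E = G ** D ** transpose G" by (simp add: E_def D(3) mm_rules G_def)
  have "(F ** G ** D) ** transpose G = mat 1"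
    using inv(2) by (simp add: EG F_def mm_rules)
  then have GF: "transpose G ** (F ** G ** D) = mat 1" by (simp add: matrix_left_right_inverse)
  have SB: "S ** Q ** F ** transpose Q ** S = S"
  proof -
    have "S ** Q ** F ** transpose Q ** S = Q' ** D ** (transpose G ** (F ** G ** D)) ** transpose Q'"
      by (simp add: D(3) GT G_def mm_rules)
    then show ?thesis by (simp only: GF) (simp add: D(3))
  qed
  have "psd_param Q (psd_coord Q S) = (S ** Q ** F) ** E ** transpose (S ** Q ** F)"
    unfolding psd_param_def Let_def 1 unfolding c E_def[symmetric] by simp
  also have "\<dots> = S ** Q ** F ** transpose Q ** S"
    using inv(2) by (simp add: mm_rules symS symF F_def[symmetric] mm_lift[OF inv(2)[folded F_def]])
  finally show "psd_param Q (psd_coord Q S) = S" using SB by simp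
qed

lemma open_vimage_posdef: "open {S :: real^'n^'m. L ** S ** R \<in> posdef}"
  for L :: "real^'m^'k" and R :: "real^'k^'n"
proof -
  have "smooth_on_subset UNIV (\<lambda>S. L ** S ** R)" by (intro smooth_rules)
  from open_vimage[OF open_posdef smooth_on_subset_continuous[OF this]] show ?thesis
    by (simp add: vimage_def)
qed

lemma smooth_manifold_psd:
  "smooth_manifold (psd_mfd TYPE('k) :: (real^'n^'n, real^('n::finite, 'k::finite) psd_dim) mfd)"
  unfolding psd_mfd_def
proof (rule smooth_manifold_submanifold)
  fix S :: "real^'n^'n" assume S: "S \<in> psd_rank CARD('k)"
  then obtain Q :: "real^'k^'n" and D where D: "Q \<in> stiefel" "D \<in> spd" "S = Q ** D ** transpose Q"
    using psd_rank_decompose by blast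
  note q = stiefelD[OF D(1)]
  let ?N = "{S. transpose Q ** S ** Q \<in> posdef}" and ?O = "{X. transpose Q ** X \<in> posdef}"
  let ?U = "psd_rank CARD('k) \<inter> ?N"
  have "open ?O" using open_vimage_posdef[of "transpose Q" "mat 1"] by simp
  moreover have "dim (psd_model Q) = DIM(real^('n, 'k) psd_dim)"
    using dim_psd_model[OF D(1)] by simp
  moreover have "openin (top_of_set (psd_rank CARD('k))) ?U"
    by (rule openin_open_Int) (rule open_vimage_posdef)
  moreover have "smooth_on_subset ?U (psd_coord Q)"
    using smooth_psd_coord by (rule smooth_on_subset_mono) simp
  ultimately have "\<exists>g. (?U, g) \<in> snd (submanifold (psd_rank CARD('k)) :: (_, real^('n, 'k) psd_dim) mfd)"
    using psd_coord_in[OF D(1)] psd_param_in[OF D(1)]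
    by (intro submanifold_chart_of_parametrization[OF _ subspace_psd_model[of Q], where N = ?O
          and f = "psd_coord Q" and b = "psd_param Q"] smooth_psd_param) auto
  moreover have "transpose Q ** S ** Q = D" by (simp add: D(3) mm_rules q mm_lift[OF q])
  then have "S \<in> ?U" using S D(2) by (simp add: spd_iff)
  ultimately show "\<exists>U f. (U, f) \<in> snd (submanifold (psd_rank CARD('k)) :: (_, real^('n, 'k) psd_dim) mfd) \<and> S \<in> U"
    by blast
qed

section \<open>Charts of the total space\<close>

text \<open>Write \<open>Q = Q\<^sub>0 U + W\<close> with \<open>Q\<^sub>0\<^sup>T W = 0\<close>. The parametrization is
  \<open>U = (1 - Z) (1 + Z)\<^sup>-\<^sup>1\<close> and \<open>W = 2 Y (1 + Z)\<^sup>-\<^sup>1\<close>, a Cayley transform; the condition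
  \<open>U\<^sup>T U + W\<^sup>T W = 1\<close> becomes \<open>Z + Z\<^sup>T = 2 Y\<^sup>T Y\<close>, that is, \<open>Z - Y\<^sup>T Y\<close> is skew.
  Together with the symmetric \<open>D\<close> this skew matrix fills the square matrix \<open>Q\<^sub>0\<^sup>T X\<close> of the
  coordinate \<open>X\<close>, and \<open>Y\<close> is the part of \<open>X\<close> orthogonal to \<open>Q\<^sub>0\<close>.\<close>

definition total_coord :: "real^'k^'n \<Rightarrow> (real^'k^'n) \<times> (real^'k^'k) \<Rightarrow> real^'k^'n" where
  "total_coord Q0 = (\<lambda>(Q, D).
     let U = transpose Q0 ** Q; M = matrix_inv (mat 1 + U); Y = (Q - Q0 ** U) ** M;
         Z = (mat 1 - U) ** M
     in Q0 ** (D + Z - transpose Y ** Y) + Y)"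

definition total_param :: "real^'k^'n \<Rightarrow> real^'k^'n \<Rightarrow> (real^'k^'n) \<times> (real^'k^'k)" where
  "total_param Q0 X =
     (let E = transpose Q0 ** X; Y = X - Q0 ** E;
          Z = transpose Y ** Y + (1/2) *\<^sub>R (E - transpose E); N = matrix_inv (mat 1 + Z)
      in (Q0 ** (mat 1 - Z) ** N + 2 *\<^sub>R (Y ** N), (1/2) *\<^sub>R (E + transpose E)))"

text \<open>Makes \<open>1 + Z\<close> invertible for every choice of the parameters, so that the parametrization is
  smooth everywhere.\<close>

lemma posdef_one_plus_gram_plus_skew:
  fixes Y :: "real^'k^'n" and A :: "real^'k^'k"
  assumes "transpose A = - A"
  shows "mat 1 + (transpose Y ** Y + A) \<in> posdef"
proof -
  have "0 < x \<bullet> ((mat 1 + transpose Y ** Y) *v x)" if "x \<noteq> 0" for x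
  proof -
    have "x \<bullet> ((transpose Y ** Y) *v x) = (Y *v x) \<bullet> (Y *v x)"
      using inner_matrix_vector[of x "transpose Y" "Y *v x"] by (simp add: matrix_vector_mul_assoc)
    then have "x \<bullet> ((mat 1 + transpose Y ** Y) *v x) = x \<bullet> x + (Y *v x) \<bullet> (Y *v x)"
      by (simp add: matrix_vector_mult_add_rdistrib inner_add_right)
    moreover have "0 < x \<bullet> x" "0 \<le> (Y *v x) \<bullet> (Y *v x)" using that by simp_all
    ultimately show ?thesis by linarith
  qed
  then have "mat 1 + transpose Y ** Y \<in> posdef" by (simp add: posdef_def)
  then show ?thesis using posdef_add_skew[OF assms, of "mat 1 + transpose Y ** Y"] by (simp add: add.assoc)
qed

lemma skew_part_skew: "transpose ((1/2) *\<^sub>R (E - transpose E)) = - ((1/2) *\<^sub>R (E - transpose E))"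
  for E :: "real^'k^'k"
  by (simp add: mm_rules scaleR_diff_right)

lemma smooth_total_param: "smooth_on_subset S (total_param Q0)"
  unfolding total_param_def[abs_def] Let_def
  by (intro smooth_rules posdef_det posdef_one_plus_gram_plus_skew skew_part_skew)

lemma smooth_total_coord:
  "smooth_on_subset {p. det (mat 1 + transpose Q0 ** fst p) \<noteq> 0} (total_coord Q0)"
  unfolding total_coord_def case_prod_unfold Let_def
  by (intro smooth_rules) auto

text \<open>With \<open>N = (1 + Z)\<^sup>-\<^sup>1\<close> the relation \<open>1 + U = 2 N\<close> inverts the Cayley transform, and
  \<open>Q\<^sup>T Q = 1\<close> reduces to \<open>(1 - Z)\<^sup>T (1 - Z) + 4 Y\<^sup>T Y = (1 + Z)\<^sup>T (1 + Z)\<close>.\<close>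

lemma total_param_in:
  fixes Q0 X :: "real^'k^'n"
  assumes Q0: "Q0 \<in> stiefel" and X: "transpose Q0 ** X \<in> posdef"
  shows "total_param Q0 X \<in> total_space"
    "det (mat 1 + transpose Q0 ** fst (total_param Q0 X)) \<noteq> 0"
    "total_coord Q0 (total_param Q0 X) = X"
proof -
  note q = stiefelD[OF Q0]
  define E where "E = transpose Q0 ** X"
  define Y where "Y = X - Q0 ** E"
  define A where "A = (1/2) *\<^sub>R (E - transpose E)"
  define Z where "Z = transpose Y ** Y + A"
  define N where "N = matrix_inv (mat 1 + Z)"
  define C where "C = Q0 ** (mat 1 - Z) + 2 *\<^sub>R Y"
  define Q where "Q = C ** N"
  define D where "D = (1/2) *\<^sub>R (E + transpose E)"
  have "Q = Q0 ** (mat 1 - Z) ** N + 2 *\<^sub>R (Y ** N)"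
    by (simp only: Q_def C_def mm_rules(1,5))
  then have tp: "total_param Q0 X = (Q, D)"
    by (simp only: total_param_def Let_def E_def[symmetric] Y_def[symmetric] A_def[symmetric]
        Z_def[symmetric] N_def[symmetric] D_def[symmetric])
  have QY: "transpose Q0 ** Y = 0" by (simp add: Y_def mm_rules q E_def)
  then have YQ: "transpose Y ** Q0 = 0"
    by (metis matrix_transpose_mul transpose_transpose mm_rules(11))
  have skew: "transpose A = - A" unfolding A_def by (rule skew_part_skew)
  have detZ: "det (mat 1 + Z) \<noteq> 0"
    unfolding Z_def by (intro posdef_det posdef_one_plus_gram_plus_skew skew)
  note N = matrix_inv_works[OF detZ, folded N_def]
  have gram: "Z + transpose Z = 2 *\<^sub>R (transpose Y ** Y)"
    by (simp add: Z_def mm_rules skew scaleR_2)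
  have "transpose C ** C = transpose (mat 1 - Z) ** (mat 1 - Z) + 4 *\<^sub>R (transpose Y ** Y)"
    by (simp add: C_def mm_rules q QY YQ mm_lift[OF q] mm_lift[OF QY] mm_lift[OF YQ])
  also have "4 *\<^sub>R (transpose Y ** Y) = 2 *\<^sub>R (Z + transpose Z)" by (simp add: gram)
  also have "transpose (mat 1 - Z) ** (mat 1 - Z) + 2 *\<^sub>R (Z + transpose Z) =
      transpose (mat 1 + Z) ** (mat 1 + Z)"
    by (simp add: mm_rules scaleR_2 algebra_simps)
  finally have CC: "transpose C ** C = transpose (mat 1 + Z) ** (mat 1 + Z)" .
  have "transpose Q ** Q = transpose N ** (transpose C ** C) ** N"
    by (simp add: Q_def mm_rules(11-14))
  also have "\<dots> = transpose ((mat 1 + Z) ** N) ** ((mat 1 + Z) ** N)"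
    by (simp only: CC matrix_transpose_mul matrix_mul_assoc)
  finally have "transpose Q ** Q = mat 1" by (simp add: N)
  then have Q: "Q \<in> stiefel" by (simp add: stiefel_def)
  have "D \<in> posdef" unfolding D_def by (simp only: posdef_sym_part E_def X)
  then have "D \<in> spd" by (simp add: spd_iff D_def mm_rules add.commute)
  then show "total_param Q0 X \<in> total_space" using Q by (simp add: tp)
  define U where "U = transpose Q0 ** Q"
  have U: "U = (mat 1 - Z) ** N" by (simp add: U_def Q_def C_def mm_rules q QY)
  have 1: "mat 1 + U = 2 *\<^sub>R N"
  proof -
    have "mat 1 + U = (mat 1 + Z) ** N + (mat 1 - Z) ** N" by (simp only: N U)
    then show ?thesis by (simp add: mm_rules scaleR_2)
  qed
  have 2: "mat 1 - U = 2 *\<^sub>R (Z ** N)"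
  proof -
    have "mat 1 - U = (mat 1 + Z) ** N - (mat 1 - Z) ** N" by (simp only: N U)
    then show ?thesis by (simp add: mm_rules scaleR_2)
  qed
  have inv: "((1/2) *\<^sub>R (mat 1 + Z)) ** (mat 1 + U) = mat 1"
    unfolding 1 bounded_bilinear.scaleR_left[OF bounded_bilinear_matrix_matrix_mult]
      bounded_bilinear.scaleR_right[OF bounded_bilinear_matrix_matrix_mult] by (simp add: N)
  define M where "M = matrix_inv (mat 1 + U)"
  have M: "M = (1/2) *\<^sub>R (mat 1 + Z)" unfolding M_def by (rule matrix_inv_unique_left[OF inv])
  have "invertible (mat 1 + U)" using inv invertible_left_inverse by blast
  then show "det (mat 1 + transpose Q0 ** fst (total_param Q0 X)) \<noteq> 0"
    by (simp add: tp U_def invertible_det_nz)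
  have NM: "N ** M = (1/2) *\<^sub>R mat 1"
    by (simp only: M bounded_bilinear.scaleR_right[OF bounded_bilinear_matrix_matrix_mult] N)
  have W: "Q - Q0 ** U = 2 *\<^sub>R (Y ** N)" by (simp add: Q_def C_def U mm_rules)
  have Y': "(Q - Q0 ** U) ** M = Y"
    unfolding W by (simp add: bounded_bilinear.scaleR_left[OF bounded_bilinear_matrix_matrix_mult]
        matrix_mul_assoc[symmetric] NM mm_rules(6))
  have Z': "(mat 1 - U) ** M = Z"
    unfolding 2 by (simp add: bounded_bilinear.scaleR_left[OF bounded_bilinear_matrix_matrix_mult]
        matrix_mul_assoc[symmetric] NM mm_rules(6))
  have "total_coord Q0 (total_param Q0 X) = Q0 ** (D + Z - transpose Y ** Y) + Y"
    using Y' Z' by (simp add: tp total_coord_def Let_def U_def[symmetric] M_def[symmetric])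
  also have "D + Z - transpose Y ** Y = E"
  proof -
    have "D + A = (1/2) *\<^sub>R (2 *\<^sub>R E)" unfolding D_def A_def scaleR_add_right[symmetric]
      by (simp add: scaleR_2)
    then show ?thesis by (simp add: Z_def)
  qed
  finally show "total_coord Q0 (total_param Q0 X) = X" by (simp add: Y_def)
qed

text \<open>Conversely \<open>W\<^sup>T W = 1 - U\<^sup>T U\<close> shows that \<open>Z - Y\<^sup>T Y\<close> is skew, so that \<open>D\<close> is the symmetric part
  of \<open>Q\<^sub>0\<^sup>T X\<close>.\<close>

lemma total_coord_in:
  fixes Q0 Q :: "real^'k^'n"
  assumes Q0: "Q0 \<in> stiefel" and Q: "Q \<in> stiefel" and D: "D \<in> spd"
    and det: "det (mat 1 + transpose Q0 ** Q) \<noteq> 0"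
  shows "transpose Q0 ** total_coord Q0 (Q, D) \<in> posdef"
    "total_param Q0 (total_coord Q0 (Q, D)) = (Q, D)"
proof -
  note q = stiefelD[OF Q0] and q1 = stiefelD[OF Q]
  define U where "U = transpose Q0 ** Q"
  define M where "M = matrix_inv (mat 1 + U)"
  define W where "W = Q - Q0 ** U"
  define Y where "Y = W ** M"
  define Z where "Z = (mat 1 - U) ** M"
  define A where "A = Z - transpose Y ** Y"
  define X where "X = Q0 ** (D + A) + Y"
  have X: "total_coord Q0 (Q, D) = X"
    by (simp add: total_coord_def Let_def U_def M_def W_def Y_def Z_def A_def X_def add_diff_eq)
  note M = matrix_inv_works[OF det[folded U_def], folded M_def]
  have D': "transpose D = D" "D \<in> posdef" using D by (simp_all add: spd_iff)
  have QW: "transpose Q0 ** W = 0" by (simp add: W_def mm_rules q U_def)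
  then have QY: "transpose Q0 ** Y = 0" by (simp add: Y_def mm_rules)
  have UT: "transpose U = transpose Q ** Q0" by (simp add: U_def mm_rules)
  have WW: "transpose W ** W = mat 1 - transpose U ** U"
    by (simp add: W_def mm_rules q q1 mm_lift[OF q] UT) (simp add: U_def mm_rules)
  have "Z + transpose Z = transpose M ** ((transpose (mat 1 + U)) ** (mat 1 - U) +
      transpose (mat 1 - U) ** (mat 1 + U)) ** M"
  proof -
    have "transpose M ** transpose (mat 1 + U) = mat 1"
      by (metis M(1) matrix_transpose_mul transpose_mat)
    then have "transpose M ** transpose (mat 1 + U) ** (mat 1 - U) ** M = Z" by (simp add: Z_def)
    moreover have "transpose M ** transpose (mat 1 - U) ** ((mat 1 + U) ** M) = transpose Z"
      by (simp only: M(1) Z_def matrix_transpose_mul matrix_mul_rid)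
    ultimately show ?thesis by (simp only: mm_rules(1,2) matrix_mul_assoc)
  qed
  also have "(transpose (mat 1 + U)) ** (mat 1 - U) + transpose (mat 1 - U) ** (mat 1 + U) =
      2 *\<^sub>R (transpose W ** W)"
    unfolding WW by (simp add: mm_rules scaleR_2)
  also have "transpose M ** (2 *\<^sub>R (transpose W ** W)) ** M = 2 *\<^sub>R (transpose Y ** Y)"
    by (simp add: Y_def mm_rules)
  finally have gram: "Z + transpose Z = 2 *\<^sub>R (transpose Y ** Y)" .
  have skew: "transpose A = - A"
  proof -
    have "A + transpose A = 0" using gram by (simp add: A_def mm_rules scaleR_2)
    then show ?thesis by (simp add: eq_neg_iff_add_eq_0 add.commute)
  qed
  have E: "transpose Q0 ** X = D + A" by (simp add: X_def mm_rules q QY)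
  show "transpose Q0 ** total_coord Q0 (Q, D) \<in> posdef"
    unfolding X E using posdef_add_skew[OF skew] D'(2) by blast
  have sym: "(1/2) *\<^sub>R (D + A + transpose (D + A)) = D"
    by (simp add: mm_rules D' skew flip: scaleR_2)
  have "D + A - transpose (D + A) = 2 *\<^sub>R A" by (simp add: mm_rules D' skew scaleR_2)
  then have anti: "(1/2) *\<^sub>R (D + A - transpose (D + A)) = A" by simp
  have Y': "X - Q0 ** (D + A) = Y" by (simp add: X_def)
  have Z': "transpose Y ** Y + A = Z" by (simp add: A_def)
  have 1: "mat 1 + Z = 2 *\<^sub>R M"
  proof -
    have "mat 1 + Z = (mat 1 + U) ** M + (mat 1 - U) ** M" by (simp only: M Z_def)
    then show ?thesis by (simp add: mm_rules scaleR_2)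
  qed
  have 2: "mat 1 - Z = 2 *\<^sub>R (U ** M)"
  proof -
    have "mat 1 - Z = (mat 1 + U) ** M - (mat 1 - U) ** M" by (simp only: M Z_def)
    then show ?thesis by (simp add: mm_rules scaleR_2)
  qed
  have "((1/2) *\<^sub>R (mat 1 + U)) ** (mat 1 + Z) = mat 1"
    unfolding 1 mm_rules(5,6) by (simp add: M)
  then have N: "matrix_inv (mat 1 + Z) = (1/2) *\<^sub>R (mat 1 + U)" by (rule matrix_inv_unique_left)
  have "(mat 1 - Z) ** ((1/2) *\<^sub>R (mat 1 + U)) = U ** (M ** (mat 1 + U))"
    unfolding 2 by (simp add: mm_rules(5,6) matrix_mul_assoc)
  then have UU: "(mat 1 - Z) ** ((1/2) *\<^sub>R (mat 1 + U)) = U" by (simp add: M)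
  have "2 *\<^sub>R (Y ** ((1/2) *\<^sub>R (mat 1 + U))) = W ** (M ** (mat 1 + U))"
    by (simp add: Y_def mm_rules(5,6) matrix_mul_assoc)
  then have YY: "2 *\<^sub>R (Y ** ((1/2) *\<^sub>R (mat 1 + U))) = W" by (simp add: M)
  have "total_param Q0 X = (Q0 ** ((mat 1 - Z) ** ((1/2) *\<^sub>R (mat 1 + U))) +
      2 *\<^sub>R (Y ** ((1/2) *\<^sub>R (mat 1 + U))), D)"
    unfolding total_param_def Let_def E Y' anti Z' N sym by (simp only: matrix_mul_assoc)
  then show "total_param Q0 (total_coord Q0 (Q, D)) = (Q, D)"
    unfolding X UU YY by (simp add: W_def)
qed

text \<open>The chart centred at \<open>Q\<^sub>0\<close> covers \<open>(Q\<^sub>0, D)\<close> because \<open>1 + Q\<^sub>0\<^sup>T Q\<^sub>0 = 2\<close> is invertible. Its values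
  fill an open set of \<open>n \<times> k\<close> matrices.\<close>

lemma smooth_manifold_total:
  "smooth_manifold (total_mfd :: ((real^'k^'n) \<times> (real^'k^'k), real^'k^'n) mfd)"
  unfolding total_mfd_def
proof (rule smooth_manifold_submanifold)
  fix p :: "(real^'k^'n) \<times> (real^'k^'k)" assume p: "p \<in> total_space"
  define Q0 where "Q0 = fst p"
  have Q0: "Q0 \<in> stiefel" using p by (auto simp: Q0_def)
  note q = stiefelD[OF Q0]
  let ?N = "{p :: (real^'k^'n) \<times> (real^'k^'k). det (mat 1 + transpose Q0 ** fst p) \<noteq> 0}"
    and ?O = "{X. transpose Q0 ** X \<in> posdef}"
  let ?U = "total_space \<inter> ?N"
  have "smooth_on_subset UNIV (\<lambda>p :: (real^'k^'n) \<times> (real^'k^'k). det (mat 1 + transpose Q0 ** fst p))"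
    by (intro smooth_on_subset_det smooth_on_subset_vec_nth smooth_rules)
  from open_vimage[OF _ smooth_on_subset_continuous[OF this], of "- {0}"]
  have "open ?N" by (simp add: vimage_def open_Compl)
  then have U: "openin (top_of_set total_space) ?U" by (rule openin_open_Int)
  have O: "open ?O" using open_vimage_posdef[of "transpose Q0" "mat 1"] by simp
  have sm: "smooth_on_subset ?U (total_coord Q0)"
    using smooth_total_coord by (rule smooth_on_subset_mono) simp
  have coord: "total_coord Q0 p \<in> UNIV \<inter> ?O \<and> total_param Q0 (total_coord Q0 p) = p"
    if "p \<in> ?U" for p
    using that total_coord_in[OF Q0, of "fst p" "snd p"] by (simp add: mem_Times_iff)
  have param: "total_param Q0 X \<in> ?U \<and> total_coord Q0 (total_param Q0 X) = X"
    if "X \<in> UNIV \<inter> ?O" for X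
    using that total_param_in[OF Q0, of X] by simp
  have im: "total_coord Q0 ` ?U \<subseteq> UNIV \<inter> ?O" "total_param Q0 ` (UNIV \<inter> ?O) \<subseteq> ?U"
    by (rule image_subsetI, use coord in blast, rule image_subsetI, use param in blast)
  have "dim (UNIV :: (real^'k^'n) set) = DIM(real^'k^'n)" by (rule dim_UNIV)
  then have "\<exists>g. (?U, g) \<in> snd (submanifold total_space :: (_, real^'k^'n) mfd)"
    by (rule submanifold_chart_of_parametrization[OF U subspace_UNIV _ O sm im(1) smooth_total_param im(2)])
       (use coord param in blast)+
  moreover have "mat 1 + transpose Q0 ** fst p = 2 *\<^sub>R mat 1"
    unfolding Q0_def[symmetric] q by (simp add: scaleR_2)
  moreover have "det (2 *\<^sub>R mat 1 :: real^'k^'k) \<noteq> 0"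
  proof -
    have "((1/2) *\<^sub>R mat 1) ** (2 *\<^sub>R mat 1 :: real^'k^'k) = mat 1" by (simp add: mm_rules)
    then show ?thesis by (metis invertible_det_nz invertible_left_inverse)
  qed
  ultimately have "p \<in> ?U \<and> (\<exists>g. (?U, g) \<in> snd (submanifold total_space :: (_, real^'k^'n) mfd))"
    using p by auto
  then show "\<exists>U f. (U, f) \<in> snd (submanifold total_space :: (_, real^'k^'n) mfd) \<and> p \<in> U"
    by blast
qed

section \<open>The quotient as a topological space\<close>

definition congruence :: "(real^'k^'n) \<times> (real^'k^'k) \<Rightarrow> real^'n^'n" where
  "congruence = (\<lambda>(Q, D). Q ** D ** transpose Q)"

lemma phi_cls_congruence: "p \<in> total_space \<Longrightarrow> phi (cls p) = congruence p"
  by (auto simp: congruence_def phi_cls)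

lemma smooth_congruence: "smooth_on_subset S congruence"
  unfolding congruence_def case_prod_unfold by (intro smooth_rules)

lemma congruence_in_psd_rank:
  fixes p :: "(real^'k^'n) \<times> (real^'k^'k)"
  assumes "p \<in> total_space"
  shows "congruence p \<in> psd_rank CARD('k)"
proof -
  obtain Q D where p: "p = (Q, D)" by (metis surj_pair)
  then show ?thesis
    using congruence_psd_rank[OF stiefelD, of Q D] assms by (simp add: congruence_def)
qed

lemma congruence_image:
  "congruence ` (total_space :: ((real^'k^'n) \<times> (real^'k^'k)) set) = psd_rank CARD('k)"
proof
  show "congruence ` (total_space :: ((real^'k^'n) \<times> (real^'k^'k)) set) \<subseteq> psd_rank CARD('k)"
    using congruence_in_psd_rank by (rule image_subsetI)
  show "psd_rank CARD('k) \<subseteq> congruence ` (total_space :: ((real^'k^'n) \<times> (real^'k^'k)) set)"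
  proof
    fix S :: "real^'n^'n" assume "S \<in> psd_rank CARD('k)"
    then obtain Q :: "real^'k^'n" and D where "Q \<in> stiefel" "D \<in> spd" "S = Q ** D ** transpose Q"
      by (rule psd_rank_decompose)
    then show "S \<in> congruence ` (total_space :: ((real^'k^'n) \<times> (real^'k^'k)) set)"
      by (intro image_eqI[of _ _ "(Q, D)"]) (simp_all add: congruence_def)
  qed
qed

text \<open>From \<open>Q D Q\<^sup>T = Q' D' Q'\<^sup>T\<close> the matrix \<open>Q'\<close> is recovered as \<open>Q G\<close> with
  \<open>G = D Q\<^sup>T Q' D'\<^sup>-\<^sup>1\<close>, and \<open>G\<close> is orthogonal because both \<open>Q\<close> and \<open>Q'\<close> have orthonormal
  columns.\<close>

lemma congruence_eq_imp_cls_eq: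
  fixes p p' :: "(real^'k^'n) \<times> (real^'k^'k)"
  assumes p: "p \<in> total_space" "p' \<in> total_space" and eq: "congruence p = congruence p'"
  shows "cls p = cls p'"
proof -
  obtain Q D Q' D' where pq: "p = (Q, D)" "p' = (Q', D')" by (metis surj_pair)
  have q: "transpose Q ** Q = mat 1" "transpose Q' ** Q' = mat 1"
    using p pq by (simp_all add: stiefel_def)
  have e: "Q ** D ** transpose Q = Q' ** D' ** transpose Q'"
    using eq by (simp add: pq congruence_def)
  have "det D' \<noteq> 0" using p pq by (simp add: spd_iff posdef_det)
  note inv = matrix_inv_works[OF this]
  define G where "G = D ** transpose Q ** Q' ** matrix_inv D'"
  have "Q ** G = (Q ** D ** transpose Q) ** Q' ** matrix_inv D'" by (simp add: G_def mm_rules)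
  also have "\<dots> = Q'" by (simp add: e mm_lift[OF q(2)] mm_lift[OF inv(1)])
  finally have QG: "Q ** G = Q'" .
  have "transpose G ** G = transpose (Q ** G) ** (Q ** G)" by (simp add: mm_rules mm_lift[OF q(1)])
  then have "transpose G ** G = mat 1" by (simp add: QG q)
  then have G: "orthogonal_matrix G" by (simp add: orthogonal_matrix)
  have "transpose G ** D ** G = transpose (Q ** G) ** (Q ** D ** transpose Q) ** (Q ** G)"
    by (simp add: mm_rules mm_lift[OF q(1)])
  also have "\<dots> = D'" unfolding QG e by (simp add: mm_rules q mm_lift[OF q(2)])
  finally have "act p G = p'" by (simp add: act_def pq QG)
  then have "(p, p') \<in> orbit_rel" using p(1) G unfolding orbit_rel_iff by blast
  then show ?thesis unfolding cls_def by (rule equiv_class_eq[OF equiv_orbit_rel])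
qed

lemma compact_stiefel: "compact (stiefel :: (real^'k^'n) set)"
proof -
  have "continuous_on UNIV (\<lambda>Q :: real^'k^'n. transpose Q ** Q)"
    by (intro smooth_on_subset_continuous smooth_rules)
  then have "closed {Q :: real^'k^'n. transpose Q ** Q = mat 1}"
    by (intro closed_Collect_eq continuous_on_const)
  moreover have "norm Q \<le> sqrt CARD('k)" if Q: "Q \<in> stiefel" for Q :: "real^'k^'n"
  proof -
    have "Q \<bullet> Q = (\<Sum>j\<in>UNIV. \<Sum>i\<in>UNIV. Q $ i $ j * Q $ i $ j)"
      by (subst sum.swap) (simp add: inner_vec_def)
    also have "\<dots> = (\<Sum>j\<in>UNIV. (transpose Q ** Q) $ j $ j)"
      by (simp add: matrix_matrix_mult_def transpose_def)
    also have "\<dots> = CARD('k)" using Q by (simp add: stiefel_def mat_def)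
    finally show ?thesis by (simp add: norm_eq_sqrt_inner)
  qed
  then have "bounded (stiefel :: (real^'k^'n) set)" unfolding bounded_iff by blast
  ultimately show ?thesis by (simp add: compact_eq_bounded_closed stiefel_def)
qed

text \<open>The fibres of the map are compact, since \<open>Q\<close> ranges over a compact set and determines
  \<open>D = Q\<^sup>T S Q\<close>; hence the image of a closed set is a projection of a closed set along a compact
  one.\<close>

lemma closed_map_congruence:
  assumes C: "closedin (top_of_set (total_space :: ((real^'k^'n) \<times> (real^'k^'k)) set)) C"
  shows "closedin (top_of_set (psd_rank CARD('k))) (congruence ` C)"
proof -
  let ?P = "(stiefel :: (real^'k^'n) set) \<times> (psd_rank CARD('k) :: (real^'n^'n) set)"
  let ?k = "\<lambda>(Q :: real^'k^'n, S :: real^'n^'n). (Q, transpose Q ** S ** Q)"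
  define R where "R = {z \<in> ?P. snd z = congruence (?k z)}"
  have sk: "smooth_on_subset X ?k" for X
    unfolding case_prod_unfold by (intro smooth_rules)
  have "continuous_on ?P (\<lambda>z. snd z - congruence (?k z))"
    by (intro smooth_on_subset_continuous smooth_on_subset_diff smooth_on_subset_snd smooth_on_subset_id
        smooth_on_subset_comp[OF sk smooth_congruence subset_UNIV])
  from continuous_closedin_preimage[OF this closed_singleton[of 0]]
  have "closedin (top_of_set ?P) (?P \<inter> (\<lambda>z. snd z - congruence (?k z)) -` {0})" .
  moreover have "?P \<inter> (\<lambda>z. snd z - congruence (?k z)) -` {0} = R" by (auto simp: R_def)
  ultimately have R: "closedin (top_of_set ?P) R" by simp
  have "?k ` R \<subseteq> total_space"
  proof (rule image_subsetI)
    fix z assume z: "z \<in> R"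
    then have "fst z \<in> stiefel" "congruence (?k z) \<in> psd_rank CARD('k)"
      by (auto simp: R_def)
    then show "?k z \<in> total_space"
      using stiefel_congruence_spd[of "fst z" "transpose (fst z) ** snd z ** fst z"]
      by (simp add: congruence_def case_prod_unfold)
  qed
  then have "?k \<in> R \<rightarrow> total_space" by (simp add: image_subset_iff_funcset)
  then have "closedin (top_of_set R) (R \<inter> ?k -` C)"
    using continuous_closedin_preimage_gen[OF smooth_on_subset_continuous[OF sk] _ C] by blast
  then have "closedin (top_of_set ?P) (R \<inter> ?k -` C)" using R by (rule closedin_trans)
  then have "closedin (top_of_set (psd_rank CARD('k))) {S. \<exists>Q. Q \<in> stiefel \<and> (Q, S) \<in> R \<inter> ?k -` C}"
    by (rule closedin_compact_projection[OF compact_stiefel])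
  moreover have "{S. \<exists>Q. Q \<in> stiefel \<and> (Q, S) \<in> R \<inter> ?k -` C} = congruence ` C"
  proof (intro set_eqI iffI)
    fix S assume "S \<in> {S. \<exists>Q. Q \<in> stiefel \<and> (Q, S) \<in> R \<inter> ?k -` C}"
    then obtain Q where "(Q, S) \<in> R" "?k (Q, S) \<in> C" by auto
    then show "S \<in> congruence ` C" by (intro image_eqI[of _ _ "?k (Q, S)"]) (auto simp: R_def)
  next
    fix S assume "S \<in> congruence ` C"
    then obtain Q D where QD: "(Q, D) \<in> C" "S = congruence (Q, D)" by auto
    have t: "(Q, D) \<in> total_space" using closedin_imp_subset[OF C] QD(1) by blast
    then have q: "transpose Q ** Q = mat 1" by (simp add: stiefel_def)
    have "transpose Q ** S ** Q = D"
      by (simp add: QD(2) congruence_def mm_rules q mm_lift[OF q])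
    then have k: "?k (Q, S) = (Q, D)" by simp
    have "S \<in> psd_rank CARD('k)" unfolding QD(2) using t by (rule congruence_in_psd_rank)
    then have "(Q, S) \<in> R" using k t QD(2) by (simp add: R_def)
    then show "S \<in> {S. \<exists>Q. Q \<in> stiefel \<and> (Q, S) \<in> R \<inter> ?k -` C}"
      using k QD(1) t by auto
  qed
  ultimately show ?thesis by simp
qed

text \<open>Both \<open>cls\<close> and \<open>congruence = phi \<circ> cls\<close> are quotient maps, hence so is \<open>phi\<close>, which is injective.\<close>

lemma homeomorphic_map_phi:
  "homeomorphic_map (M_top :: ((real^'k^'n) \<times> (real^'k^'k)) set topology)
     (top_of_set (psd_rank CARD('k))) phi"
proof -
  let ?T = "top_of_set (total_space :: ((real^'k^'n) \<times> (real^'k^'k)) set)"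
    and ?P = "top_of_set (psd_rank CARD('k) :: (real^'n^'n) set)"
    and ?M = "M_top :: ((real^'k^'n) \<times> (real^'k^'k)) set topology"
  have cont: "continuous_map ?T ?P congruence"
    using smooth_on_subset_continuous[OF smooth_congruence] congruence_in_psd_rank by auto
  have "quotient_map ?T ?P congruence"
    using closed_map_congruence cont congruence_image
    by (intro continuous_closed_imp_quotient_map) (auto simp: closed_map_def)
  then have quo: "quotient_map ?T ?P (phi \<circ> cls)"
    by (rule quotient_map_eq) (simp add: phi_cls_congruence)
  have "continuous_map ?M ?P phi"
    by (rule continuous_compose_quotient_map[OF quotient_map_cls quotient_imp_continuous_map[OF quo]])
  then have "quotient_map ?M ?P phi"
    by (rule quotient_map_from_composition[OF quotient_imp_continuous_map[OF quotient_map_cls] _ quo])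
  moreover have "inj_on phi (topspace ?M)"
    unfolding topspace_M_top M_set_eq
  proof (rule inj_onI)
    fix C C' :: "((real^'k^'n) \<times> (real^'k^'k)) set"
    assume C: "C \<in> cls ` total_space" "C' \<in> cls ` total_space" "phi C = phi C'"
    then obtain p p' :: "(real^'k^'n) \<times> (real^'k^'k)" where
      p: "p \<in> total_space" "C = cls p" "p' \<in> total_space" "C' = cls p'" by (elim imageE)
    with C(3) show "C = C'"
      using congruence_eq_imp_cls_eq[of p p'] by (simp only: phi_cls_congruence)
  qed
  ultimately show ?thesis by (simp add: homeomorphic_map_def)
qed

section \<open>The map to the positive semidefinite matrices is a submersion\<close>

lemma has_derivative_congruence:
  fixes B :: "'a::real_normed_vector \<Rightarrow> real^'k^'n"
  assumes B: "(B has_derivative B') (at x)" and E: "(E has_derivative E') (at x)"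
  shows "((\<lambda>x. B x ** E x ** transpose (B x)) has_derivative
    (\<lambda>v. B x ** E x ** transpose (B' v) + (B x ** E' v + B' v ** E x) ** transpose (B x))) (at x)"
  by (intro bounded_bilinear.FDERIV[OF bounded_bilinear_matrix_matrix_mult]
      bounded_linear.has_derivative[OF bounded_linear_transpose] B E)

lemma has_derivative_product_of_zeros:
  fixes a :: "'a::real_normed_vector \<Rightarrow> real^'m^'n" and b :: "'a \<Rightarrow> real^'p^'m"
  assumes "(a has_derivative a') (at x)" "(b has_derivative b') (at x)" "a x = 0" "b x = 0"
  shows "((\<lambda>x. a x ** b x) has_derivative (\<lambda>_. 0)) (at x)"
proof -
  have "((\<lambda>x. a x ** b x) has_derivative (\<lambda>v. a x ** b' v + a' v ** b x)) (at x)"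
    by (rule bounded_bilinear.FDERIV[OF bounded_bilinear_matrix_matrix_mult assms(1,2)])
  then show ?thesis by (simp add: assms(3,4) mm_rules)
qed

lemma smooth_on_subset_differentiable:
  assumes "open S" "smooth_on_subset S f" "x \<in> S"
  obtains f' where "(f has_derivative f') (at x)"
  using assms smooth_on_openD(4)[of S f x] by (auto simp: smooth_on_open_iff_subset)

text \<open>A family of positive semidefinite matrices is written near \<open>Q\<^sub>0 D\<^sub>0 Q\<^sub>0\<^sup>T\<close> as
  \<open>B E B\<^sup>T\<close> with \<open>E = Q\<^sub>0\<^sup>T \<sigma> Q\<^sub>0\<close> and \<open>B = \<sigma> Q\<^sub>0 E\<^sup>-\<^sup>1\<close>, where the columns of \<open>B\<close> need not
  be orthonormal. The point of the total space with coordinate \<open>Q\<^sub>0 E + (B - Q\<^sub>0) / 2\<close> has second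
  component \<open>E\<close>, and its first component differs from \<open>B\<close> by a term of second order in
  \<open>B - Q\<^sub>0\<close>. So it lifts the family to first order, which is all that surjectivity of the
  differential requires.\<close>

lemma first_order_lift:
  fixes \<sigma> :: "'e::euclidean_space \<Rightarrow> real^'n^'n" and Q0 :: "real^'k^'n"
  assumes Q0: "Q0 \<in> stiefel" and D0: "D0 \<in> spd" and W: "open W" "e0 \<in> W"
    and \<sigma>: "smooth_on_subset W \<sigma>" "\<sigma> ` W \<subseteq> psd_rank CARD('k)" "\<sigma> e0 = congruence (Q0, D0)"
  shows "\<exists>W' \<Lambda> d. open W' \<and> e0 \<in> W' \<and> smooth_on_subset W' \<Lambda> \<and>
    \<Lambda> ` W' \<subseteq> total_space \<and> \<Lambda> e0 = (Q0, D0) \<and>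
    ((\<lambda>e. congruence (\<Lambda> e)) has_derivative d) (at e0) \<and> (\<sigma> has_derivative d) (at e0)"
proof -
  note q = stiefelD[OF Q0]
  define E where "E e = transpose Q0 ** \<sigma> e ** Q0" for e
  define W' where "W' = W \<inter> E -` posdef"
  define B where "B e = \<sigma> e ** Q0 ** matrix_inv (E e)" for e
  define Y where "Y e = (1/2) *\<^sub>R (B e - Q0)" for e
  define X where "X e = Q0 ** E e + Y e" for e
  define Z where "Z e = transpose (Y e) ** Y e" for e
  define N where "N e = matrix_inv (mat 1 + Z e)" for e
  define \<Lambda> where "\<Lambda> e = total_param Q0 (X e)" for e
  have sE: "smooth_on_subset W E" unfolding E_def by (intro smooth_rules \<sigma>)
  have W': "open W'"
    unfolding W'_def using W(1) open_posdef
    by (intro continuous_open_preimage smooth_on_subset_continuous[OF sE])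
  have "W' \<subseteq> W" by (auto simp: W'_def)
  note mono = smooth_on_subset_mono[OF _ this]
  have detE: "det (E e) \<noteq> 0" if "e \<in> W'" for e using that by (simp add: W'_def posdef_det)
  have sB: "smooth_on_subset W' B"
    unfolding B_def by (intro smooth_rules mono[OF \<sigma>(1)] mono[OF sE] detE)
  have sY: "smooth_on_subset W' Y" unfolding Y_def by (intro smooth_rules sB)
  have sX: "smooth_on_subset W' X" unfolding X_def by (intro smooth_rules sY mono[OF sE])
  have sL: "smooth_on_subset W' \<Lambda>"
    unfolding \<Lambda>_def using smooth_on_subset_comp[OF sX smooth_total_param subset_UNIV] .
  have detZ: "det (mat 1 + Z e) \<noteq> 0" for e
    using posdef_one_plus_gram_plus_skew[of 0 "Y e"] unfolding Z_def
    by (intro posdef_det) (simp add: mm_rules)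
  have sN: "smooth_on_subset W' N"
    unfolding N_def using detZ by (intro smooth_rules) (auto simp: Z_def intro!: smooth_rules sY)
  have symE: "transpose (E e) = E e" if "e \<in> W'" for e
  proof -
    have "\<sigma> e \<in> psd_rank CARD('k)" using that \<sigma>(2) by (auto simp: W'_def)
    then show ?thesis by (simp add: E_def mm_rules psd_rank_def)
  qed
  have QB: "transpose Q0 ** B e = mat 1" if "e \<in> W'" for e
    using matrix_inv_works(1)[OF detE[OF that]] by (simp add: B_def E_def mm_rules)
  have QX: "transpose Q0 ** X e = E e" if "e \<in> W'" for e
    by (simp add: X_def Y_def mm_rules q QB[OF that])
  have \<Lambda>_eq: "\<Lambda> e = (Q0 ** (mat 1 - Z e) ** N e + 2 *\<^sub>R (Y e ** N e), E e)" if "e \<in> W'" for e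
  proof -
    have "X e - Q0 ** E e = Y e" by (simp add: X_def)
    moreover have "(1/2) *\<^sub>R (E e + E e) = E e" by (simp flip: scaleR_2)
    ultimately show ?thesis
      unfolding \<Lambda>_def total_param_def Let_def QX[OF that]
      by (simp add: symE[OF that] Z_def N_def)
  qed
  have \<sigma>_eq: "\<sigma> e = B e ** E e ** transpose (B e)" if e: "e \<in> W'" for e
  proof -
    have S: "\<sigma> e \<in> psd_rank CARD('k)" "transpose Q0 ** \<sigma> e ** Q0 \<in> posdef"
      using that \<sigma>(2) by (auto simp: W'_def E_def)
    have "psd_coord Q0 (\<sigma> e) - Q0 ** E e + Q0 = B e"
      by (simp add: psd_coord_def Let_def B_def E_def)
    then show ?thesis
      using psd_coord_in(3)[OF Q0 S] psd_coord_in(1)[OF Q0 S]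
      by (simp add: psd_param_def Let_def E_def[symmetric])
  qed
  \<comment> \<open>the first components of \<open>\<Lambda>\<close> and \<open>B\<close> differ by a product of two terms vanishing at \<open>e0\<close>\<close>
  have diff: "fst (\<Lambda> e) = B e + (-2) *\<^sub>R (((Q0 + Y e) ** transpose (Y e)) ** (Y e ** N e))"
    if e: "e \<in> W'" for e
  proof -
    have "B e = Q0 + 2 *\<^sub>R Y e" by (simp add: Y_def)
    also have "\<dots> = (Q0 + 2 *\<^sub>R Y e) ** ((mat 1 + Z e) ** N e)"
      using matrix_inv_works(1)[OF detZ[of e]] by (simp add: N_def)
    finally have B: "B e = (Q0 + 2 *\<^sub>R Y e) ** (mat 1 + Z e) ** N e" by (simp only: matrix_mul_assoc)
    have "fst (\<Lambda> e) - B e = (Q0 ** (mat 1 - Z e) + 2 *\<^sub>R Y e - (Q0 + 2 *\<^sub>R Y e) ** (mat 1 + Z e)) ** N e"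
      unfolding \<Lambda>_eq[OF e] fst_conv B by (simp only: mm_rules(1,3,5))
    also have "Q0 ** (mat 1 - Z e) + 2 *\<^sub>R Y e - (Q0 + 2 *\<^sub>R Y e) ** (mat 1 + Z e) =
        (-2) *\<^sub>R ((Q0 + Y e) ** Z e)"
      by (simp only: mm_rules(1-6) matrix_mul_rid) (simp add: algebra_simps scaleR_2)
    also have "((-2) *\<^sub>R ((Q0 + Y e) ** Z e)) ** N e =
        (-2) *\<^sub>R (((Q0 + Y e) ** transpose (Y e)) ** (Y e ** N e))"
      by (simp only: mm_rules(5) Z_def matrix_mul_assoc)
    finally show ?thesis by (simp add: algebra_simps)
  qed
  have E0: "E e0 = D0"
    by (simp add: E_def \<sigma>(3) congruence_def mm_rules q mm_lift[OF q])
  then have e0: "e0 \<in> W'" using W(2) D0 by (simp add: W'_def spd_iff)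
  have B0: "B e0 = Q0"
    using matrix_inv_works(1)[OF detE[OF e0]]
    by (simp add: B_def \<sigma>(3) E0 congruence_def mm_lift[OF q] mm_lift)
  have Y0: "Y e0 = 0" by (simp add: Y_def B0)
  have L0: "fst (\<Lambda> e0) = Q0" unfolding diff[OF e0] by (simp add: B0 Y0 mm_rules)
  have sndL: "snd (\<Lambda> e) = E e" if "e \<in> W'" for e using \<Lambda>_eq[OF that] by simp
  obtain B' where B': "(B has_derivative B') (at e0)"
    by (rule smooth_on_subset_differentiable[OF W' sB e0])
  obtain E' where E': "(E has_derivative E') (at e0)"
    by (rule smooth_on_subset_differentiable[OF W' mono[OF sE] e0])
  have ab: "smooth_on_subset W' (\<lambda>e. (Q0 + Y e) ** transpose (Y e))" "smooth_on_subset W' (\<lambda>e. Y e ** N e)"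
    by (intro smooth_rules sY sN)+
  obtain a where a: "((\<lambda>e. (Q0 + Y e) ** transpose (Y e)) has_derivative a) (at e0)"
    by (rule smooth_on_subset_differentiable[OF W' ab(1) e0])
  obtain b where b: "((\<lambda>e. Y e ** N e) has_derivative b) (at e0)"
    by (rule smooth_on_subset_differentiable[OF W' ab(2) e0])
  from a b have "((\<lambda>e. ((Q0 + Y e) ** transpose (Y e)) ** (Y e ** N e)) has_derivative (\<lambda>_. 0)) (at e0)"
    by (rule has_derivative_product_of_zeros) (simp_all add: Y0 mm_rules)
  then have "((\<lambda>e. B e + (-2) *\<^sub>R (((Q0 + Y e) ** transpose (Y e)) ** (Y e ** N e)))
      has_derivative (\<lambda>v. B' v + (-2) *\<^sub>R 0)) (at e0)"
    by (intro has_derivative_add has_derivative_scaleR_right B')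
  then have "((\<lambda>e. B e + (-2) *\<^sub>R (((Q0 + Y e) ** transpose (Y e)) ** (Y e ** N e)))
      has_derivative B') (at e0)" by simp
  then have L': "((\<lambda>e. fst (\<Lambda> e)) has_derivative B') (at e0)"
    by (rule has_derivative_transform_within_open[OF _ W' e0]) (simp only: diff)
  let ?d = "\<lambda>v. Q0 ** D0 ** transpose (B' v) + (Q0 ** E' v + B' v ** D0) ** transpose Q0"
  have "((\<lambda>e. B e ** E e ** transpose (B e)) has_derivative ?d) (at e0)"
    using has_derivative_congruence[OF B' E'] by (simp only: B0 E0)
  then have d1: "(\<sigma> has_derivative ?d) (at e0)"
    by (rule has_derivative_transform_within_open[OF _ W' e0]) (simp only: \<sigma>_eq)
  have "((\<lambda>e. fst (\<Lambda> e) ** E e ** transpose (fst (\<Lambda> e))) has_derivative ?d) (at e0)"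
    using has_derivative_congruence[OF L' E'] by (simp only: L0 E0)
  then have d2: "((\<lambda>e. congruence (\<Lambda> e)) has_derivative ?d) (at e0)"
    by (rule has_derivative_transform_within_open[OF _ W' e0])
       (simp only: congruence_def case_prod_unfold sndL)
  have "\<Lambda> e \<in> total_space" if e: "e \<in> W'" for e
  proof -
    have "transpose Q0 ** X e \<in> posdef" using e QX[OF e] by (simp add: W'_def)
    then show ?thesis unfolding \<Lambda>_def by (rule total_param_in(1)[OF Q0])
  qed
  moreover have "\<Lambda> e0 = (Q0, D0)" using L0 sndL[OF e0] E0 by (simp add: prod_eq_iff)
  ultimately show ?thesis using W' e0 sL d1 d2 by blast
qed

text \<open>A direction \<open>v\<close> in the chart \<open>g\<close> belongs to the family \<open>\<sigma> = g\<^sup>-\<^sup>1\<close>. Along its first-order lift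
  \<open>\<Lambda>\<close> the derivative of the coordinate expression of the map, applied to the velocity of \<open>\<Lambda>\<close> in
  the chart \<open>f\<close>, is the derivative of \<open>g \<circ> \<sigma> = id\<close>. So \<open>v\<close> is attained.\<close>

lemma smooth_submersion_congruence:
  "smooth_submersion (total_mfd :: ((real^'k^'n) \<times> (real^'k^'k), real^'k^'n) mfd)
     (psd_mfd TYPE('k) :: (real^'n^'n, real^('n::finite, 'k::finite) psd_dim) mfd) congruence"
proof -
  let ?M = "total_mfd :: ((real^'k^'n) \<times> (real^'k^'k), real^'k^'n) mfd"
    and ?N = "psd_mfd TYPE('k) :: (real^'n^'n, real^('n, 'k) psd_dim) mfd"
  note defs = total_mfd_def psd_mfd_def
  have mfd: "smooth_manifold ?M" "smooth_manifold ?N"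
    by (rule smooth_manifold_total, rule smooth_manifold_psd)
  then have S: "smooth_structure (fst ?M) (snd ?M)" "smooth_structure (fst ?N) (snd ?N)"
    unfolding smooth_manifold_iff by blast+
  have sm: "smooth_map ?M ?N congruence"
    unfolding defs
    by (rule smooth_map_submanifold[OF smooth_congruence _ mfd[unfolded defs]])
       (use congruence_in_psd_rank in blast)
  moreover have "surj (frechet_derivative (g \<circ> congruence \<circ> inv_into U f) (at (f p)))"
    if c: "(U, f) \<in> snd ?M" "(V, g) \<in> snd ?N" "p \<in> U" "congruence p \<in> V" for U f V g p
  proof -
    let ?\<Phi> = "g \<circ> congruence \<circ> inv_into U f"
    note cf = submanifold_chartD[OF c(1)[unfolded defs]]
      and cg = submanifold_chartD[OF c(2)[unfolded defs]]
    obtain Q0 D0 where p: "p = (Q0, D0)" "Q0 \<in> stiefel" "D0 \<in> spd" using c(3) cf(2) by auto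
    let ?\<sigma> = "inv_into V g" and ?e0 = "g (congruence p)"
    have e0: "?e0 \<in> g ` V" using c(4) by blast
    have \<sigma>: "?\<sigma> ` g ` V \<subseteq> psd_rank CARD('k)" "?\<sigma> ?e0 = congruence (Q0, D0)"
      using cg(2,3) c(4) p(1) by auto
    obtain W \<Lambda> d where W: "open W" "?e0 \<in> W" and \<Lambda>: "smooth_on_subset W \<Lambda>" "\<Lambda> ` W \<subseteq> total_space"
      "\<Lambda> ?e0 = p" and d: "((\<lambda>e. congruence (\<Lambda> e)) has_derivative d) (at ?e0)"
      "(?\<sigma> has_derivative d) (at ?e0)"
      using first_order_lift[OF p(2,3) cg(5) e0 cg(6) \<sigma>] p(1) by blast
    obtain A G where G: "congruence p \<in> A" "smooth_on_open A G" "\<And>S. S \<in> A \<inter> V \<Longrightarrow> G S = g S"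
      using smooth_on_subsetE[OF cg(4) c(4)] by metis
    obtain NU NV where NU: "open NU" "U = total_space \<inter> NU" and NV: "open NV" "V = psd_rank CARD('k) \<inter> NV"
      using cf(1) cg(1) by (auto simp: openin_open)
    have sc: "smooth_on_subset W (\<lambda>e. congruence (\<Lambda> e))"
      by (rule smooth_on_subset_comp[OF \<Lambda>(1) smooth_congruence subset_UNIV])
    define W1 where "W1 = (W \<inter> \<Lambda> -` NU) \<inter> (W \<inter> (\<lambda>e. congruence (\<Lambda> e)) -` (NV \<inter> A))"
    have W1: "open W1"
      unfolding W1_def using smooth_on_openD(1)[OF G(2)] NU(1) NV(1) W(1)
      by (intro open_Int continuous_open_preimage smooth_on_subset_continuous[OF \<Lambda>(1)]
          smooth_on_subset_continuous[OF sc])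
    have e1: "?e0 \<in> W1" using W(2) \<Lambda>(3) c(3,4) NU(2) NV(2) G(1) by (simp add: W1_def)
    have LU: "\<Lambda> e \<in> U" and cV: "congruence (\<Lambda> e) \<in> A \<inter> V" if "e \<in> W1" for e
      using that \<Lambda>(2) congruence_in_psd_rank[of "\<Lambda> e"] by (auto simp: W1_def NU(2) NV(2))
    have "smooth_on_subset W1 \<Lambda>" using \<Lambda>(1) by (rule smooth_on_subset_mono) (auto simp: W1_def)
    then have "smooth_on_subset W1 (\<lambda>e. f (\<Lambda> e))"
      by (rule smooth_on_subset_comp[OF _ cf(4)]) (use LU in blast)
    then obtain a where a: "((\<lambda>e. f (\<Lambda> e)) has_derivative a) (at ?e0)"
      using smooth_on_subset_differentiable[OF W1 _ e1] by blast
    obtain D where "f p \<in> D" "smooth_on_open D ?\<Phi>"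
      using smooth_map_in_charts[OF S sm c(1,2,3,4)] by blast
    then have \<Phi>: "(?\<Phi> has_derivative frechet_derivative ?\<Phi> (at (f p))) (at (f p))"
      using smooth_on_openD(4) by blast
    have 1: "((\<lambda>e. ?\<Phi> (f (\<Lambda> e))) has_derivative (\<lambda>v. frechet_derivative ?\<Phi> (at (f p)) (a v))) (at ?e0)"
      by (rule has_derivative_compose[OF a]) (unfold \<Lambda>(3), rule \<Phi>)
    let ?G' = "frechet_derivative G (at (congruence p))"
    have G': "(G has_derivative ?G') (at (congruence p))" by (rule smooth_on_openD(4)[OF G(2,1)])
    have "((\<lambda>e. G (congruence (\<Lambda> e))) has_derivative (\<lambda>v. ?G' (d v))) (at ?e0)"
      by (rule has_derivative_compose[OF d(1)]) (use G' \<Lambda>(3) in simp)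
    then have 2: "((\<lambda>e. ?\<Phi> (f (\<Lambda> e))) has_derivative (\<lambda>v. ?G' (d v))) (at ?e0)"
      by (rule has_derivative_transform_within_open[OF _ W1 e1]) (use LU cV G(3) cf(3) in simp)
    have 3: "((\<lambda>e. G (?\<sigma> e)) has_derivative (\<lambda>v. ?G' (d v))) (at ?e0)"
      by (rule has_derivative_compose[OF d(2)]) (use G' \<sigma>(2) p(1) in simp)
    define W2 where "W2 = g ` V \<inter> ?\<sigma> -` A"
    have W2: "open W2"
      unfolding W2_def using cg(5) smooth_on_openD(1)[OF G(2)]
      by (intro continuous_open_preimage smooth_on_subset_continuous[OF cg(6)])
    have e2: "?e0 \<in> W2" using e0 \<sigma>(2) p(1) G(1) by (simp add: W2_def)
    have "((\<lambda>e. e) has_derivative (\<lambda>v. ?G' (d v))) (at ?e0)"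
    proof (rule has_derivative_transform_within_open[OF 3 W2 e2])
      fix e assume e: "e \<in> W2"
      then have "e \<in> g ` V" by (simp add: W2_def)
      from inv_into_into[OF this] f_inv_into_f[OF this] show "G (?\<sigma> e) = e"
        using e G(3)[of "?\<sigma> e"] by (simp add: W2_def)
    qed
    then have "(\<lambda>v. ?G' (d v)) = (\<lambda>v. v)"
      using has_derivative_ident has_derivative_unique by blast
    moreover have "(\<lambda>v. frechet_derivative ?\<Phi> (at (f p)) (a v)) = (\<lambda>v. ?G' (d v))"
      using 1 2 has_derivative_unique by blast
    ultimately have "frechet_derivative ?\<Phi> (at (f p)) (a v) = v" for v by metis
    then show ?thesis by (rule surjI)
  qed
  ultimately show ?thesis unfolding smooth_submersion_iff by blast
qed

section \<open>The diffeomorphism and its fibres\<close>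

text \<open>The pulled back atlas makes \<open>cls\<close> a submersion, and by uniqueness it is the only one.\<close>

lemma M_mfd_eq_pullback:
  assumes hom: "homeomorphic_maps (M_top :: ((real^'k::finite^'n::finite) \<times> (real^'k^'k)) set topology)
      (top_of_set (psd_rank CARD('k))) phi \<psi>"
  shows "(M_mfd :: (((real^'k^'n) \<times> (real^'k^'k)) set, real^('n, 'k) psd_dim) mfd) =
    (M_top, pullback_atlas M_top phi \<psi> (snd (psd_mfd TYPE('k))))"
proof -
  let ?M = "total_mfd :: ((real^'k^'n) \<times> (real^'k^'k), real^'k^'n) mfd"
    and ?N = "psd_mfd TYPE('k) :: (real^'n^'n, real^('n, 'k) psd_dim) mfd"
  let ?A = "pullback_atlas M_top phi \<psi> (snd ?N)"
  let ?P = "\<lambda>A :: (((real^'k^'n) \<times> (real^'k^'k)) set, real^('n, 'k) psd_dim) chart set.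
    smooth_manifold (M_top, A) \<and> smooth_submersion ?M (M_top, A) cls"
  have hom': "homeomorphic_maps M_top (fst ?N) phi \<psi>" using hom by (simp add: psd_mfd_def)
  have mfd: "smooth_manifold ?M" "smooth_manifold ?N"
    by (rule smooth_manifold_total, rule smooth_manifold_psd)
  then have M: "smooth_structure (fst ?M) (snd ?M)" and N: "smooth_structure (fst ?N) (snd ?N)"
    unfolding smooth_manifold_iff by blast+
  have top: "topspace (fst ?M) = total_space" by (simp add: total_mfd_def)
  have A: "?P ?A"
  proof
    show "smooth_manifold (M_top, ?A)" by (rule smooth_manifold_pullback[OF hom' smooth_manifold_psd])
    show "smooth_submersion ?M (M_top, ?A) cls"
      by (rule smooth_submersion_pullback[OF hom' M N smooth_submersion_congruence])
         (unfold top topspace_M_top M_set_eq, use phi_cls_congruence in blast)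
  qed
  have "(THE A. ?P A) = ?A"
  proof (rule the_equality[where P = ?P], rule A)
    fix B assume B: "?P B"
    show "B = ?A"
      by (rule submersion_structure_unique[OF M, where X = M_top and \<pi> = cls])
         (use A B in \<open>simp_all only: smooth_manifold_iff fst_conv snd_conv top topspace_M_top M_set_eq\<close>)
  qed
  then show ?thesis by (simp only: M_mfd_def)
qed

lemma diffeomorphism_phi:
  "diffeomorphism
     (M_mfd :: (((real^'k::finite^'n::finite) \<times> (real^'k^'k)) set, real^('n, 'k) psd_dim) mfd)
     (psd_mfd TYPE('k)) phi"
proof -
  obtain \<psi> where hom: "homeomorphic_maps (M_top :: ((real^'k^'n) \<times> (real^'k^'k)) set topology)
      (top_of_set (psd_rank CARD('k))) phi \<psi>"
    using homeomorphic_map_phi homeomorphic_map_maps by blast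
  have hom': "homeomorphic_maps M_top (fst (psd_mfd TYPE('k) :: (_, real^('n, 'k) psd_dim) mfd)) phi \<psi>"
    using hom by (simp add: psd_mfd_def)
  show ?thesis
    unfolding M_mfd_eq_pullback[OF hom] by (rule diffeomorphism_pullback[OF hom' smooth_manifold_psd])
qed

lemma diffeomorphism_submanifold:
  assumes S: "smooth_manifold (submanifold S :: ('a::euclidean_space, 'e::euclidean_space) mfd)"
    and T: "smooth_manifold (submanifold T :: ('b::euclidean_space, 'd::euclidean_space) mfd)"
    and F: "smooth_on_subset S F" "F ` S \<subseteq> T" and G: "smooth_on_subset T G" "G ` T \<subseteq> S"
    and GF: "\<And>x. x \<in> S \<Longrightarrow> G (F x) = x" and FG: "\<And>y. y \<in> T \<Longrightarrow> F (G y) = y"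
  shows "diffeomorphism (submanifold S :: ('a, 'e) mfd) (submanifold T :: ('b, 'd) mfd) F"
proof -
  have bij: "bij_betw F S T"
    by (rule bij_betw_byWitness[where f' = G]) (use F G GF FG in auto)
  have inv: "inv_into S F y = G y" if "y \<in> T" for y
    using that G(2) FG bij by (intro inv_into_f_eq) (auto simp: bij_betw_def)
  have "smooth_on_subset T (inv_into S F)"
    using G(1) by (rule smooth_on_subset_cong[THEN iffD2, rotated]) (rule inv)
  then have "smooth_map (submanifold T :: ('b, 'd) mfd) (submanifold S :: ('a, 'e) mfd) (inv_into S F)"
    by (rule smooth_map_submanifold[OF _ _ T S]) (use inv G(2) in auto)
  then show ?thesis
    unfolding diffeomorphism_def using S T bij smooth_map_submanifold[OF F S T] by simp
qed

lemma symmetric_model: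
  "subspace {A :: real^'k^'k. transpose A = A}"
  "dim {A :: real^'k::finite^'k. transpose A = A} = DIM(real^('k, 'k) psd_dim)"
  by (simp add: subspace_def mm_rules) (simp add: dim_symmetric card_psd_dim)

lemma smooth_manifold_spd:
  "smooth_manifold (submanifold spd :: (real^'k^'k, real^('k::finite, 'k) psd_dim) mfd)"
proof (rule smooth_manifold_submanifold)
  fix D :: "real^'k^'k" assume D: "D \<in> spd"
  have eq: "spd = {A :: real^'k^'k. transpose A = A} \<inter> posdef" by (auto simp: spd_iff)
  have "\<exists>g. (spd, g) \<in> snd (submanifold spd :: (real^'k^'k, real^('k, 'k) psd_dim) mfd)"
    by (rule submanifold_chart_of_parametrization[OF _ symmetric_model open_posdef,
          where f = "\<lambda>x. x" and b = "\<lambda>x. x"])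
       (auto simp: eq)
  then show "\<exists>U f. (U, f) \<in> snd (submanifold spd :: (real^'k^'k, real^('k, 'k) psd_dim) mfd) \<and> D \<in> U"
    using D by blast
qed

text \<open>An orthonormal basis \<open>Q\<close> of \<open>V\<close> identifies the matrices with column space \<open>V\<close> linearly with
  \<open>k \<times> k\<close> matrices, by \<open>S \<mapsto> Q\<^sup>T S Q\<close> and \<open>D \<mapsto> Q D Q\<^sup>T\<close>.\<close>

lemma diffeomorphic_fibre:
  fixes V :: "(real^'n) set"
  assumes V: "V \<in> grassmannian CARD('k::finite)"
  shows "diffeomorphic (Sym_fiber_mfd TYPE('k) V) (spd_mfd :: (real^'k^'k, real^('k, 'k) psd_dim) mfd)"
proof -
  obtain Q :: "real^'k^'n" where Q: "Q \<in> stiefel" "range ((*v) Q) = V"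
    using V stiefel_with_range by (auto simp: grassmannian_def)
  note q = stiefelD[OF Q(1)]
  let ?F = "{S \<in> psd_rank CARD('k). proj_Sym S = V}"
  let ?f = "\<lambda>S. transpose Q ** S ** Q" and ?b = "\<lambda>D. Q ** D ** transpose Q"
  have f: "?f S \<in> spd" "?b (?f S) = S" if "S \<in> ?F" for S
    using psd_rank_stiefel_decomposition[OF Q(1), of S] that Q(2) by (auto simp: proj_Sym_def)
  have b: "?b D \<in> ?F" "?f (?b D) = D" if "D \<in> spd" for D
    using that congruence_psd_rank[OF q that] congruence_range[OF q that] Q(2)
    by (simp_all add: proj_Sym_def mm_rules q mm_lift[OF q])
  have sm: "smooth_on_subset X ?f" "smooth_on_subset Z ?b" for X Z
    by (intro smooth_rules)+
  have eq: "{A :: real^'k^'k. transpose A = A} \<inter> posdef = spd" by (auto simp: spd_iff)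
  have im: "?f ` ?F \<subseteq> spd" "?b ` spd \<subseteq> ?F" using f b by blast+
  have F: "smooth_manifold (submanifold ?F :: (real^'n^'n, real^('k, 'k) psd_dim) mfd)"
  proof (rule smooth_manifold_submanifold)
    fix S assume S: "S \<in> ?F"
    have "openin (top_of_set ?F) ?F" by simp
    then have "\<exists>g. (?F, g) \<in> snd (submanifold ?F :: (real^'n^'n, real^('k, 'k) psd_dim) mfd)"
      by (rule submanifold_chart_of_parametrization[OF _ symmetric_model open_posdef sm(1) _ sm(2),
            unfolded eq, OF _ im f(2) b(2)])
    then show "\<exists>U f. (U, f) \<in> snd (submanifold ?F :: (real^'n^'n, real^('k, 'k) psd_dim) mfd) \<and> S \<in> U"
      using S by blast
  qed
  have "diffeomorphism (submanifold ?F :: (real^'n^'n, real^('k, 'k) psd_dim) mfd)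
      (submanifold spd :: (real^'k^'k, real^('k, 'k) psd_dim) mfd) ?f"
    by (rule diffeomorphism_submanifold[OF F smooth_manifold_spd sm(1) im(1) sm(2) im(2) f(2) b(2)])
  then show ?thesis unfolding diffeomorphic_def Sym_fiber_mfd_def spd_mfd_def by blast
qed

lemma proj_Sym_phi:
  fixes C :: "((real^'k^'n) \<times> (real^'k^'k)) set"
  assumes "C \<in> M_set"
  shows "proj_Sym (phi C) = proj_M C"
proof -
  obtain Q D where C: "Q \<in> stiefel" "D \<in> spd" "C = cls (Q, D)"
    using assms unfolding M_set_eq by blast
  then have "proj_Sym (phi C) = range ((*v) Q)"
    using congruence_range[OF stiefelD[OF C(1)] C(2)] by (simp add: phi_cls proj_Sym_def)
  also have "\<dots> = proj_M C" using C by (simp add: proj_M_cls span_columns_eq_range)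
  finally show ?thesis .
qed

theorem theorem1:
  assumes "CARD('k::finite) \<le> CARD('n::finite)"
  shows "diffeomorphism
           (M_mfd :: (((real^'k^'n) \<times> (real^'k^'k)) set, real^('n, 'k) psd_dim) mfd)
           (psd_mfd TYPE('k)) phi
       \<and> (\<forall>C\<in>(M_set :: ((real^'k^'n) \<times> (real^'k^'k)) set set). proj_Sym (phi C) = proj_M C)
       \<and> (\<forall>V\<in>(grassmannian CARD('k) :: (real^'n) set set).
            diffeomorphic (Sym_fiber_mfd TYPE('k) V) (spd_mfd :: (real^'k^'k, real^('k, 'k) psd_dim) mfd))"
  using diffeomorphism_phi proj_Sym_phi diffeomorphic_fibre by blast

end
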